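(* Let $\mathsf{Spec}=(\mathsf{CMod},\mathsf{OpSpec})$ be a basic storage specification, i.e. $\mathsf{CMod}$ is a basic consistency model and $\mathsf{OpSpec}$ is a basic operation specification. The following statements are equivalent: (1) $\mathsf{CMod}$ is arbitration-free w.r.t. $\mathsf{OpSpec}$; (2) there exists an available $\mathsf{Spec}$-implementation.
   Context: **Events.** Fix an infinite set $\mathsf{Objs}$ of objects, a set $\mathsf{Vals}$ of values and a set $\mathsf{Reps}$ of (two or more) replica identifiers. An event is a tuple $e=(\mathsf{id},\mathsf{r},\mathsf{op},\mathsf{wval},\mathsf{m})$: identifier, replica $\mathrm{rep}(e)=\mathsf r$, operation name, a partial map $\mathsf{wval}(e):\mathsf{Objs}\rightharpoonup\mathsf{Vals}$ of the values it writes, and metadata. Each event accesses a fixed finite set of objects $\mathrm{obj}(e)$. There are distinguished initial events, which write every object. "$e$ writes $x$" means $\mathsf{wval}(e)(x)$ is defined. **Histories.** A history $(E,\mathsf{so},\mathsf{wr})$ is a finite set $E$ of events, a strict partial order $\mathsf{so}$ on $E$ and, for each object $x$, a relation $\mathsf{wr}_x\subseteq\mathcal P(E)\times E$ such that: $E$ contains exactly one initial event $\mathbf{init}$, which $\mathsf{so}$-precedes all others; non-initial $e,e'$ are $\mathsf{so}$-ordered iff $\mathrm{rep}(e)=\mathrm{rep}(e')$; the inverse $\mathsf{wr}_x^{-1}:E\to\mathcal P(E)$ is a total function; $\mathsf{so}\cup\mathsf{wr}$ is acyclic, where on pairs of events $(w,r)\in\mathsf{wr}_x$ iff $w\in\mathsf{wr}_x^{-1}(r)$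 and $\mathsf{wr}=\bigcup_x\mathsf{wr}_x$. **Abstract executions.** An abstract execution $\xi=(h,\mathsf{rb},\mathsf{ar})$ is a history $h=(E,\mathsf{so},\mathsf{wr})$ with an asymmetric irreflexive relation $\mathsf{rb}$ (receive-before) and a strict total order $\mathsf{ar}$ (arbitration) on $E$ with $\mathsf{rb}=\mathsf{rb};\mathsf{so}^*$ and $\mathsf{so}\cup\mathsf{wr}\subseteq\mathsf{rb}\subseteq\mathsf{ar}$. **Basic consistency models.** A basic visibility formula $\mathsf v$, parametrized by an object $x$, has the form $\mathsf v_x(\varepsilon_0,\varepsilon_n):=\exists\varepsilon_1,\dots,\varepsilon_{n-1}.\ \bigwedge_{i=1}^n(\varepsilon_{i-1},\varepsilon_i)\in\mathsf{Rel}_i^{\mathsf v}\wedge(\varepsilon_0\text{ writes }x)\wedge\mathsf{wr}_x^{-1}(\varepsilon_n)\ne\emptyset$, each $\mathsf{Rel}_i^{\mathsf v}$ generated by $\mathsf{Rel}::=\mathrm{id}\mid\mathsf{so}\mid\mathsf{wr}\mid\mathsf{rb}\mid\mathsf{ar}\mid\mathsf{Rel}\cup\mathsf{Rel}\mid\mathsf{Rel};\mathsf{Rel}\mid\mathsf{Rel}^?\mid\mathsf{Rel}^+\mid\mathsf{Rel}^*$. A basic consistency model is a non-empty set $\mathsf{CMod}$ of such formulas; it is always assumed to include formulas $\mathsf v^{\mathsf{so}},\mathsf v^{\mathsf{wr}}$ with $\mathsf{so}\subseteq\mathsf v^{\mathsf{so}}_x$ and $\mathsf{wr}_x\subseteq\mathsf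 v^{\mathsf{wr}}_x$ for all $x$ (for pairs whose first event writes $x$ and second reads $x$). The context of $r$ for $x$, $\mathsf{ctxt}_x(r,[\xi,\mathsf{CMod}])$, is the set $\{e\in\xi\mid\exists\mathsf v\in\mathsf{CMod}.\ \mathsf v_x(e,r)\text{ holds in }\xi\}$ with the restrictions of $\mathsf{rb},\mathsf{ar}$ to it. **Basic operation specifications.** $\mathsf{OpSpec}=(E,\mathsf{rspec},\mathsf{wspec})$: $E$ is a set of events (non-initial ones having singleton $\mathrm{obj}(e)$), denoted $\mathsf{Events}[\mathsf{OpSpec}]$; $\mathsf{rspec}$ is a predicate on events ($e$ is a read event if it holds); $\mathsf{wspec}$ assigns to some non-initial events $e$ (the write events) a partial function $\mathsf{wspec}(e):\mathsf{Vals}\rightharpoonup\mathsf{Vals}$ from the value read to the value written. A read-write event is both a read and a write event; it is unconditional if $\mathsf{wspec}(e)$ is total, conditional otherwise. Standing assumptions: $\mathsf{wspec}(e)$, when defined, has non-empty domain; for every value $v$ some $e$ has $\mathsf{wspec}(e)(v)$ defined; if $e$ is a write but not a read event, $\mathsf{wspec}(e)$ is a total constant function; $E$ contains a read event and a write event; for all $e\in E$, replicas $\mathsf r$, identifiers $\mathsf{id}$ and objects $x$ there is $e'\in E$ with that replica and identifier, $\mathrm{obj}(e')=\{x\}$, $\mathsf{rspec}(e')=\mathsf{rspec}(e)$, $\mathsf{wspec}(e')=\mathsf{wspec}(e)$; if $E$ contains read-write events then for every $v$ some read-write $e\in E$ has $\mathsf{wspec}(e)(v)$ defined; if $E$ contains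 conditional read-writes then for every $v$ some conditional read-write $e\in E$ has $\mathsf{wspec}(e)(v)$ undefined. **Validity.** $\xi$ (with event set $E_\xi$) is valid w.r.t. $(\mathsf{CMod},\mathsf{OpSpec})$ iff $E_\xi\subseteq\mathsf{Events}[\mathsf{OpSpec}]$ and for every non-initial $e\in E_\xi$ and object $x$, with $w_x^e=\max_{\mathsf{ar}}\mathsf{ctxt}_x(e,[\xi,\mathsf{CMod}])$: if $e$ is a read event and $x\in\mathrm{obj}(e)$ then $\mathsf{wr}_x^{-1}(e)=\{w_x^e\}$ and $\mathsf{wval}(e)(x)=\mathsf{wspec}(e)(\mathsf{wval}(w_x^e)(x))$ (one side defined iff the other is); otherwise $\mathsf{wr}_x^{-1}(e)=\emptyset$, and $\mathsf{wval}(e)(x)$ is the constant value of $\mathsf{wspec}(e)$ if $x\in\mathrm{obj}(e)$ (undefined if $e$ is not a write event), and undefined if $x\notin\mathrm{obj}(e)$. The initial event reads nothing. **Arbitration-freeness.** A formula is simple if each $\mathsf{Rel}_i^{\mathsf v}\in\{\mathsf{so},\mathsf{wr},\mathsf{rb},\mathsf{ar}\}$. $\mathsf v\in\mathsf{CMod}$ is vacuous w.r.t. $\mathsf{OpSpec}$ iff every abstract execution is valid w.r.t. $(\mathsf{CMod},\mathsf{OpSpec})$ iff it is valid w.r.t. $(\mathsf{CMod}\setminus\{\mathsf v\},\mathsf{OpSpec})$. A basic model is in normal form w.r.t. $\mathsf{OpSpec}$ if all its formulas are simple and none is vacuous. A normal form of $\mathsf{CMod}$ is a basic model $\mathsf{CMod}'$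 in normal form such that every abstract execution is valid w.r.t. $(\mathsf{CMod},\mathsf{OpSpec})$ iff it is valid w.r.t. $(\mathsf{CMod}',\mathsf{OpSpec})$. A formula is arbitration-free if it does not use $\mathsf{ar}$. $\mathsf{CMod}$ is arbitration-free w.r.t. $\mathsf{OpSpec}$ if all formulas of some normal form of $\mathsf{CMod}$ w.r.t. $\mathsf{OpSpec}$ are arbitration-free. **LTSs, programs, implementations.** An LTS is $(S,A,s_0,\Delta)$ with $\Delta:S\times A\rightharpoonup S$; traces are the action sequences of executions from $s_0$; for a finite trace $t$, $\Delta(t,a)$ means $\Delta$ at the final state of $t$; an LTS is finite if all its traces are finite. A program $P_E$ over a set of events $E$ is an LTS with action set $A_{\mathsf p}\supseteq E$. A storage implementation $I_E$ over $E$ is an LTS whose actions $A_{\mathsf i}$ are pairs $(e,m)$ with $e\in E$, $m:\mathsf{Objs}\rightharpoonup\mathcal P(E)$ (read dependencies of $e$), plus local actions, among them send and receive actions. Every action $a$ has a replica $\mathrm{rep}(a)$ and an identifier, so that it occurs at most once in an execution. Messages have unique identifiers; a send matches a receive if they concern the same message. A send/receive action $a$ carries a set of events $\mathsf{rb}\text{-}\mathrm{Set}(a)$, equal for matching actions, each of which occurs in an action $(e,\_)$ earlier in the trace. The composition $I_E\parallel P_E$ is the LTS on pairs of states in which an action $(e,m)$ of $I_E$ is executed jointly with the action $e$ of $P_E$ (both must be enabled), while other actions of $I_E$, and actions of $P_E$ not in $E$, are executed by one component alone. A finite trace $t$ induces the history whose events are $\mathbf{init}$ and the $e$ with some $(e,m)$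 in $t$, $\mathsf{so}^t$ ordering events of the same replica as in $t$ (with $\mathbf{init}$ first) and $(\mathsf{wr}^t_x)^{-1}(e)=m(x)$ ($\emptyset$ if undefined); and $\mathsf{rb}^t$: $(e,e')\in\mathsf{rb}^t$ iff $(e,e')\in\mathsf{so}^t$ or there are matching send $a_s$ and receive $a_r$ in $t$ with $e\in\mathsf{rb}\text{-}\mathrm{Set}(a_s)$, $\mathrm{rep}(a_r)=\mathrm{rep}(e')$ and $a_r$ before the action $(e',\_)$ in $t$. The abstract executions induced by $t$ are this history with $\mathsf{rb}^t$ and any total order $\mathsf{ar}^t\supseteq\mathsf{rb}^t$. $I_E$ with $E=\mathsf{Events}[\mathsf{OpSpec}]$ is a $\mathsf{Spec}$-implementation if every trace of $I_E$ induces some abstract execution valid w.r.t. $\mathsf{Spec}$. **Availability.** A replica $r$ is waiting in a trace $t$ of $I_E\parallel P_E$ if (i) some $a\in A_{\mathsf p}$ with $\mathrm{rep}(a)=r$ is enabled in $P_E$ after $t'$, where $t'$ is $t$ with local actions of $I_E$ removed and each $(e',m)$ replaced by $e'$, and (ii) every $a\in A_{\mathsf p}\cup A_{\mathsf i}$ with $\mathrm{rep}(a)=r$ that is not a receive action is disabled in $I_E\parallel P_E$ after $t$. $I_E$ is available if for every finite program $P_E$ the composition $I_E\parallel P_E$ is finite, and for every program $P_E$ and trace $t$ of $I_E\parallel P_E$ no replica is waiting in $t$.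
   Formalization: Identifiers are assumed infinite; E must contain, for each event and each value read, the same event with the prescribed written value; programs enabling an event enable all its variants differing only in wval (otherwise a fetch-and-add with a wrong wval makes (2) fail). *)

theory Defs
  imports Main
begin

section \<open>Events, histories, abstract executions\<close>

record ('id, 'rep, 'op, 'obj, 'val, 'meta) event =
  ev_id   :: 'id
  ev_rep  :: 'rep
  ev_op   :: 'op
  ev_wval :: "'obj \<Rightarrow> 'val option"
  ev_meta :: 'meta

definition writes :: "('id, 'rep, 'op, 'obj, 'val, 'meta) event \<Rightarrow> 'obj \<Rightarrow> bool" where
  "writes e x \<longleftrightarrow> ev_wval e x \<noteq> None"

text \<open>The distinguished initial events \<open>Init\<close> and the function \<open>obj\<close> giving the objects
  accessed by an event are parameters. The finiteness requirement concerns non-initial events: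
  an initial event writes all (infinitely many) objects.\<close>

definition event_universe ::
  "('id, 'rep, 'op, 'obj, 'val, 'meta) event set \<Rightarrow>
   (('id, 'rep, 'op, 'obj, 'val, 'meta) event \<Rightarrow> 'obj set) \<Rightarrow> bool" where
  "event_universe Init obj \<longleftrightarrow>
     (\<forall>e\<in>Init. \<forall>x. writes e x) \<and> (\<forall>e. e \<notin> Init \<longrightarrow> finite (obj e))"

text \<open>The relations \<open>wr\<^sub>x\<close> are given by their inverses, which are total functions
  from events to sets of events: \<open>h_wrinv h x e\<close> is the set of events from which \<open>e\<close> reads
  \<open>x\<close>. Its values at events outside \<open>h_events h\<close> are irrelevant.\<close>

record ('id, 'rep, 'op, 'obj, 'val, 'meta) history =
  h_events :: "('id, 'rep, 'op, 'obj, 'val, 'meta) event set"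
  h_so     :: "('id, 'rep, 'op, 'obj, 'val, 'meta) event rel"
  h_wrinv  :: "'obj \<Rightarrow> ('id, 'rep, 'op, 'obj, 'val, 'meta) event
                 \<Rightarrow> ('id, 'rep, 'op, 'obj, 'val, 'meta) event set"

definition h_wr ::
  "('id, 'rep, 'op, 'obj, 'val, 'meta) history \<Rightarrow> ('id, 'rep, 'op, 'obj, 'val, 'meta) event rel"
where
  "h_wr h = {(w, r). r \<in> h_events h \<and> (\<exists>x. w \<in> h_wrinv h x r)}"

definition is_history ::
  "('id, 'rep, 'op, 'obj, 'val, 'meta) event set \<Rightarrow>
   ('id, 'rep, 'op, 'obj, 'val, 'meta) history \<Rightarrow> bool" where
  "is_history Init h \<longleftrightarrow>
     finite (h_events h) \<and>
     h_so h \<subseteq> h_events h \<times> h_events h \<and> irrefl (h_so h) \<and> trans (h_so h) \<and>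
     (\<exists>i. h_events h \<inter> Init = {i} \<and> (\<forall>e \<in> h_events h - {i}. (i, e) \<in> h_so h)) \<and>
     (\<forall>e \<in> h_events h - Init. \<forall>e' \<in> h_events h - Init. e \<noteq> e' \<longrightarrow>
        ((e, e') \<in> h_so h \<or> (e', e) \<in> h_so h \<longleftrightarrow> ev_rep e = ev_rep e')) \<and>
     (\<forall>x. \<forall>e \<in> h_events h. h_wrinv h x e \<subseteq> h_events h) \<and>
     acyclic (h_so h \<union> h_wr h)"

record ('id, 'rep, 'op, 'obj, 'val, 'meta) execution =
  x_hist :: "('id, 'rep, 'op, 'obj, 'val, 'meta) history"
  x_rb   :: "('id, 'rep, 'op, 'obj, 'val, 'meta) event rel"
  x_ar   :: "('id, 'rep, 'op, 'obj, 'val, 'meta) event rel"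

abbreviation x_events where "x_events \<xi> \<equiv> h_events (x_hist \<xi>)"
abbreviation x_so where "x_so \<xi> \<equiv> h_so (x_hist \<xi>)"
abbreviation x_wr where "x_wr \<xi> \<equiv> h_wr (x_hist \<xi>)"
abbreviation x_wrinv where "x_wrinv \<xi> \<equiv> h_wrinv (x_hist \<xi>)"

definition is_execution ::
  "('id, 'rep, 'op, 'obj, 'val, 'meta) event set \<Rightarrow>
   ('id, 'rep, 'op, 'obj, 'val, 'meta) execution \<Rightarrow> bool" where
  "is_execution Init \<xi> \<longleftrightarrow>
     is_history Init (x_hist \<xi>) \<and>
     asym (x_rb \<xi>) \<and> irrefl (x_rb \<xi>) \<and>
     x_ar \<xi> \<subseteq> x_events \<xi> \<times> x_events \<xi> \<and> strict_linear_order_on (x_events \<xi>) (x_ar \<xi>) \<and>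
     x_rb \<xi> = x_rb \<xi> O (x_so \<xi>)\<^sup>* \<and>
     x_so \<xi> \<union> x_wr \<xi> \<subseteq> x_rb \<xi> \<and> x_rb \<xi> \<subseteq> x_ar \<xi>"


section \<open>Basic consistency models\<close>

datatype relexp =
    RId | RSo | RWr | RRb | RAr
  | RUnion relexp relexp | RComp relexp relexp | ROpt relexp | RPlus relexp | RStar relexp

primrec rel_sem ::
  "('id, 'rep, 'op, 'obj, 'val, 'meta) execution \<Rightarrow> relexp \<Rightarrow>
   ('id, 'rep, 'op, 'obj, 'val, 'meta) event rel" where
  "rel_sem \<xi> RId = Id_on (x_events \<xi>)"
| "rel_sem \<xi> RSo = x_so \<xi>"
| "rel_sem \<xi> RWr = x_wr \<xi>"
| "rel_sem \<xi> RRb = x_rb \<xi>"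
| "rel_sem \<xi> RAr = x_ar \<xi>"
| "rel_sem \<xi> (RUnion R S) = rel_sem \<xi> R \<union> rel_sem \<xi> S"
| "rel_sem \<xi> (RComp R S) = rel_sem \<xi> R O rel_sem \<xi> S"
| "rel_sem \<xi> (ROpt R) = Id_on (x_events \<xi>) \<union> rel_sem \<xi> R"
| "rel_sem \<xi> (RPlus R) = (rel_sem \<xi> R)\<^sup>+"
| "rel_sem \<xi> (RStar R) = Id_on (x_events \<xi>) \<union> (rel_sem \<xi> R)\<^sup>+"

text \<open>A visibility formula is determined by the sequence \<open>Rel\<^sub>1, \<dots>, Rel\<^sub>n\<close>;
  \<open>n \<ge> 1\<close> is imposed in \<open>is_basic_model\<close>.\<close>

type_synonym vformula = "relexp list"

definition vis ::
  "('id, 'rep, 'op, 'obj, 'val, 'meta) execution \<Rightarrow> vformula \<Rightarrow> 'obj \<Rightarrow>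
   ('id, 'rep, 'op, 'obj, 'val, 'meta) event \<Rightarrow>
   ('id, 'rep, 'op, 'obj, 'val, 'meta) event \<Rightarrow> bool" where
  "vis \<xi> v x e r \<longleftrightarrow>
     e \<in> x_events \<xi> \<and> r \<in> x_events \<xi> \<and>
     (\<exists>\<epsilon>. \<epsilon> 0 = e \<and> \<epsilon> (length v) = r \<and>
          (\<forall>k < length v. (\<epsilon> k, \<epsilon> (Suc k)) \<in> rel_sem \<xi> (v ! k))) \<and>
     writes e x \<and> x_wrinv \<xi> x r \<noteq> {}"

definition is_basic_model ::
  "('id, 'rep, 'op, 'obj, 'val, 'meta) event set \<Rightarrow> vformula set \<Rightarrow> bool" where
  "is_basic_model Init CMod \<longleftrightarrow>
     CMod \<noteq> {} \<and> (\<forall>v\<in>CMod. v \<noteq> []) \<and>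
     (\<exists>v\<in>CMod. \<forall>\<xi>. is_execution Init \<xi> \<longrightarrow>
        (\<forall>x e r. (e, r) \<in> x_so \<xi> \<and> writes e x \<and> x_wrinv \<xi> x r \<noteq> {} \<longrightarrow> vis \<xi> v x e r)) \<and>
     (\<exists>v\<in>CMod. \<forall>\<xi>. is_execution Init \<xi> \<longrightarrow>
        (\<forall>x e. \<forall>r \<in> x_events \<xi>. e \<in> x_wrinv \<xi> x r \<and> writes e x \<longrightarrow> vis \<xi> v x e r))"

definition ctxt ::
  "('id, 'rep, 'op, 'obj, 'val, 'meta) execution \<Rightarrow> vformula set \<Rightarrow> 'obj \<Rightarrow>
   ('id, 'rep, 'op, 'obj, 'val, 'meta) event \<Rightarrow>
   ('id, 'rep, 'op, 'obj, 'val, 'meta) event set" where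
  "ctxt \<xi> CMod x r = {e \<in> x_events \<xi>. \<exists>v\<in>CMod. vis \<xi> v x e r}"

definition is_max_in :: "'a rel \<Rightarrow> 'a set \<Rightarrow> 'a \<Rightarrow> bool" where
  "is_max_in R A w \<longleftrightarrow> w \<in> A \<and> (\<forall>w'\<in>A. w' \<noteq> w \<longrightarrow> (w', w) \<in> R)"


section \<open>Basic operation specifications\<close>

record ('id, 'rep, 'op, 'obj, 'val, 'meta) opspec =
  os_events :: "('id, 'rep, 'op, 'obj, 'val, 'meta) event set"
  os_rspec  :: "('id, 'rep, 'op, 'obj, 'val, 'meta) event \<Rightarrow> bool"
  os_wspec  :: "('id, 'rep, 'op, 'obj, 'val, 'meta) event \<Rightarrow> ('val \<Rightarrow> 'val option) option"

definition calls ::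
  "('id, 'rep, 'op, 'obj, 'val, 'meta) event set \<Rightarrow>
   ('id, 'rep, 'op, 'obj, 'val, 'meta) opspec \<Rightarrow>
   ('id, 'rep, 'op, 'obj, 'val, 'meta) event set" where
  "calls Init Op = os_events Op - Init"

definition is_rw ::
  "('id, 'rep, 'op, 'obj, 'val, 'meta) opspec \<Rightarrow>
   ('id, 'rep, 'op, 'obj, 'val, 'meta) event \<Rightarrow> bool" where
  "is_rw Op e \<longleftrightarrow> os_rspec Op e \<and> os_wspec Op e \<noteq> None"

text \<open>The value written by \<open>e\<close> after reading \<open>v\<close> (\<open>None\<close> if \<open>e\<close> then writes nothing).\<close>

definition outcome ::
  "('id, 'rep, 'op, 'obj, 'val, 'meta) opspec \<Rightarrow>
   ('id, 'rep, 'op, 'obj, 'val, 'meta) event \<Rightarrow> 'val \<Rightarrow> 'val option" where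
  "outcome Op e v = (case os_wspec Op e of None \<Rightarrow> None | Some f \<Rightarrow> f v)"

definition is_conditional_rw ::
  "('id, 'rep, 'op, 'obj, 'val, 'meta) opspec \<Rightarrow>
   ('id, 'rep, 'op, 'obj, 'val, 'meta) event \<Rightarrow> bool" where
  "is_conditional_rw Op e \<longleftrightarrow> is_rw Op e \<and> (\<exists>v. outcome Op e v = None)"

text \<open>Whether and what a read-write event writes depends on the value it reads, hence on the
  execution. Events that are equal up to \<open>ev_wval\<close> are the possible outcomes of one and the same
  call of an operation.\<close>

definition same_call ::
  "(('id, 'rep, 'op, 'obj, 'val, 'meta) event \<Rightarrow> 'obj set) \<Rightarrow>
   ('id, 'rep, 'op, 'obj, 'val, 'meta) opspec \<Rightarrow>
   ('id, 'rep, 'op, 'obj, 'val, 'meta) event \<Rightarrow>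
   ('id, 'rep, 'op, 'obj, 'val, 'meta) event \<Rightarrow> bool" where
  "same_call obj Op e e' \<longleftrightarrow>
     e' = e\<lparr>ev_wval := ev_wval e'\<rparr> \<and>
     obj e' = obj e \<and> os_rspec Op e' = os_rspec Op e \<and> os_wspec Op e' = os_wspec Op e"

text \<open>The last conjunct makes explicit that an operation specification contains, with each event,
  every outcome that its write specification prescribes for the same call.\<close>

definition is_basic_opspec ::
  "('id, 'rep, 'op, 'obj, 'val, 'meta) event set \<Rightarrow>
   (('id, 'rep, 'op, 'obj, 'val, 'meta) event \<Rightarrow> 'obj set) \<Rightarrow>
   ('id, 'rep, 'op, 'obj, 'val, 'meta) opspec \<Rightarrow> bool" where
  "is_basic_opspec Init obj Op \<longleftrightarrow>
     (\<forall>e \<in> calls Init Op. \<exists>x. obj e = {x}) \<and>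
     (\<forall>e \<in> os_events Op. os_wspec Op e \<noteq> None \<longrightarrow> e \<notin> Init) \<and>
     (\<forall>e \<in> os_events Op. \<forall>f. os_wspec Op e = Some f \<longrightarrow> dom f \<noteq> {}) \<and>
     (\<forall>v. \<exists>e \<in> os_events Op. outcome Op e v \<noteq> None) \<and>
     (\<forall>e \<in> calls Init Op. os_wspec Op e \<noteq> None \<and> \<not> os_rspec Op e \<longrightarrow>
        (\<exists>c. os_wspec Op e = Some (\<lambda>_. Some c))) \<and>
     (\<exists>e \<in> calls Init Op. os_rspec Op e) \<and>
     (\<exists>e \<in> calls Init Op. os_wspec Op e \<noteq> None) \<and>
     (\<forall>e \<in> calls Init Op. \<forall>r i x. \<exists>e' \<in> calls Init Op.
        ev_rep e' = r \<and> ev_id e' = i \<and> obj e' = {x} \<and>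
        os_rspec Op e' = os_rspec Op e \<and> os_wspec Op e' = os_wspec Op e) \<and>
     ((\<exists>e \<in> calls Init Op. is_rw Op e) \<longrightarrow>
        (\<forall>v. \<exists>e \<in> calls Init Op. is_rw Op e \<and> outcome Op e v \<noteq> None)) \<and>
     ((\<exists>e \<in> calls Init Op. is_conditional_rw Op e) \<longrightarrow>
        (\<forall>v. \<exists>e \<in> calls Init Op. is_conditional_rw Op e \<and> outcome Op e v = None)) \<and>
     (\<forall>e \<in> calls Init Op. \<forall>v. \<exists>e' \<in> calls Init Op. same_call obj Op e e' \<and>
        ev_wval e' = (\<lambda>x. if x \<in> obj e then outcome Op e v else None))"


section \<open>Validity and arbitration-freeness\<close>

text \<open>In the second case \<open>e\<close> is not a read event or does not access \<open>x\<close>; a write event that is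
  not a read event has a constant write specification, so \<open>outcome Op e v\<close> is that constant for
  every \<open>v\<close>, and it is \<open>None\<close> if \<open>e\<close> is not a write event.\<close>

definition valid ::
  "('id, 'rep, 'op, 'obj, 'val, 'meta) event set \<Rightarrow>
   (('id, 'rep, 'op, 'obj, 'val, 'meta) event \<Rightarrow> 'obj set) \<Rightarrow>
   vformula set \<Rightarrow> ('id, 'rep, 'op, 'obj, 'val, 'meta) opspec \<Rightarrow>
   ('id, 'rep, 'op, 'obj, 'val, 'meta) execution \<Rightarrow> bool" where
  "valid Init obj CMod Op \<xi> \<longleftrightarrow>
     x_events \<xi> \<subseteq> os_events Op \<and>
     (\<forall>e \<in> x_events \<xi> \<inter> Init. \<forall>x. x_wrinv \<xi> x e = {}) \<and>
     (\<forall>e \<in> x_events \<xi> - Init. \<forall>x.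
        if os_rspec Op e \<and> x \<in> obj e
        then \<exists>w. is_max_in (x_ar \<xi>) (ctxt \<xi> CMod x e) w \<and>
                 x_wrinv \<xi> x e = {w} \<and>
                 ev_wval e x = Option.bind (ev_wval w x) (outcome Op e)
        else x_wrinv \<xi> x e = {} \<and>
             (if x \<in> obj e then \<forall>v. ev_wval e x = outcome Op e v else ev_wval e x = None))"

definition equivalent_models ::
  "('id, 'rep, 'op, 'obj, 'val, 'meta) event set \<Rightarrow>
   (('id, 'rep, 'op, 'obj, 'val, 'meta) event \<Rightarrow> 'obj set) \<Rightarrow>
   ('id, 'rep, 'op, 'obj, 'val, 'meta) opspec \<Rightarrow> vformula set \<Rightarrow> vformula set \<Rightarrow> bool" where
  "equivalent_models Init obj Op C C' \<longleftrightarrow>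
     (\<forall>\<xi>. is_execution Init \<xi> \<longrightarrow> (valid Init obj C Op \<xi> \<longleftrightarrow> valid Init obj C' Op \<xi>))"

definition simple :: "vformula \<Rightarrow> bool" where
  "simple v \<longleftrightarrow> set v \<subseteq> {RSo, RWr, RRb, RAr}"

definition vacuous ::
  "('id, 'rep, 'op, 'obj, 'val, 'meta) event set \<Rightarrow>
   (('id, 'rep, 'op, 'obj, 'val, 'meta) event \<Rightarrow> 'obj set) \<Rightarrow>
   ('id, 'rep, 'op, 'obj, 'val, 'meta) opspec \<Rightarrow> vformula set \<Rightarrow> vformula \<Rightarrow> bool" where
  "vacuous Init obj Op CMod v \<longleftrightarrow> equivalent_models Init obj Op CMod (CMod - {v})"

definition in_normal_form ::
  "('id, 'rep, 'op, 'obj, 'val, 'meta) event set \<Rightarrow>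
   (('id, 'rep, 'op, 'obj, 'val, 'meta) event \<Rightarrow> 'obj set) \<Rightarrow>
   ('id, 'rep, 'op, 'obj, 'val, 'meta) opspec \<Rightarrow> vformula set \<Rightarrow> bool" where
  "in_normal_form Init obj Op CMod \<longleftrightarrow>
     is_basic_model Init CMod \<and> (\<forall>v\<in>CMod. simple v \<and> \<not> vacuous Init obj Op CMod v)"

definition is_normal_form_of ::
  "('id, 'rep, 'op, 'obj, 'val, 'meta) event set \<Rightarrow>
   (('id, 'rep, 'op, 'obj, 'val, 'meta) event \<Rightarrow> 'obj set) \<Rightarrow>
   ('id, 'rep, 'op, 'obj, 'val, 'meta) opspec \<Rightarrow> vformula set \<Rightarrow> vformula set \<Rightarrow> bool" where
  "is_normal_form_of Init obj Op CMod' CMod \<longleftrightarrow>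
     in_normal_form Init obj Op CMod' \<and> equivalent_models Init obj Op CMod CMod'"

primrec uses_ar :: "relexp \<Rightarrow> bool" where
  "uses_ar RId = False"
| "uses_ar RSo = False"
| "uses_ar RWr = False"
| "uses_ar RRb = False"
| "uses_ar RAr = True"
| "uses_ar (RUnion R S) = (uses_ar R \<or> uses_ar S)"
| "uses_ar (RComp R S) = (uses_ar R \<or> uses_ar S)"
| "uses_ar (ROpt R) = uses_ar R"
| "uses_ar (RPlus R) = uses_ar R"
| "uses_ar (RStar R) = uses_ar R"

definition arbitration_free_formula :: "vformula \<Rightarrow> bool" where
  "arbitration_free_formula v \<longleftrightarrow> (\<forall>R \<in> set v. \<not> uses_ar R)"

definition arbitration_free ::
  "('id, 'rep, 'op, 'obj, 'val, 'meta) event set \<Rightarrow>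
   (('id, 'rep, 'op, 'obj, 'val, 'meta) event \<Rightarrow> 'obj set) \<Rightarrow>
   ('id, 'rep, 'op, 'obj, 'val, 'meta) opspec \<Rightarrow> vformula set \<Rightarrow> bool" where
  "arbitration_free Init obj Op CMod \<longleftrightarrow>
     (\<exists>CMod'. is_normal_form_of Init obj Op CMod' CMod \<and>
              (\<forall>v\<in>CMod'. arbitration_free_formula v))"


section \<open>Labelled transition systems\<close>

record ('s, 'a) lts =
  states  :: "'s set"
  actions :: "'a set"
  start   :: 's
  trans   :: "'s \<Rightarrow> 'a \<Rightarrow> 's option"

hide_const (open) trans

definition is_lts :: "('s, 'a) lts \<Rightarrow> bool" where
  "is_lts L \<longleftrightarrow> start L \<in> states L \<and>
     (\<forall>s a s'. lts.trans L s a = Some s' \<longrightarrow> s \<in> states L \<and> a \<in> actions L \<and> s' \<in> states L)"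

primrec run_from :: "('s, 'a) lts \<Rightarrow> 's \<Rightarrow> 'a list \<Rightarrow> 's option" where
  "run_from L s [] = Some s"
| "run_from L s (a # t) =
     (case lts.trans L s a of None \<Rightarrow> None | Some s' \<Rightarrow> run_from L s' t)"

definition is_trace :: "('s, 'a) lts \<Rightarrow> 'a list \<Rightarrow> bool" where
  "is_trace L t \<longleftrightarrow> run_from L (start L) t \<noteq> None"

definition enabled_after :: "('s, 'a) lts \<Rightarrow> 'a list \<Rightarrow> 'a \<Rightarrow> bool" where
  "enabled_after L t a \<longleftrightarrow>
     (\<exists>s. run_from L (start L) t = Some s \<and> lts.trans L s a \<noteq> None)"

definition finite_lts :: "('s, 'a) lts \<Rightarrow> bool" where
  "finite_lts L \<longleftrightarrow>
     \<not> (\<exists>\<sigma> \<alpha>. \<sigma> 0 = start L \<and> (\<forall>n::nat. lts.trans L (\<sigma> n) (\<alpha> n) = Some (\<sigma> (Suc n))))"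


section \<open>Programs\<close>

text \<open>A local action consists of its replica and its identifier, taken from a type \<open>'l\<close>.\<close>

datatype ('id, 'rep, 'op, 'obj, 'val, 'meta, 'l) paction =
    PEvent "('id, 'rep, 'op, 'obj, 'val, 'meta) event"
  | PLocal 'rep 'l

primrec pa_rep :: "('id, 'rep, 'op, 'obj, 'val, 'meta, 'l) paction \<Rightarrow> 'rep" where
  "pa_rep (PEvent e) = ev_rep e"
| "pa_rep (PLocal r l) = r"

primrec pa_ident :: "('id, 'rep, 'op, 'obj, 'val, 'meta, 'l) paction \<Rightarrow> 'id + 'l" where
  "pa_ident (PEvent e) = Inl (ev_id e)"
| "pa_ident (PLocal r l) = Inr l"

text \<open>Programs call operations and do not execute initial events. The written values are computed
  by the storage: a program that enables a call enables it with all its outcomes.\<close>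

definition is_program ::
  "('id, 'rep, 'op, 'obj, 'val, 'meta) event set \<Rightarrow>
   (('id, 'rep, 'op, 'obj, 'val, 'meta) event \<Rightarrow> 'obj set) \<Rightarrow>
   ('id, 'rep, 'op, 'obj, 'val, 'meta) opspec \<Rightarrow>
   ('s, ('id, 'rep, 'op, 'obj, 'val, 'meta, 'l) paction) lts \<Rightarrow> bool" where
  "is_program Init obj Op P \<longleftrightarrow>
     is_lts P \<and>
     {e. PEvent e \<in> actions P} = calls Init Op \<and>
     (\<forall>t. is_trace P t \<longrightarrow> distinct (map pa_ident t)) \<and>
     (\<forall>s \<in> states P. \<forall>e \<in> calls Init Op. \<forall>e' \<in> calls Init Op.
        same_call obj Op e e' \<and> lts.trans P s (PEvent e) \<noteq> None \<longrightarrow>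
        lts.trans P s (PEvent e') \<noteq> None)"


section \<open>Storage implementations\<close>

text \<open>\<open>Do e m\<close> is the action \<open>(e, m)\<close>. In \<open>Send r l n S\<close> and \<open>Receive r l n S\<close>, \<open>n\<close> is the
  message identifier and \<open>S\<close> the set \<open>rb-Set\<close> of the action.\<close>

datatype ('id, 'rep, 'op, 'obj, 'val, 'meta, 'l, 'msg) iaction =
    Do "('id, 'rep, 'op, 'obj, 'val, 'meta) event"
       "'obj \<Rightarrow> ('id, 'rep, 'op, 'obj, 'val, 'meta) event set option"
  | Send 'rep 'l 'msg "('id, 'rep, 'op, 'obj, 'val, 'meta) event set"
  | Receive 'rep 'l 'msg "('id, 'rep, 'op, 'obj, 'val, 'meta) event set"
  | Internal 'rep 'l

primrec ia_rep :: "('id, 'rep, 'op, 'obj, 'val, 'meta, 'l, 'msg) iaction \<Rightarrow> 'rep" where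
  "ia_rep (Do e m) = ev_rep e"
| "ia_rep (Send r l n S) = r"
| "ia_rep (Receive r l n S) = r"
| "ia_rep (Internal r l) = r"

primrec ia_ident :: "('id, 'rep, 'op, 'obj, 'val, 'meta, 'l, 'msg) iaction \<Rightarrow> 'id + 'l" where
  "ia_ident (Do e m) = Inl (ev_id e)"
| "ia_ident (Send r l n S) = Inr l"
| "ia_ident (Receive r l n S) = Inr l"
| "ia_ident (Internal r l) = Inr l"

primrec ia_rbset ::
  "('id, 'rep, 'op, 'obj, 'val, 'meta, 'l, 'msg) iaction \<Rightarrow>
   ('id, 'rep, 'op, 'obj, 'val, 'meta) event set" where
  "ia_rbset (Do e m) = {}"
| "ia_rbset (Send r l n S) = S"
| "ia_rbset (Receive r l n S) = S"
| "ia_rbset (Internal r l) = {}"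

definition wf_itrace ::
  "('id, 'rep, 'op, 'obj, 'val, 'meta, 'l, 'msg) iaction list \<Rightarrow> bool" where
  "wf_itrace t \<longleftrightarrow>
     distinct (map ia_ident t) \<and>
     (\<forall>r l r' l' n S S'. Send r l n S \<in> set t \<and> Send r' l' n S' \<in> set t \<longrightarrow>
        Send r l n S = Send r' l' n S') \<and>
     (\<forall>r l r' l' n S S'. Send r l n S \<in> set t \<and> Receive r' l' n S' \<in> set t \<longrightarrow> S = S') \<and>
     (\<forall>k < length t. \<forall>e \<in> ia_rbset (t ! k). \<exists>j < k. \<exists>m. t ! j = Do e m)"

definition is_implementation ::
  "('id, 'rep, 'op, 'obj, 'val, 'meta) event set \<Rightarrow>
   ('id, 'rep, 'op, 'obj, 'val, 'meta) opspec \<Rightarrow>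
   ('s, ('id, 'rep, 'op, 'obj, 'val, 'meta, 'l, 'msg) iaction) lts \<Rightarrow> bool" where
  "is_implementation Init Op I \<longleftrightarrow>
     is_lts I \<and>
     (\<forall>e m. Do e m \<in> actions I \<longrightarrow>
        e \<in> calls Init Op \<and> (\<forall>W \<in> ran m. W \<subseteq> os_events Op)) \<and>
     (\<forall>t. is_trace I t \<longrightarrow> wf_itrace t)"

definition tr_events ::
  "('id, 'rep, 'op, 'obj, 'val, 'meta, 'l, 'msg) iaction list \<Rightarrow>
   ('id, 'rep, 'op, 'obj, 'val, 'meta) event set" where
  "tr_events t = {e. \<exists>m. Do e m \<in> set t}"

definition tr_so ::
  "('id, 'rep, 'op, 'obj, 'val, 'meta) event \<Rightarrow>
   ('id, 'rep, 'op, 'obj, 'val, 'meta, 'l, 'msg) iaction list \<Rightarrow>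
   ('id, 'rep, 'op, 'obj, 'val, 'meta) event rel" where
  "tr_so i t =
     {i} \<times> tr_events t \<union>
     {(e, e'). ev_rep e = ev_rep e' \<and>
        (\<exists>j k m m'. j < k \<and> k < length t \<and> t ! j = Do e m \<and> t ! k = Do e' m')}"

definition tr_wrinv ::
  "('id, 'rep, 'op, 'obj, 'val, 'meta, 'l, 'msg) iaction list \<Rightarrow> 'obj \<Rightarrow>
   ('id, 'rep, 'op, 'obj, 'val, 'meta) event \<Rightarrow>
   ('id, 'rep, 'op, 'obj, 'val, 'meta) event set" where
  "tr_wrinv t x e = \<Union> {W. \<exists>m. Do e m \<in> set t \<and> m x = Some W}"

definition tr_rb ::
  "('id, 'rep, 'op, 'obj, 'val, 'meta) event \<Rightarrow>
   ('id, 'rep, 'op, 'obj, 'val, 'meta, 'l, 'msg) iaction list \<Rightarrow>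
   ('id, 'rep, 'op, 'obj, 'val, 'meta) event rel" where
  "tr_rb i t =
     tr_so i t \<union>
     {(e, e'). \<exists>r l n S l' S' j k m.
        Send r l n S \<in> set t \<and> e \<in> S \<and>
        j < k \<and> k < length t \<and> t ! j = Receive (ev_rep e') l' n S' \<and> t ! k = Do e' m}"

text \<open>\<open>induces Init t \<xi>\<close>: \<open>\<xi>\<close> is one of the abstract executions induced by the trace \<open>t\<close>, for
  some initial event and some arbitration order. That \<open>x_ar \<xi>\<close> is a total order containing
  \<open>x_rb \<xi>\<close> is part of \<open>is_execution\<close>.\<close>

definition induces ::
  "('id, 'rep, 'op, 'obj, 'val, 'meta) event set \<Rightarrow>
   ('id, 'rep, 'op, 'obj, 'val, 'meta, 'l, 'msg) iaction list \<Rightarrow>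
   ('id, 'rep, 'op, 'obj, 'val, 'meta) execution \<Rightarrow> bool" where
  "induces Init t \<xi> \<longleftrightarrow>
     is_execution Init \<xi> \<and>
     (\<exists>i\<in>Init.
        x_hist \<xi> = \<lparr>h_events = insert i (tr_events t), h_so = tr_so i t, h_wrinv = tr_wrinv t\<rparr> \<and>
        x_rb \<xi> = tr_rb i t)"

definition is_spec_implementation ::
  "('id, 'rep, 'op, 'obj, 'val, 'meta) event set \<Rightarrow>
   (('id, 'rep, 'op, 'obj, 'val, 'meta) event \<Rightarrow> 'obj set) \<Rightarrow>
   vformula set \<Rightarrow> ('id, 'rep, 'op, 'obj, 'val, 'meta) opspec \<Rightarrow>
   ('s, ('id, 'rep, 'op, 'obj, 'val, 'meta, 'l, 'msg) iaction) lts \<Rightarrow> bool" where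
  "is_spec_implementation Init obj CMod Op I \<longleftrightarrow>
     is_implementation Init Op I \<and>
     (\<forall>t. is_trace I t \<longrightarrow> (\<exists>\<xi>. induces Init t \<xi> \<and> valid Init obj CMod Op \<xi>))"


section \<open>Composition and availability\<close>

text \<open>In the composition, \<open>Impl (Do e m)\<close> is the joint action; \<open>Impl a\<close> for any other \<open>a\<close> is a
  local action of the implementation and \<open>Prog (PLocal r l)\<close> one of the program.\<close>

datatype ('id, 'rep, 'op, 'obj, 'val, 'meta, 'l, 'msg) caction =
    Impl "('id, 'rep, 'op, 'obj, 'val, 'meta, 'l, 'msg) iaction"
  | Prog "('id, 'rep, 'op, 'obj, 'val, 'meta, 'l) paction"

primrec ca_rep :: "('id, 'rep, 'op, 'obj, 'val, 'meta, 'l, 'msg) caction \<Rightarrow> 'rep" where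
  "ca_rep (Impl a) = ia_rep a"
| "ca_rep (Prog a) = pa_rep a"

definition is_receive :: "('id, 'rep, 'op, 'obj, 'val, 'meta, 'l, 'msg) caction \<Rightarrow> bool" where
  "is_receive a \<longleftrightarrow> (\<exists>r l n S. a = Impl (Receive r l n S))"

fun comp_trans ::
  "('s, ('id, 'rep, 'op, 'obj, 'val, 'meta, 'l, 'msg) iaction) lts \<Rightarrow>
   ('p, ('id, 'rep, 'op, 'obj, 'val, 'meta, 'l) paction) lts \<Rightarrow>
   's \<times> 'p \<Rightarrow> ('id, 'rep, 'op, 'obj, 'val, 'meta, 'l, 'msg) caction \<Rightarrow> ('s \<times> 'p) option" where
  "comp_trans I P (s, p) (Impl (Do e m)) =
     (case (lts.trans I s (Do e m), lts.trans P p (PEvent e)) of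
        (Some s', Some p') \<Rightarrow> Some (s', p')
      | _ \<Rightarrow> None)"
| "comp_trans I P (s, p) (Impl a) = map_option (\<lambda>s'. (s', p)) (lts.trans I s a)"
| "comp_trans I P (s, p) (Prog (PEvent e)) = None"
| "comp_trans I P (s, p) (Prog (PLocal r l)) =
     map_option (\<lambda>p'. (s, p')) (lts.trans P p (PLocal r l))"

definition comp ::
  "('s, ('id, 'rep, 'op, 'obj, 'val, 'meta, 'l, 'msg) iaction) lts \<Rightarrow>
   ('p, ('id, 'rep, 'op, 'obj, 'val, 'meta, 'l) paction) lts \<Rightarrow>
   ('s \<times> 'p, ('id, 'rep, 'op, 'obj, 'val, 'meta, 'l, 'msg) caction) lts" where
  "comp I P =
     \<lparr>states = states I \<times> states P,
      actions = Impl ` actions I \<union> Prog ` {a \<in> actions P. \<forall>e. a \<noteq> PEvent e},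
      start = (start I, start P),
      trans = comp_trans I P\<rparr>"

fun prog_part ::
  "('id, 'rep, 'op, 'obj, 'val, 'meta, 'l, 'msg) caction list \<Rightarrow>
   ('id, 'rep, 'op, 'obj, 'val, 'meta, 'l) paction list" where
  "prog_part [] = []"
| "prog_part (Impl (Do e m) # t) = PEvent e # prog_part t"
| "prog_part (Impl a # t) = prog_part t"
| "prog_part (Prog a # t) = a # prog_part t"

definition waiting ::
  "('s, ('id, 'rep, 'op, 'obj, 'val, 'meta, 'l, 'msg) iaction) lts \<Rightarrow>
   ('p, ('id, 'rep, 'op, 'obj, 'val, 'meta, 'l) paction) lts \<Rightarrow>
   ('id, 'rep, 'op, 'obj, 'val, 'meta, 'l, 'msg) caction list \<Rightarrow> 'rep \<Rightarrow> bool" where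
  "waiting I P t r \<longleftrightarrow>
     (\<exists>a \<in> actions P. pa_rep a = r \<and> enabled_after P (prog_part t) a) \<and>
     (\<forall>a \<in> actions (comp I P). ca_rep a = r \<and> \<not> is_receive a \<longrightarrow>
        \<not> enabled_after (comp I P) t a)"

text \<open>The states of the programs are taken from the type of finite action sequences. This is no
  restriction: transitions are functional, so every program has the same traces as its unfolding,
  in which a state is the trace leading to it, and finiteness and waiting depend on traces only.\<close>

definition available ::
  "('id, 'rep, 'op, 'obj, 'val, 'meta) event set \<Rightarrow>
   (('id, 'rep, 'op, 'obj, 'val, 'meta) event \<Rightarrow> 'obj set) \<Rightarrow>
   ('id, 'rep, 'op, 'obj, 'val, 'meta) opspec \<Rightarrow>
   ('s, ('id, 'rep, 'op, 'obj, 'val, 'meta, 'l, 'msg) iaction) lts \<Rightarrow> bool" where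
  "available Init obj Op I \<longleftrightarrow>
     (\<forall>P :: (('id, 'rep, 'op, 'obj, 'val, 'meta, 'l) paction list,
             ('id, 'rep, 'op, 'obj, 'val, 'meta, 'l) paction) lts.
        is_program Init obj Op P \<longrightarrow>
        (finite_lts P \<longrightarrow> finite_lts (comp I P)) \<and>
        (\<forall>t. is_trace (comp I P) t \<longrightarrow> (\<forall>r. \<not> waiting I P t r)))"

text \<open>Likewise, it is no restriction to take states of implementations from the type of finite
  action sequences.\<close>

type_synonym ('id, 'rep, 'op, 'obj, 'val, 'meta, 'l, 'msg) implementation =
  "(('id, 'rep, 'op, 'obj, 'val, 'meta, 'l, 'msg) iaction list,
    ('id, 'rep, 'op, 'obj, 'val, 'meta, 'l, 'msg) iaction) lts"

end

theory Submission
  imports Defs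
begin

text \<open>A formula is a set of words over \<open>so\<close>, \<open>wr\<close>, \<open>rb\<close>, \<open>ar\<close>, so that a model is equivalent to a set of
  simple formulas.

  An implementation without any communication, in which every read returns the last write of its
  own replica, satisfies every arbitration-free model: \<open>rb\<close> is then \<open>so\<close>, hence nothing else is
  visible.

  Conversely, an available implementation must execute any sequence of calls without receiving
  messages, and then every read returns the last write of its own replica. Running a store-buffering
  script on two replicas (each writes its own object and later reads that of the other replica, with
  events realizing the word in between) shows that a word using \<open>ar\<close> would force a cycle in \<open>ar\<close>,
  unless the word can never change the outcome of a read. Words of the latter kind are dropped. Among
  the remaining words a minimal equivalent set exists, because a finite execution is affected by
  finitely many words only; it is the desired normal form.\<close>

section \<open>Visibility formulas as sets of words\<close>

text \<open>Two difficulties shape the converse. A normal form has to be a basic model again, so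
  formulas covering \<open>so\<close> and \<open>wr\<close> must survive while none is vacuous, and
  this has to be achieved for a possibly infinite set of words. Moreover, using \<open>ar\<close>
  does not by itself contradict availability. The word \<open>ar;wr\<close> is harmless: a call
  accesses one object and reads it from one event, so the source of the last \<open>wr\<close> edge
  is the very write that is read, and whatever reaches that write is older. Likewise harmless are
  words that no valid execution contains, such as two consecutive \<open>wr\<close> edges when no
  event both reads and writes. Only a word that avoids these shapes has to be refuted by a run.

  In such a run neither the written values nor the arbitration order can be prescribed. The values
  are under control because reads are local: the value about to be read is known, so a conditional
  read-write can be chosen that really writes. Of \<open>ar\<close> only \<open>so\<close> is known;
  the run therefore compares events of two replicas, where the wrong orientation of a single pair
  would expose a write to a read that is known to return the initial event.\<close>

definition rel_closed :: "('id, 'rep, 'op, 'obj, 'val, 'meta) execution \<Rightarrow> bool" where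
  "rel_closed \<xi> \<longleftrightarrow>
     x_so \<xi> \<union> x_wr \<xi> \<union> x_rb \<xi> \<union> x_ar \<xi> \<subseteq> x_events \<xi> \<times> x_events \<xi>"

lemma is_execution_rel_closed: "is_execution Init \<xi> \<Longrightarrow> rel_closed \<xi>"
  unfolding is_execution_def rel_closed_def by blast

lemma rel_sem_closed:
  assumes "rel_closed \<xi>"
  shows "rel_sem \<xi> R \<subseteq> x_events \<xi> \<times> x_events \<xi>"
proof (induction R)
  case (RPlus R)
  then show ?case by (simp add: trancl_subset_Sigma)
next
  case (RStar R)
  then have "(rel_sem \<xi> R)\<^sup>+ \<subseteq> x_events \<xi> \<times> x_events \<xi>"
    by (simp add: trancl_subset_Sigma)
  then show ?case by auto
qed (use assms in \<open>auto simp: rel_closed_def\<close>)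

text \<open>Composing the letters replaces the path \<open>\<epsilon>\<close> of \<open>vis\<close>
  and makes formulas accessible to relation algebra.\<close>

primrec wsem ::
  "('id, 'rep, 'op, 'obj, 'val, 'meta) execution \<Rightarrow> vformula \<Rightarrow>
   ('id, 'rep, 'op, 'obj, 'val, 'meta) event rel" where
  "wsem \<xi> [] = Id_on (x_events \<xi>)"
| "wsem \<xi> (R # v) = rel_sem \<xi> R O wsem \<xi> v"

lemma wsem_closed: "rel_closed \<xi> \<Longrightarrow> wsem \<xi> v \<subseteq> x_events \<xi> \<times> x_events \<xi>"
  by (induction v) (use rel_sem_closed in fastforce)+

text \<open>Closure enters in the base case: \<open>wsem \<xi> []\<close> is the identity on the
  events only, which is neutral for composition because \<open>wsem \<xi> v\<close> stays inside the
  events.\<close>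

lemma wsem_append:
  assumes "rel_closed \<xi>"
  shows "wsem \<xi> (u @ v) = wsem \<xi> u O wsem \<xi> v"
proof (induction u)
  case Nil
  then show ?case using wsem_closed[OF assms, of v] by auto
qed (simp add: O_assoc)

lemma wsem_single: "rel_closed \<xi> \<Longrightarrow> wsem \<xi> [R] = rel_sem \<xi> R"
  using rel_sem_closed[of \<xi> R] by auto

lemma path_iff_wsem:
  assumes "rel_closed \<xi>" "r \<in> x_events \<xi>"
  shows "(\<exists>\<epsilon>. \<epsilon> 0 = e \<and> \<epsilon> (length v) = r \<and>
            (\<forall>k < length v. (\<epsilon> k, \<epsilon> (Suc k)) \<in> rel_sem \<xi> (v ! k))) \<longleftrightarrow> (e, r) \<in> wsem \<xi> v"
proof (induction v arbitrary: e)
  case Nil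
  show ?case using assms(2) by auto
next
  case (Cons R v)
  show ?case
  proof
    assume "\<exists>\<epsilon>. \<epsilon> 0 = e \<and> \<epsilon> (length (R # v)) = r \<and>
      (\<forall>k < length (R # v). (\<epsilon> k, \<epsilon> (Suc k)) \<in> rel_sem \<xi> ((R # v) ! k))"
    then obtain \<epsilon> where \<epsilon>: "\<epsilon> 0 = e" "\<epsilon> (Suc (length v)) = r"
      "\<And>k. k < Suc (length v) \<Longrightarrow> (\<epsilon> k, \<epsilon> (Suc k)) \<in> rel_sem \<xi> ((R # v) ! k)" by auto
    have "(\<epsilon> 1, r) \<in> wsem \<xi> v"
      using \<epsilon>(2) \<epsilon>(3)[of "Suc _"] by (subst Cons.IH[symmetric]) (intro exI[of _ "\<epsilon> \<circ> Suc"], auto)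
    moreover have "(e, \<epsilon> 1) \<in> rel_sem \<xi> R" using \<epsilon>(1) \<epsilon>(3)[of 0] by simp
    ultimately show "(e, r) \<in> wsem \<xi> (R # v)" by auto
  next
    assume "(e, r) \<in> wsem \<xi> (R # v)"
    then obtain z where z: "(e, z) \<in> rel_sem \<xi> R" "(z, r) \<in> wsem \<xi> v" by auto
    then obtain \<epsilon> where \<epsilon>: "\<epsilon> 0 = z" "\<epsilon> (length v) = r"
      "\<forall>k < length v. (\<epsilon> k, \<epsilon> (Suc k)) \<in> rel_sem \<xi> (v ! k)"
      using Cons.IH by blast
    then have "(case_nat e \<epsilon> k, case_nat e \<epsilon> (Suc k)) \<in> rel_sem \<xi> ((R # v) ! k)"
      if "k < length (R # v)" for k
      using z(1) that by (cases k) auto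
    then show "\<exists>\<epsilon>. \<epsilon> 0 = e \<and> \<epsilon> (length (R # v)) = r \<and>
      (\<forall>k < length (R # v). (\<epsilon> k, \<epsilon> (Suc k)) \<in> rel_sem \<xi> ((R # v) ! k))"
      using \<epsilon>(2) by (intro exI[of _ "case_nat e \<epsilon>"]) auto
  qed
qed

lemma vis_iff_wsem:
  assumes "rel_closed \<xi>"
  shows "vis \<xi> v x e r \<longleftrightarrow> (e, r) \<in> wsem \<xi> v \<and> writes e x \<and> x_wrinv \<xi> x r \<noteq> {}"
  using path_iff_wsem[OF assms] wsem_closed[OF assms, of v] unfolding vis_def by blast

section \<open>Relation expressions as regular languages\<close>

definition conc :: "'a list set \<Rightarrow> 'a list set \<Rightarrow> 'a list set" where
  "conc A B = {u @ v |u v. u \<in> A \<and> v \<in> B}"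

text \<open>The regular language of a relation expression over the letters \<open>so\<close>,
  \<open>wr\<close>, \<open>rb\<close>, \<open>ar\<close>, with \<open>RId\<close> as the empty
  word.\<close>

primrec lang :: "relexp \<Rightarrow> vformula set" where
  "lang RId = {[]}"
| "lang RSo = {[RSo]}"
| "lang RWr = {[RWr]}"
| "lang RRb = {[RRb]}"
| "lang RAr = {[RAr]}"
| "lang (RUnion R S) = lang R \<union> lang S"
| "lang (RComp R S) = conc (lang R) (lang S)"
| "lang (ROpt R) = insert [] (lang R)"
| "lang (RPlus R) = {concat us |us. us \<noteq> [] \<and> set us \<subseteq> lang R}"
| "lang (RStar R) = {concat us |us. set us \<subseteq> lang R}"

primrec flang :: "vformula \<Rightarrow> vformula set" where
  "flang [] = {[]}"
| "flang (R # v) = conc (lang R) (flang v)"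

lemma wsem_conc:
  assumes "rel_closed \<xi>"
  shows "(\<Union>w\<in>conc A B. wsem \<xi> w) = (\<Union>w\<in>A. wsem \<xi> w) O (\<Union>w\<in>B. wsem \<xi> w)"
proof -
  have "(\<Union>w\<in>conc A B. wsem \<xi> w) = (\<Union>u\<in>A. \<Union>v\<in>B. wsem \<xi> (u @ v))"
    unfolding conc_def by blast
  then show ?thesis
    unfolding wsem_append[OF assms] relcomp_UNION_distrib relcomp_UNION_distrib2 by (rule trans) (rule SUP_commute)
qed

lemma wsem_concat_in_trancl:
  assumes "rel_closed \<xi>" "us \<noteq> []" "\<And>u. u \<in> set us \<Longrightarrow> wsem \<xi> u \<subseteq> r"
  shows "wsem \<xi> (concat us) \<subseteq> r\<^sup>+"
  using assms(2,3)
proof (induction us)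
  case (Cons u us)
  have u: "wsem \<xi> u \<subseteq> r" using Cons.prems by simp
  show ?case
  proof (cases "us = []")
    case True
    then show ?thesis using u by auto
  next
    case False
    then have "wsem \<xi> (concat us) \<subseteq> r\<^sup>+" using Cons by simp
    then have "wsem \<xi> u O wsem \<xi> (concat us) \<subseteq> r O r\<^sup>+" using u by (intro relcomp_mono)
    also have "\<dots> \<subseteq> r\<^sup>+" by (auto intro: trancl_into_trancl2)
    finally show ?thesis by (simp add: wsem_append[OF assms(1)])
  qed
qed simp

lemma trancl_in_wsem_concat:
  assumes "rel_closed \<xi>" "(a, b) \<in> (\<Union>w\<in>A. wsem \<xi> w)\<^sup>+"
  shows "\<exists>us. us \<noteq> [] \<and> set us \<subseteq> A \<and> (a, b) \<in> wsem \<xi> (concat us)"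
  using assms(2)
proof (induction rule: trancl_induct)
  case (base y)
  then obtain w where "w \<in> A" "(a, y) \<in> wsem \<xi> w" by blast
  then show ?case by (intro exI[of _ "[w]"]) simp
next
  case (step y z)
  then obtain us w where "us \<noteq> []" "set us \<subseteq> A" "(a, y) \<in> wsem \<xi> (concat us)"
    "w \<in> A" "(y, z) \<in> wsem \<xi> w" by blast
  then show ?case
    by (intro exI[of _ "us @ [w]"]) (auto simp: wsem_append[OF assms(1)])
qed

lemma wsem_plus:
  assumes "rel_closed \<xi>"
  shows "(\<Union>w\<in>{concat us |us. us \<noteq> [] \<and> set us \<subseteq> A}. wsem \<xi> w) = (\<Union>w\<in>A. wsem \<xi> w)\<^sup>+"
proof (intro equalityI subrelI)
  fix a b assume "(a, b) \<in> (\<Union>w\<in>{concat us |us. us \<noteq> [] \<and> set us \<subseteq> A}. wsem \<xi> w)"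
  then obtain us where us: "us \<noteq> []" "set us \<subseteq> A" "(a, b) \<in> wsem \<xi> (concat us)" by auto
  have "wsem \<xi> (concat us) \<subseteq> (\<Union>w\<in>A. wsem \<xi> w)\<^sup>+"
    using us by (intro wsem_concat_in_trancl[OF assms]) auto
  then show "(a, b) \<in> (\<Union>w\<in>A. wsem \<xi> w)\<^sup>+" using us by auto
next
  fix a b assume "(a, b) \<in> (\<Union>w\<in>A. wsem \<xi> w)\<^sup>+"
  from trancl_in_wsem_concat[OF assms this]
  show "(a, b) \<in> (\<Union>w\<in>{concat us |us. us \<noteq> [] \<and> set us \<subseteq> A}. wsem \<xi> w)" by auto
qed

text \<open>Taking the union of \<open>wsem\<close> over a language commutes with union, composition
  and iteration, so the relational semantics factors through the language. Only iteration needs an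
  argument, which is \<open>wsem_plus\<close>.\<close>

lemma rel_sem_lang:
  assumes "rel_closed \<xi>"
  shows "rel_sem \<xi> R = (\<Union>w\<in>lang R. wsem \<xi> w)"
proof (induction R)
  case (RComp R S)
  then show ?case using wsem_conc[OF assms] by simp
next
  case (RPlus R)
  then show ?case unfolding rel_sem.simps lang.simps wsem_plus[OF assms] by simp
next
  case (RStar R)
  have "lang (RStar R) = insert [] (lang (RPlus R))"
  proof (intro equalityI subsetI)
    fix w assume "w \<in> lang (RStar R)"
    then obtain us where "w = concat us" "set us \<subseteq> lang R" by auto
    then show "w \<in> insert [] (lang (RPlus R))" by (cases "us = []") auto
  next
    fix w assume "w \<in> insert [] (lang (RPlus R))"
    then show "w \<in> lang (RStar R)" using exI[of "\<lambda>us. w = concat us \<and> set us \<subseteq> lang R" "[]"] by auto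
  qed
  then have "(\<Union>w\<in>lang (RStar R). wsem \<xi> w) = Id_on (x_events \<xi>) \<union> (\<Union>w\<in>lang (RPlus R). wsem \<xi> w)"
    by simp
  also have "(\<Union>w\<in>lang (RPlus R). wsem \<xi> w) = (rel_sem \<xi> R)\<^sup>+"
    unfolding lang.simps wsem_plus[OF assms] RStar[symmetric] by simp
  finally show ?case by simp
qed (use wsem_single[OF assms, of RSo] wsem_single[OF assms, of RWr]
       wsem_single[OF assms, of RRb] wsem_single[OF assms, of RAr] in simp_all)

lemma wsem_flang:
  assumes "rel_closed \<xi>"
  shows "wsem \<xi> v = (\<Union>w\<in>flang v. wsem \<xi> w)"
proof (induction v)
  case (Cons R v)
  then show ?case unfolding flang.simps wsem_conc[OF assms] by (simp add: rel_sem_lang[OF assms, of R])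
qed simp

lemma simple_append: "simple (u @ v) \<longleftrightarrow> simple u \<and> simple v"
  by (simp add: simple_def)

lemma simple_concat: "(\<And>u. u \<in> set us \<Longrightarrow> simple u) \<Longrightarrow> simple (concat us)"
  by (induction us) (simp_all add: simple_append, simp add: simple_def)

lemma lang_simple: "\<forall>w \<in> lang R. simple w"
proof (induction R)
  case (RComp R S)
  then show ?case by (auto simp: simple_append conc_def)
next
  case (RPlus R)
  show ?case
  proof
    fix w assume "w \<in> lang (RPlus R)"
    then obtain us where "w = concat us" "set us \<subseteq> lang R" by auto
    then show "simple w" using RPlus by (auto intro!: simple_concat)
  qed
next
  case (RStar R)
  show ?case
  proof
    fix w assume "w \<in> lang (RStar R)"
    then obtain us where "w = concat us" "set us \<subseteq> lang R" by auto
    then show "simple w" using RStar by (auto intro!: simple_concat)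
  qed
qed (simp_all add: simple_def ball_Un)

lemma flang_simple: "\<forall>w \<in> flang v. simple w"
proof (induction v)
  case (Cons R v)
  then show ?case using lang_simple[of R] by (auto simp: conc_def simple_append)
qed (simp add: simple_def)

text \<open>A context depends only on the union of the visibility relations of the model. Hence
  every formula may be split into its words, and this is where simple formulas come from.\<close>

lemma ctxt_flang:
  assumes "rel_closed \<xi>"
  shows "ctxt \<xi> C x r = ctxt \<xi> (\<Union>v\<in>C. flang v) x r"
  using wsem_flang[OF assms] unfolding ctxt_def vis_iff_wsem[OF assms] by blast

lemma valid_cong_ctxt:
  assumes "\<And>x e. ctxt \<xi> C x e = ctxt \<xi> C' x e"
  shows "valid Init obj C Op \<xi> = valid Init obj C' Op \<xi>"
  unfolding valid_def using assms by simp

lemma arbitration_free_simple: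
  assumes "simple v"
  shows "arbitration_free_formula v \<longleftrightarrow> RAr \<notin> set v"
proof -
  have "uses_ar R \<longleftrightarrow> R = RAr" if "R \<in> set v" for R
    using assms that by (auto simp: simple_def)
  then show ?thesis by (auto simp: arbitration_free_formula_def)
qed

section \<open>Simple words climb in the arbitration order\<close>

lemma rel_sem_simple_subset_ar:
  assumes "is_execution Init \<xi>" "R \<in> {RSo, RWr, RRb, RAr}"
  shows "rel_sem \<xi> R \<subseteq> x_ar \<xi>"
  using assms unfolding is_execution_def by auto

lemma execution_ar:
  assumes "is_execution Init \<xi>"
  shows "trans (x_ar \<xi>)" "irrefl (x_ar \<xi>)" "total_on (x_events \<xi>) (x_ar \<xi>)"
    "x_ar \<xi> \<subseteq> x_events \<xi> \<times> x_events \<xi>" "x_so \<xi> \<subseteq> x_rb \<xi>" "x_wr \<xi> \<subseteq> x_rb \<xi>" "x_rb \<xi> \<subseteq> x_ar \<xi>"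
    "finite (x_events \<xi>)"
  using assms unfolding is_execution_def strict_linear_order_on_def is_history_def by auto

lemma wsem_simple_subset_ar:
  assumes "is_execution Init \<xi>" "simple v"
  shows "wsem \<xi> v \<subseteq> (x_ar \<xi>)\<^sup>="
  using assms(2)
proof (induction v)
  case (Cons R v)
  have "rel_sem \<xi> R \<subseteq> x_ar \<xi>" "wsem \<xi> v \<subseteq> (x_ar \<xi>)\<^sup>="
    using Cons rel_sem_simple_subset_ar[OF assms(1)] by (auto simp: simple_def)
  then show ?case using transD[OF execution_ar(1)[OF assms(1)]] by fastforce
qed auto

lemma wsem_simple_subset_ar':
  assumes "is_execution Init \<xi>" "simple v" "v \<noteq> []"
  shows "wsem \<xi> v \<subseteq> x_ar \<xi>"
proof -
  obtain R u where v: "v = R # u" using assms(3) by (cases v) auto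
  have "rel_sem \<xi> R \<subseteq> x_ar \<xi>" "wsem \<xi> u \<subseteq> (x_ar \<xi>)\<^sup>="
    using assms(2) v rel_sem_simple_subset_ar[OF assms(1)] wsem_simple_subset_ar[OF assms(1)]
    by (auto simp: simple_def)
  then show ?thesis using transD[OF execution_ar(1)[OF assms(1)]] v by fastforce
qed

text \<open>Each letter moves strictly upwards in \<open>ar\<close>, so the set of events above the
  current one shrinks with every letter.\<close>

lemma wsem_simple_length:
  assumes "is_execution Init \<xi>" "simple v" "(e, r) \<in> wsem \<xi> v"
  shows "length v \<le> card {z \<in> x_events \<xi>. (e, z) \<in> x_ar \<xi>}"
  using assms(2,3)
proof (induction v arbitrary: e)
  case (Cons R v)
  note ar = execution_ar[OF assms(1)]
  let ?S = "\<lambda>e. {z \<in> x_events \<xi>. (e, z) \<in> x_ar \<xi>}"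
  obtain z where z: "(e, z) \<in> rel_sem \<xi> R" "(z, r) \<in> wsem \<xi> v" using Cons.prems by auto
  have ez: "(e, z) \<in> x_ar \<xi>"
    using z(1) rel_sem_simple_subset_ar[OF assms(1), of R] Cons.prems(1) by (auto simp: simple_def)
  have "length v \<le> card (?S z)" using Cons z by (auto simp: simple_def)
  also have "card (?S z) < card (?S e)"
  proof (rule psubset_card_mono)
    have "z \<in> ?S e" "z \<notin> ?S z" "?S z \<subseteq> ?S e"
      using ez ar(1,2,4) by (auto simp: irrefl_def dest: transD)
    then show "?S z \<subset> ?S e" by blast
  qed (use ar in auto)
  finally show ?case by simp
qed simp

text \<open>A bound on the length over a four-letter alphabet leaves finitely many words. This is
  the compactness on which the chain argument of \<open>equivalent_models_minimal\<close>
  rests.\<close>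

lemma finite_relevant_words:
  assumes "is_execution Init \<xi>"
  shows "finite {v. simple v \<and> wsem \<xi> v \<noteq> {}}"
proof (rule finite_subset)
  show "{v. simple v \<and> wsem \<xi> v \<noteq> {}} \<subseteq>
      {v. set v \<subseteq> {RSo, RWr, RRb, RAr} \<and> length v \<le> card (x_events \<xi>)}"
  proof
    fix v assume "v \<in> {v. simple v \<and> wsem \<xi> v \<noteq> {}}"
    then obtain e r where v: "simple v" "(e, r) \<in> wsem \<xi> v" by auto
    have "card {z \<in> x_events \<xi>. (e, z) \<in> x_ar \<xi>} \<le> card (x_events \<xi>)"
      by (intro card_mono execution_ar(8)[OF assms]) auto
    then show "v \<in> {v. set v \<subseteq> {RSo, RWr, RRb, RAr} \<and> length v \<le> card (x_events \<xi>)}"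
      using wsem_simple_length[OF assms v] v(1) by (auto simp: simple_def)
  qed
qed (intro finite_lists_length_le, simp)

text \<open>Zorn's lemma is applied to the sets \<open>D\<close> of removed words. If
  \<open>M\<close> is a maximal removable set, no word of \<open>F - M\<close> is vacuous, since
  otherwise it could be added to \<open>M\<close>.\<close>

lemma equivalent_models_minimal:
  assumes simple: "\<And>v. v \<in> F \<Longrightarrow> simple v"
  obtains N where "N \<subseteq> F" "equivalent_models Init obj Op F N"
    "\<And>v. v \<in> N \<Longrightarrow> \<not> vacuous Init obj Op N v"
proof -
  define A where "A = {D. D \<subseteq> F \<and> equivalent_models Init obj Op F (F - D)}"
  have "\<exists>M\<in>A. \<forall>X\<in>A. M \<subseteq> X \<longrightarrow> X = M"
  proof (rule subset_Zorn')
    fix C assume C: "subset.chain A C"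
    have "equivalent_models Init obj Op F (F - \<Union>C)"
      unfolding equivalent_models_def
    proof (intro allI impI)
      fix \<xi> assume \<xi>: "is_execution Init \<xi>"
      note cl = is_execution_rel_closed[OF \<xi>]
      let ?Rel = "{v. simple v \<and> wsem \<xi> v \<noteq> {}}"
      show "valid Init obj F Op \<xi> = valid Init obj (F - \<Union>C) Op \<xi>"
      proof (cases "C = {}")
        case False
        \<comment> \<open>For a fixed execution only finitely many of the words removed along the
          chain matter, so one member of the chain already removes all of them and has the same
          effect there as the union.\<close>
        have "finite (\<Union>C \<inter> ?Rel)" using finite_relevant_words[OF \<xi>] by auto
        then obtain D where D: "D \<in> C" "\<Union>C \<inter> ?Rel \<subseteq> D"
          using finite_subset_Union_chain[of "\<Union>C \<inter> ?Rel" C A] C False by blast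
        have "ctxt \<xi> (F - \<Union>C) x e = ctxt \<xi> (F - D) x e" for x e
        proof -
          have "v \<in> F - \<Union>C \<longleftrightarrow> v \<in> F - D" if "vis \<xi> v x a e" for v a
          proof -
            have "v \<in> ?Rel" if "v \<in> F"
              using that simple \<open>vis \<xi> v x a e\<close> vis_iff_wsem[OF cl] by auto
            then show ?thesis using D by blast
          qed
          then show ?thesis unfolding ctxt_def by blast
        qed
        then have "valid Init obj (F - \<Union>C) Op \<xi> = valid Init obj (F - D) Op \<xi>"
          by (rule valid_cong_ctxt)
        moreover have "D \<in> A" using D(1) C by (auto simp: subset.chain_def)
        then have "valid Init obj F Op \<xi> = valid Init obj (F - D) Op \<xi>"
          using \<xi> unfolding A_def equivalent_models_def by blast
        ultimately show ?thesis by blast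
      qed simp
    qed
    then show "\<Union>C \<in> A" using C by (auto simp: A_def subset.chain_def)
  qed
  then obtain M where M: "M \<in> A" "\<And>X. X \<in> A \<Longrightarrow> M \<subseteq> X \<Longrightarrow> X = M" by blast
  show thesis
  proof (rule that[of "F - M"])
    show "equivalent_models Init obj Op F (F - M)" using M(1) by (simp add: A_def)
    fix v assume v: "v \<in> F - M"
    show "\<not> vacuous Init obj Op (F - M) v"
    proof
      assume "vacuous Init obj Op (F - M) v"
      moreover have "F - M - {v} = F - insert v M" by blast
      ultimately have "equivalent_models Init obj Op (F - M) (F - insert v M)"
        by (simp add: vacuous_def)
      then have "equivalent_models Init obj Op F (F - insert v M)"
        using M(1) unfolding A_def equivalent_models_def by blast
      then have "insert v M \<in> A" using M(1) v by (simp add: A_def)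
      then show False using M(2)[of "insert v M"] v by auto
    qed
  qed auto
qed


section \<open>Runs\<close>

lemma run_from_append:
  "run_from L s (t @ u) = (case run_from L s t of None \<Rightarrow> None | Some s' \<Rightarrow> run_from L s' u)"
  by (induction t arbitrary: s) (simp_all split: option.split)

lemma is_trace_appendD: "is_trace L (t @ u) \<Longrightarrow> is_trace L t"
  by (auto simp: is_trace_def run_from_append split: option.splits)

text \<open>Dependent choice turns a property of traces that can always be extended into an infinite
  run: \<open>f\<close> is a sequence of traces, each a prefix of the next.\<close>

lemma not_finite_ltsI:
  assumes "Q t\<^sub>0" and tr: "\<And>t. Q t \<Longrightarrow> is_trace L t" and ext: "\<And>t. Q t \<Longrightarrow> \<exists>a. Q (t @ [a])"
  shows "\<not> finite_lts L"
proof -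
  define f where "f = rec_nat t\<^sub>0 (\<lambda>_ t. t @ [SOME a. Q (t @ [a])])"
  have f0: "f 0 = t\<^sub>0" and fS: "f (Suc n) = f n @ [SOME a. Q (f n @ [a])]" for n
    by (simp_all add: f_def)
  have Qf: "Q (f n)" for n
  proof (induction n)
    case (Suc n)
    show ?case unfolding fS using someI_ex[OF ext[OF Suc]] .
  qed (simp add: f0 assms)
  have len: "length (f n) = length t\<^sub>0 + n" for n by (induction n) (simp_all add: f0 fS)
  have pre: "take (length (f n)) (f (n + k)) = f n" for n k
    by (induction k) (simp_all add: fS len)
  \<comment> \<open>The limit of the traces \<open>f n\<close>, read off the first one that is
    certainly long enough to have position \<open>k\<close>.\<close>
  define \<alpha> where "\<alpha> k = f (Suc k) ! k" for k
  have \<alpha>: "take k (f n) = map \<alpha> [0..<k]" if "k \<le> length (f n)" for k n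
  proof (rule nth_equalityI)
    show "length (take k (f n)) = length (map \<alpha> [0..<k])" using that by simp
    fix j assume "j < length (take k (f n))"
    then have j: "j < k" "j < length (f n)" by auto
    have "f n ! j = take (length (f n)) (f (n + Suc j)) ! j" unfolding pre ..
    also have "\<dots> = f (Suc j + n) ! j" using j(2) by (simp add: add.commute)
    also have "\<dots> = take (length (f (Suc j))) (f (Suc j + n)) ! j" by (simp add: len)
    also have "\<dots> = f (Suc j) ! j" unfolding pre ..
    finally show "take k (f n) ! j = map \<alpha> [0..<k] ! j" using j by (simp add: \<alpha>_def)
  qed
  have trace: "is_trace L (map \<alpha> [0..<k])" for k
  proof -
    have "is_trace L (take k (f k) @ drop k (f k))" using tr[OF Qf[of k]] by simp
    then have "is_trace L (take k (f k))" by (rule is_trace_appendD)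
    then show ?thesis using \<alpha>[of k k] by (simp add: len)
  qed
  define \<sigma> where "\<sigma> k = the (run_from L (start L) (map \<alpha> [0..<k]))" for k
  have \<sigma>: "run_from L (start L) (map \<alpha> [0..<k]) = Some (\<sigma> k)" for k
    using trace[of k] by (auto simp: is_trace_def \<sigma>_def)
  have "lts.trans L (\<sigma> k) (\<alpha> k) = Some (\<sigma> (Suc k))" for k
    using \<sigma>[of "Suc k"] \<sigma>[of k] by (simp add: run_from_append split: option.splits)
  moreover have "\<sigma> 0 = start L" using \<sigma>[of 0] by simp
  ultimately show ?thesis unfolding finite_lts_def by blast
qed

section \<open>Events of a trace, alone and in a composition\<close>

definition do_evs ::
  "('id, 'rep, 'op, 'obj, 'val, 'meta, 'l, 'msg) iaction list \<Rightarrow>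
   ('id, 'rep, 'op, 'obj, 'val, 'meta) event list" where
  "do_evs t = concat (map (\<lambda>a. case a of Do e m \<Rightarrow> [e] | _ \<Rightarrow> []) t)"

lemma do_evs_simps [simp]:
  "do_evs [] = []" "do_evs (Do e m # t) = e # do_evs t"
  "do_evs (Send r l n S # t) = do_evs t" "do_evs (Receive r l n S # t) = do_evs t"
  "do_evs (Internal r l # t) = do_evs t" "do_evs (t @ u) = do_evs t @ do_evs u"
  by (simp_all add: do_evs_def)

lemma set_do_evs: "set (do_evs t) = tr_events t"
proof -
  have "e \<in> set (do_evs t) \<longleftrightarrow> (\<exists>m. Do e m \<in> set t)" for e
    by (induction t) (simp, rename_tac a t, case_tac a, auto)
  then show ?thesis by (auto simp: tr_events_def)
qed

lemma tr_events_simps [simp]: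
  "tr_events [] = {}" "tr_events (t @ u) = tr_events t \<union> tr_events u"
  "tr_events [Do e m] = {e}"
  by (auto simp: tr_events_def)

lemma finite_tr_events: "finite (tr_events t)"
  unfolding set_do_evs[symmetric] by simp

lemma prog_part_map_Impl: "prog_part (map Impl t) = map PEvent (do_evs t)"
  by (induction t) (simp, rename_tac a t, case_tac a, auto)

lemma distinct_do_evs_ids:
  "distinct (map ia_ident t) \<Longrightarrow> distinct (map ev_id (do_evs t))"
proof (induction t)
  case (Cons a t)
  have *: "ev_id e \<notin> ev_id ` set (do_evs t)" if "a = Do e m" for e m
    using Cons.prems that unfolding set_do_evs tr_events_def by force
  show ?case using Cons * by (cases a) auto
qed simp

lemma run_from_comp_Impl:
  "run_from (comp I P) (s, p) (map Impl t) = Some (s', p') \<longleftrightarrow>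
   run_from I s t = Some s' \<and> run_from P p (map PEvent (do_evs t)) = Some p'"
proof (induction t arbitrary: s p)
  case (Cons a t)
  have [simp]: "lts.trans (comp I P) = comp_trans I P" by (simp add: comp_def)
  show ?case
    by (cases a) (auto simp: Cons.IH split: option.splits)
qed simp


section \<open>Calls can always be appended to a trace\<close>

lemma same_call_refl: "same_call obj Op e e"
  by (simp add: same_call_def)

lemma same_call_trans:
  "same_call obj Op e e' \<Longrightarrow> same_call obj Op e' e'' \<Longrightarrow> same_call obj Op e e''"
  unfolding same_call_def by (cases e; cases e'; cases e'') simp

lemma same_callD:
  assumes "same_call obj Op e e'"
  shows "ev_id e' = ev_id e" "ev_rep e' = ev_rep e" "obj e' = obj e"
    "os_rspec Op e' = os_rspec Op e" "os_wspec Op e' = os_wspec Op e"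
  using assms unfolding same_call_def by (cases e; cases e'; simp)+

text \<open>The program that offers the calls \<open>es\<close> one after the other. The state
  records what was done and only its length, the position in \<open>es\<close>, matters. Each call
  is offered with all its outcomes, as \<open>is_program\<close> demands, so the script does not
  determine the written values.\<close>

definition script ::
  "('id, 'rep, 'op, 'obj, 'val, 'meta) event set \<Rightarrow>
   (('id, 'rep, 'op, 'obj, 'val, 'meta) event \<Rightarrow> 'obj set) \<Rightarrow>
   ('id, 'rep, 'op, 'obj, 'val, 'meta) opspec \<Rightarrow>
   ('id, 'rep, 'op, 'obj, 'val, 'meta) event list \<Rightarrow>
   (('id, 'rep, 'op, 'obj, 'val, 'meta, 'l) paction list,
    ('id, 'rep, 'op, 'obj, 'val, 'meta, 'l) paction) lts" where
  "script Init obj Op es =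
     \<lparr>states = UNIV, actions = PEvent ` calls Init Op, start = [],
      trans = (\<lambda>s a. case a of
        PEvent e \<Rightarrow> if length s < length es \<and> e \<in> calls Init Op \<and>
                       same_call obj Op (es ! length s) e
                     then Some (s @ [a]) else None
      | PLocal r l \<Rightarrow> None)\<rparr>"

lemma script_sel [simp]:
  "states (script Init obj Op es) = UNIV" "actions (script Init obj Op es) = PEvent ` calls Init Op"
  "start (script Init obj Op es) = []"
  by (simp_all add: script_def)

lemma script_trans [simp]:
  "lts.trans (script Init obj Op es) s (PLocal r l) = None"
  "lts.trans (script Init obj Op es) s (PEvent e) =
     (if length s < length es \<and> e \<in> calls Init Op \<and> same_call obj Op (es ! length s) e
      then Some (s @ [PEvent e]) else None)"
  by (simp_all add: script_def)

lemma script_trans_SomeD: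
  assumes "lts.trans (script Init obj Op es) s a = Some s'"
  shows "s' = s @ [a]" "length s < length es" "a \<in> PEvent ` calls Init Op"
    "pa_ident a = Inl (ev_id (es ! length s))"
  using assms by (cases a; auto split: if_splits dest: same_callD)+

lemma script_run:
  assumes "run_from (script Init obj Op es) s t = Some s'"
  shows "s' = s @ t \<and>
    (t \<noteq> [] \<longrightarrow> length s + length t \<le> length es) \<and>
    map pa_ident t = map (Inl \<circ> ev_id) (take (length t) (drop (length s) es))"
  using assms
proof (induction t arbitrary: s)
  case (Cons a t)
  then obtain s1 where s1: "lts.trans (script Init obj Op es) s a = Some s1"
    "run_from (script Init obj Op es) s1 t = Some s'" by (auto split: option.splits)
  note d = script_trans_SomeD[OF s1(1)]
  note ih = Cons.IH[OF s1(2)]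
  have "drop (length s) es = es ! length s # drop (Suc (length s)) es"
    using d(2) by (simp add: Cons_nth_drop_Suc)
  then show ?case using ih d by (cases "t = []") auto
qed simp

lemma script_is_program:
  assumes "distinct (map ev_id es)"
  shows "is_program Init obj Op (script Init obj Op es)"
  unfolding is_program_def
proof (intro conjI allI impI ballI)
  show "is_lts (script Init obj Op es)"
    unfolding is_lts_def using script_trans_SomeD(3) by auto
  show "{e. PEvent e \<in> actions (script Init obj Op es)} = calls Init Op" by auto
next
  fix t :: "('a, 'b, 'c, 'd, 'e, 'f, 'g) paction list"
  assume "is_trace (script Init obj Op es) t"
  then obtain s' where "run_from (script Init obj Op es) [] t = Some s'"
    by (auto simp: is_trace_def)
  from script_run[OF this]
  have *: "map pa_ident t = map Inl (take (length t) (map ev_id es))" by (simp add: take_map)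
  show "distinct (map pa_ident t)"
    unfolding * distinct_map using assms by (simp add: distinct_map inj_on_def)
next
  fix s :: "('a, 'b, 'c, 'd, 'e, 'f, 'g) paction list" and e e'
  assume "e \<in> calls Init Op" "e' \<in> calls Init Op"
    "same_call obj Op e e' \<and> lts.trans (script Init obj Op es) s (PEvent e) \<noteq> None"
  then show "lts.trans (script Init obj Op es) s (PEvent e') \<noteq> None"
    by (auto split: if_splits dest: same_call_trans)
qed

lemma script_finite: "finite_lts (script Init obj Op es)" (is "finite_lts ?L")
  unfolding finite_lts_def
proof
  assume "\<exists>\<sigma> \<alpha>. \<sigma> 0 = start ?L \<and> (\<forall>n. lts.trans ?L (\<sigma> n) (\<alpha> n) = Some (\<sigma> (Suc n)))"
  then obtain \<sigma> \<alpha> where \<sigma>: "\<sigma> 0 = []" "\<And>n. lts.trans ?L (\<sigma> n) (\<alpha> n) = Some (\<sigma> (Suc n))"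
    by auto
  have "length (\<sigma> n) = n" for n
    by (induction n) (simp_all add: \<sigma>(1) script_trans_SomeD(1)[OF \<sigma>(2)])
  then show False using script_trans_SomeD(2)[OF \<sigma>(2)[of "length es"]] by simp
qed

lemma script_run_prefix:
  assumes "set es \<subseteq> calls Init Op"
  shows "run_from (script Init obj Op (es @ us)) [] (map PEvent es) = Some (map PEvent es)"
  using assms
proof (induction es arbitrary: us rule: rev_induct)
  case (snoc e es)
  then show ?case by (simp add: run_from_append nth_append same_call_refl)
qed simp

definition no_recv ::
  "('id, 'rep, 'op, 'obj, 'val, 'meta, 'l, 'msg) iaction list \<Rightarrow> bool" where
  "no_recv t \<longleftrightarrow> (\<forall>r l n S. Receive r l n S \<notin> set t)"

lemma no_recv_append [simp]: "no_recv (t @ u) \<longleftrightarrow> no_recv t \<and> no_recv u"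
  by (auto simp: no_recv_def)

lemma implementation_calls:
  assumes "is_implementation Init Op I" "is_trace I t"
  shows "tr_events t \<subseteq> calls Init Op"
proof -
  have lts: "is_lts I" and act: "\<And>e m. Do e m \<in> actions I \<Longrightarrow> e \<in> calls Init Op"
    using assms(1) unfolding is_implementation_def by blast+
  have "set t \<subseteq> actions I" if "run_from I s t \<noteq> None" for s
    using that
  proof (induction t arbitrary: s)
    case (Cons a t)
    then show ?case using lts unfolding is_lts_def by (auto split: option.splits)
  qed simp
  then show ?thesis using assms(2) act unfolding is_trace_def tr_events_def by blast
qed

text \<open>The script of the events of \<open>t\<close> followed by \<open>e\<close> is run against
  the implementation. As long as \<open>e\<close> is pending, its replica has an enabled program
  action and may not be waiting, so some action other than a receive is enabled there. If that were
  never an outcome of \<open>e\<close>, the implementation could perform other local actions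
  forever, although the script is finite.\<close>

lemma append_call:
  fixes I :: "('s, ('id, 'rep, 'op, 'obj, 'val, 'meta, 'l, 'msg) iaction) lts"
  assumes impl: "is_implementation Init Op I" and avail: "available Init obj Op I"
    and t: "is_trace I t" and e: "e \<in> calls Init Op" "ev_id e \<notin> ev_id ` tr_events t"
  shows "\<exists>l e' m. same_call obj Op e e' \<and> is_trace I (t @ l @ [Do e' m]) \<and>
    tr_events l = {} \<and> no_recv l"
proof (rule ccontr)
  assume contr: "\<not> ?thesis"
  define P :: "(('id, 'rep, 'op, 'obj, 'val, 'meta, 'l) paction list,
    ('id, 'rep, 'op, 'obj, 'val, 'meta, 'l) paction) lts"
    where "P = script Init obj Op (do_evs t @ [e])"
  \<comment> \<open>The traces of the composition in which \<open>e\<close> is still pending and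
    nothing has been received since \<open>t\<close>; under the assumption for contradiction they
    can always be extended.\<close>
  define Q :: "('id, 'rep, 'op, 'obj, 'val, 'meta, 'l, 'msg) caction list \<Rightarrow> bool" where
    "Q tc \<longleftrightarrow> (\<exists>l. tc = map Impl (t @ l) \<and> is_trace I (t @ l) \<and> do_evs l = [] \<and> no_recv l)" for tc
  have "distinct (map ev_id (do_evs t @ [e]))"
    using distinct_do_evs_ids[of t] impl t e(2)
    by (auto simp: is_implementation_def wf_itrace_def set_do_evs)
  then have P: "is_program Init obj Op P" "finite_lts P"
    unfolding P_def by (rule script_is_program) (rule script_finite)
  have Prun: "run_from P (start P) (map PEvent (do_evs t)) = Some (map PEvent (do_evs t))"
    unfolding P_def using implementation_calls[OF impl t]
    by (simp add: script_run_prefix set_do_evs)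
  have comp_run: "\<exists>s. run_from I (start I) (t @ l) = Some s \<and>
      run_from (comp I P) (start (comp I P)) (map Impl (t @ l)) = Some (s, map PEvent (do_evs t))"
    if "is_trace I (t @ l)" "do_evs l = []" for l
  proof -
    obtain s where s: "run_from I (start I) (t @ l) = Some s" using \<open>is_trace I (t @ l)\<close>
      by (auto simp: is_trace_def)
    have "run_from (comp I P) (start I, start P) (map Impl (t @ l)) = Some (s, map PEvent (do_evs t))"
      using s Prun that(2) by (simp only: run_from_comp_Impl do_evs_simps append_Nil2)
    then show ?thesis using s by (simp add: comp_def)
  qed
  have "\<not> finite_lts (comp I P)"
  proof (rule not_finite_ltsI[of Q "map Impl t"])
    show "Q (map Impl t)" unfolding Q_def using t by (intro exI[of _ "[]"]) (simp add: no_recv_def)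
  next
    fix tc assume "Q tc"
    then show "is_trace (comp I P) tc" using comp_run unfolding Q_def is_trace_def by fastforce
  next
    fix tc assume "Q tc"
    then obtain l where l: "tc = map Impl (t @ l)" "is_trace I (t @ l)" "do_evs l = []" "no_recv l"
      unfolding Q_def by blast
    obtain s where s: "run_from I (start I) (t @ l) = Some s"
      "run_from (comp I P) (start (comp I P)) tc = Some (s, map PEvent (do_evs t))"
      using comp_run[OF l(2,3)] l(1) by blast
    have "enabled_after P (prog_part tc) (PEvent e)"
      unfolding l(1) prog_part_map_Impl enabled_after_def
      using Prun e l(3) by (simp add: P_def same_call_refl)
    moreover have "PEvent e \<in> actions P" using e by (simp add: P_def)
    moreover have "\<not> waiting I P tc (ev_rep e)"
    proof -
      have "is_trace (comp I P) tc" using s(2) by (simp add: is_trace_def)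
      then show ?thesis using avail P(1) unfolding available_def by blast
    qed
    ultimately obtain a where a: "\<not> is_receive a" "enabled_after (comp I P) tc a"
      unfolding waiting_def by (metis pa_rep.simps(1))
    then have tr: "comp_trans I P (s, map PEvent (do_evs t)) a \<noteq> None"
      using s(2) by (simp add: enabled_after_def comp_def)
    show "\<exists>a. Q (tc @ [a])"
    proof (cases a)
      case (Prog b)
      then show ?thesis using tr by (cases b) (simp_all add: P_def)
    next
      case (Impl b)
      have tr_b: "lts.trans I s b \<noteq> None"
        using tr Impl by (cases b) (auto split: option.splits)
      then have trace: "is_trace I (t @ l @ [b])"
        using s(1) by (auto simp: is_trace_def run_from_append split: option.splits)
      show ?thesis
      proof (cases "\<exists>e' m. b = Do e' m")
        case True
        then obtain e' m where b: "b = Do e' m" by blast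
        have "lts.trans P (map PEvent (do_evs t)) (PEvent e') \<noteq> None"
          using tr Impl b by (auto split: option.splits)
        then have "same_call obj Op e e'" by (simp add: P_def split: if_splits)
        moreover have "tr_events l = {}" using l(3) set_do_evs[of l] by simp
        ultimately show ?thesis using contr trace b l(4) by blast
      next
        case False
        then have "do_evs [b] = []" by (cases b) auto
        moreover have "no_recv [b]" using a(1) Impl by (auto simp: no_recv_def is_receive_def)
        ultimately show ?thesis
          unfolding Q_def using trace l Impl
          by (intro exI[of _ "Impl b"] exI[of _ "l @ [b]"]) simp
      qed
    qed
  qed
  then show False using avail P unfolding available_def by blast
qed


section \<open>Executions without communication\<close>

lemma tr_so_append_call:
  assumes "tr_events l = {}" "Do e m \<notin> set t"
  shows "tr_so i (t @ l @ [Do e m']) =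
    tr_so i t \<union> insert i {a \<in> tr_events t. ev_rep a = ev_rep e} \<times> {e}"
proof -
  let ?t' = "t @ l @ [Do e m']"
  define B where "B a b \<longleftrightarrow>
    (\<exists>j k n n'. j < k \<and> k < length t \<and> t ! j = Do a n \<and> t ! k = Do b n')" for a b
  have l: "Do a n \<notin> set l" for a n using assms(1) by (auto simp: tr_events_def)
  \<comment> \<open>The positions inside \<open>l\<close> carry no events, so a \<open>Do\<close>
    sits either in \<open>t\<close> or at the very end.\<close>
  have nth: "?t' ! k = Do a n \<longleftrightarrow>
      (k < length t \<and> t ! k = Do a n) \<or> (k = length t + length l \<and> Do a n = Do e m')"
    if "k < length ?t'" for k a n
  proof -
    have "l ! (k - length t) \<noteq> Do a n" if "\<not> k < length t" "k < length t + length l"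
    proof -
      have "l ! (k - length t) \<in> set l" using that by (intro nth_mem) linarith
      then show ?thesis using l by metis
    qed
    then show ?thesis using that by (auto simp: nth_append)
  qed
  have B: "(\<exists>j k n n'. j < k \<and> k < length ?t' \<and> ?t' ! j = Do a n \<and> ?t' ! k = Do b n') \<longleftrightarrow>
      B a b \<or> (a \<in> tr_events t \<and> b = e)" (is "?L \<longleftrightarrow> ?R") for a b
  proof
    assume ?L
    then obtain j k n n' where *: "j < k" "k < length ?t'" "?t' ! j = Do a n" "?t' ! k = Do b n'"
      by blast
    have "j < length t" "t ! j = Do a n" using nth[of j a n] * by auto
    moreover have "(k < length t \<and> t ! k = Do b n') \<or> b = e" using nth[of k b n'] * by auto
    ultimately show ?R using *(1) nth_mem[of j t] by (auto simp: tr_events_def B_def)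
  next
    assume ?R
    then show ?L
    proof
      assume "B a b"
      then obtain j k n n' where *: "j < k" "k < length t" "t ! j = Do a n" "t ! k = Do b n'"
        unfolding B_def by blast
      then have "?t' ! j = Do a n" "?t' ! k = Do b n'" by (simp_all add: nth_append)
      then show ?L using * by (intro exI[of _ j] exI[of _ k]) auto
    next
      assume R: "a \<in> tr_events t \<and> b = e"
      then obtain j n where j: "j < length t" "t ! j = Do a n"
        unfolding tr_events_def in_set_conv_nth by auto
      have "?t' ! j = Do a n" "?t' ! (length t + length l) = Do b m'"
        using j R by (simp_all add: nth_append)
      then show ?L using j
        by (intro exI[of _ j] exI[of _ "length t + length l"]) auto
    qed
  qed
  have "tr_so i ?t' = {i} \<times> tr_events ?t' \<union>
      {(a, b). ev_rep a = ev_rep b \<and> (B a b \<or> (a \<in> tr_events t \<and> b = e))}"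
    unfolding tr_so_def B ..
  moreover have "tr_so i t = {i} \<times> tr_events t \<union> {(a, b). ev_rep a = ev_rep b \<and> B a b}"
    unfolding tr_so_def B_def ..
  ultimately show ?thesis using assms(1) by auto
qed

lemma tr_wrinv_append: "tr_wrinv t x e \<subseteq> tr_wrinv (t @ u) x e"
  by (auto simp: tr_wrinv_def)

lemma tr_rb_no_recv:
  assumes "no_recv t"
  shows "tr_rb i t = tr_so i t"
proof -
  have "t ! j \<noteq> Receive r l n S" if "j < k" "k < length t" for j k r l n S
    using assms nth_mem[of j t] that unfolding no_recv_def by (metis less_trans)
  then show ?thesis unfolding tr_rb_def by auto
qed

section \<open>Consequences of the standing assumptions\<close>

locale basic_storage =
  fixes Init :: "('id, 'rep, 'op, 'obj, 'val, 'meta) event set"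
    and obj :: "('id, 'rep, 'op, 'obj, 'val, 'meta) event \<Rightarrow> 'obj set"
    and CMod :: "vformula set"
    and Op :: "('id, 'rep, 'op, 'obj, 'val, 'meta) opspec"
  assumes infinite_obj: "infinite (UNIV :: 'obj set)"
    and infinite_id: "infinite (UNIV :: 'id set)"
    and two_reps: "\<exists>r r' :: 'rep. r \<noteq> r'"
    and universe: "event_universe Init obj"
    and model: "is_basic_model Init CMod"
    and opspec: "is_basic_opspec Init obj Op"
begin

lemma calls_not_init: "e \<in> calls Init Op \<Longrightarrow> e \<in> os_events Op \<and> e \<notin> Init"
  by (simp add: calls_def)

lemma calls_obj: "e \<in> calls Init Op \<Longrightarrow> \<exists>x. obj e = {x}"
  using opspec unfolding is_basic_opspec_def by blast

lemma init_writes: "i \<in> Init \<Longrightarrow> writes i x"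
  using universe unfolding event_universe_def by blast

lemma outcome_wspec: "outcome Op e v \<noteq> None \<Longrightarrow> os_wspec Op e \<noteq> None"
  by (auto simp: outcome_def split: option.splits)

lemma ex_write_call: "\<exists>e \<in> calls Init Op. outcome Op e v \<noteq> None"
proof -
  obtain e where e: "e \<in> os_events Op" "outcome Op e v \<noteq> None"
    using opspec unfolding is_basic_opspec_def by blast
  then have "os_wspec Op e \<noteq> None" by (intro outcome_wspec)
  then have "e \<notin> Init" using opspec e(1) unfolding is_basic_opspec_def by blast
  then show ?thesis using e by (auto simp: calls_def)
qed

lemma ex_read_call: "\<exists>e \<in> calls Init Op. os_rspec Op e"
  using opspec unfolding is_basic_opspec_def by blast

definition has_rw :: bool where
  "has_rw \<longleftrightarrow> (\<exists>e \<in> calls Init Op. is_rw Op e)"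

lemma ex_rw_call: "has_rw \<Longrightarrow> \<exists>e \<in> calls Init Op. is_rw Op e \<and> outcome Op e v \<noteq> None"
  using opspec unfolding is_basic_opspec_def has_rw_def by blast

lemma ex_call_at:
  assumes "e \<in> calls Init Op"
  obtains e' where "e' \<in> calls Init Op" "ev_rep e' = r" "ev_id e' = n" "obj e' = {x}"
    "os_rspec Op e' = os_rspec Op e" "os_wspec Op e' = os_wspec Op e"
proof -
  have "\<exists>e' \<in> calls Init Op. ev_rep e' = r \<and> ev_id e' = n \<and> obj e' = {x} \<and>
      os_rspec Op e' = os_rspec Op e \<and> os_wspec Op e' = os_wspec Op e"
    using opspec assms unfolding is_basic_opspec_def by blast
  then show thesis using that by blast
qed

lemma ex_outcome:
  assumes "e \<in> calls Init Op"
  obtains e' where "e' \<in> calls Init Op" "same_call obj Op e e'"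
    "ev_wval e' = (\<lambda>x. if x \<in> obj e then outcome Op e v else None)"
  using opspec assms unfolding is_basic_opspec_def by blast

lemma non_read_outcome:
  assumes "e \<in> calls Init Op" "\<not> os_rspec Op e"
  shows "outcome Op e v = outcome Op e v'"
proof (cases "os_wspec Op e")
  case (Some f)
  then have "os_wspec Op e \<noteq> None \<and> \<not> os_rspec Op e" using assms(2) by simp
  then obtain c where "os_wspec Op e = Some (\<lambda>_. Some c)"
    using opspec assms(1) unfolding is_basic_opspec_def by blast
  then show ?thesis by (simp add: outcome_def)
qed (simp add: outcome_def)

lemma outcome_cong: "os_wspec Op e' = os_wspec Op e \<Longrightarrow> outcome Op e' v = outcome Op e v"
  by (simp add: outcome_def)

lemma so_formula:
  obtains v where "v \<in> CMod" "\<And>\<xi> x e r. is_execution Init \<xi> \<Longrightarrow> (e, r) \<in> x_so \<xi> \<Longrightarrow> writes e x \<Longrightarrow>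
    x_wrinv \<xi> x r \<noteq> {} \<Longrightarrow> vis \<xi> v x e r"
proof -
  obtain v where "v \<in> CMod" "\<forall>\<xi>. is_execution Init \<xi> \<longrightarrow>
      (\<forall>x e r. (e, r) \<in> x_so \<xi> \<and> writes e x \<and> x_wrinv \<xi> x r \<noteq> {} \<longrightarrow> vis \<xi> v x e r)"
    using model unfolding is_basic_model_def by (elim conjE bexE) (rule that)
  then show thesis using that by simp
qed

lemma wr_formula:
  obtains v where "v \<in> CMod" "\<And>\<xi> x e r. is_execution Init \<xi> \<Longrightarrow> r \<in> x_events \<xi> \<Longrightarrow>
    e \<in> x_wrinv \<xi> x r \<Longrightarrow> writes e x \<Longrightarrow> vis \<xi> v x e r"
proof -
  obtain v where "v \<in> CMod" "\<forall>\<xi>. is_execution Init \<xi> \<longrightarrow>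
      (\<forall>x e. \<forall>r \<in> x_events \<xi>. e \<in> x_wrinv \<xi> x r \<and> writes e x \<longrightarrow> vis \<xi> v x e r)"
    using model unfolding is_basic_model_def by (elim conjE bexE) (rule that)
  then show thesis using that by simp
qed

text \<open>The part of validity that does not mention contexts. It follows from validity in either
  of two models and so can be used in both directions when the models are compared on one
  execution.\<close>

definition well_read :: "('id, 'rep, 'op, 'obj, 'val, 'meta) execution \<Rightarrow> bool" where
  "well_read \<xi> \<longleftrightarrow> x_events \<xi> \<subseteq> os_events Op \<and>
     (\<forall>e \<in> x_events \<xi> \<inter> Init. \<forall>x. x_wrinv \<xi> x e = {}) \<and>
     (\<forall>e \<in> x_events \<xi> - Init. \<forall>x.
        (if os_rspec Op e \<and> x \<in> obj e
         then \<exists>w \<in> x_events \<xi>. x_wrinv \<xi> x e = {w} \<and> writes w x \<and>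
                ev_wval e x = Option.bind (ev_wval w x) (outcome Op e)
         else x_wrinv \<xi> x e = {}) \<and>
        (writes e x \<longrightarrow> x \<in> obj e \<and> os_wspec Op e \<noteq> None))"

lemma valid_read:
  assumes "valid Init obj C Op \<xi>" "e \<in> x_events \<xi> - Init" "os_rspec Op e" "x \<in> obj e"
  obtains w where "is_max_in (x_ar \<xi>) (ctxt \<xi> C x e) w" "x_wrinv \<xi> x e = {w}"
    "ev_wval e x = Option.bind (ev_wval w x) (outcome Op e)"
proof -
  have "if os_rspec Op e \<and> x \<in> obj e
        then \<exists>w. is_max_in (x_ar \<xi>) (ctxt \<xi> C x e) w \<and> x_wrinv \<xi> x e = {w} \<and>
                 ev_wval e x = Option.bind (ev_wval w x) (outcome Op e)
        else x_wrinv \<xi> x e = {} \<and>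
             (if x \<in> obj e then \<forall>v. ev_wval e x = outcome Op e v else ev_wval e x = None)"
    using assms(1,2) unfolding valid_def by blast
  then show thesis using assms(3,4) that by auto
qed

lemma valid_non_read:
  assumes "valid Init obj C Op \<xi>" "e \<in> x_events \<xi> - Init" "\<not> (os_rspec Op e \<and> x \<in> obj e)"
  shows "x_wrinv \<xi> x e = {}" "ev_wval e x = (if x \<in> obj e then outcome Op e v else None)"
proof -
  have "if os_rspec Op e \<and> x \<in> obj e
        then \<exists>w. is_max_in (x_ar \<xi>) (ctxt \<xi> C x e) w \<and> x_wrinv \<xi> x e = {w} \<and>
                 ev_wval e x = Option.bind (ev_wval w x) (outcome Op e)
        else x_wrinv \<xi> x e = {} \<and>
             (if x \<in> obj e then \<forall>v. ev_wval e x = outcome Op e v else ev_wval e x = None)"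
    using assms(1,2) unfolding valid_def by blast
  then show "x_wrinv \<xi> x e = {}" "ev_wval e x = (if x \<in> obj e then outcome Op e v else None)"
    unfolding if_not_P[OF assms(3)] by simp_all
qed

lemma valid_well_read:
  assumes "valid Init obj C Op \<xi>"
  shows "well_read \<xi>"
proof -
  have "(if os_rspec Op e \<and> x \<in> obj e
         then \<exists>w \<in> x_events \<xi>. x_wrinv \<xi> x e = {w} \<and> writes w x \<and>
                ev_wval e x = Option.bind (ev_wval w x) (outcome Op e)
         else x_wrinv \<xi> x e = {}) \<and>
        (writes e x \<longrightarrow> x \<in> obj e \<and> os_wspec Op e \<noteq> None)" if e: "e \<in> x_events \<xi> - Init" for e x
  proof (cases "os_rspec Op e \<and> x \<in> obj e")
    case True
    then obtain w where w: "is_max_in (x_ar \<xi>) (ctxt \<xi> C x e) w" "x_wrinv \<xi> x e = {w}"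
      "ev_wval e x = Option.bind (ev_wval w x) (outcome Op e)"
      using valid_read[OF assms e] by blast
    have "w \<in> x_events \<xi>" "writes w x"
      using w(1) by (auto simp: is_max_in_def ctxt_def vis_def)
    moreover have "os_wspec Op e \<noteq> None" if "writes e x"
      using w(3) that outcome_wspec by (cases "ev_wval w x") (auto simp: writes_def)
    ultimately show ?thesis using True w by auto
  next
    case False
    note * = valid_non_read[OF assms e this]
    have "x \<in> obj e \<and> os_wspec Op e \<noteq> None" if "writes e x"
      using that *(2)[of undefined] outcome_wspec by (auto simp: writes_def split: if_splits)
    then show ?thesis using False * by auto
  qed
  then show ?thesis using assms unfolding well_read_def valid_def by blast
qed

text \<open>In a chain of two \<open>wr\<close> edges between non-initial events, the event in the middle both reads
  and writes.\<close>

definition realizable :: "vformula \<Rightarrow> bool" where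
  "realizable w \<longleftrightarrow> has_rw \<or> successively (\<lambda>R S. \<not> (R = RWr \<and> S = RWr)) w"

text \<open>An execution induced by a trace without receives: \<open>rb\<close> has collapsed to
  \<open>so\<close>, while nothing is known about \<open>ar\<close> beyond
  \<open>is_execution\<close> and validity.\<close>

definition local_exec ::
  "('id, 'rep, 'op, 'obj, 'val, 'meta) event \<Rightarrow>
   ('id, 'rep, 'op, 'obj, 'val, 'meta, 'l, 'msg) iaction list \<Rightarrow>
   ('id, 'rep, 'op, 'obj, 'val, 'meta) execution \<Rightarrow> bool" where
  "local_exec i t \<xi> \<longleftrightarrow> is_execution Init \<xi> \<and> valid Init obj CMod Op \<xi> \<and>
     x_events \<xi> = insert i (tr_events t) \<and> x_so \<xi> = tr_so i t \<and> x_wrinv \<xi> = tr_wrinv t \<and>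
     x_rb \<xi> = tr_so i t"

end

section \<open>Traces of an available implementation that receive no message\<close>

locale available_storage = basic_storage Init obj CMod Op
  for Init :: "('id, 'rep, 'op, 'obj, 'val, 'meta) event set"
    and obj :: "('id, 'rep, 'op, 'obj, 'val, 'meta) event \<Rightarrow> 'obj set"
    and CMod :: "vformula set"
    and Op :: "('id, 'rep, 'op, 'obj, 'val, 'meta) opspec" +
  fixes I :: "('id, 'rep, 'op, 'obj, 'val, 'meta, 'l, 'msg) implementation"
  assumes spec_impl: "is_spec_implementation Init obj CMod Op I"
    and avail: "available Init obj Op I"
begin

lemma impl: "is_implementation Init Op I"
  using spec_impl by (simp add: is_spec_implementation_def)

lemma ex_local_exec:
  assumes "is_trace I t" "no_recv t"
  obtains i \<xi> where "i \<in> Init" "i \<in> os_events Op" "local_exec i t \<xi>"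
proof -
  obtain \<xi> where \<xi>: "induces Init t \<xi>" "valid Init obj CMod Op \<xi>"
    using spec_impl assms(1) unfolding is_spec_implementation_def by blast
  then obtain i where i: "i \<in> Init" "is_execution Init \<xi>"
    "x_hist \<xi> = \<lparr>h_events = insert i (tr_events t), h_so = tr_so i t, h_wrinv = tr_wrinv t\<rparr>"
    "x_rb \<xi> = tr_rb i t"
    unfolding induces_def by blast
  then have "local_exec i t \<xi>"
    using \<xi>(2) tr_rb_no_recv[OF assms(2)] by (simp add: local_exec_def)
  moreover have "i \<in> os_events Op" using \<xi>(2) i(3) by (auto simp: valid_def)
  ultimately show thesis using that i(1) by blast
qed

text \<open>A first read event, which can only read from the initial event, fixes the initial event of
  all executions induced by extensions of the trace.\<close>

definition anchored ::
  "('id, 'rep, 'op, 'obj, 'val, 'meta) event \<Rightarrow>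
   ('id, 'rep, 'op, 'obj, 'val, 'meta, 'l, 'msg) iaction list \<Rightarrow> bool" where
  "anchored i t \<longleftrightarrow> is_trace I t \<and> no_recv t \<and> i \<in> Init \<and> i \<in> os_events Op \<and>
     (\<exists>x. \<exists>e \<in> tr_events t. i \<in> tr_wrinv t x e)"

lemma tr_events_not_init: "is_trace I t \<Longrightarrow> e \<in> tr_events t \<Longrightarrow> e \<in> calls Init Op \<and> e \<notin> Init"
  using implementation_calls[OF impl] calls_not_init by blast

text \<open>\<open>induces\<close> leaves the choice of the initial event open for each trace. Read
  dependencies must lie inside the history, so the initial event \<open>i\<close> that was read
  belongs to it, and a history has only one initial event.\<close>

lemma anchored_local_exec:
  assumes "anchored i t"
  obtains \<xi> where "local_exec i t \<xi>"
proof -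
  obtain j \<xi> where \<xi>: "j \<in> Init" "local_exec j t \<xi>"
    using ex_local_exec[of t thesis] assms unfolding anchored_def by blast
  obtain x e where e: "e \<in> tr_events t" "i \<in> tr_wrinv t x e"
    using assms unfolding anchored_def by blast
  have "x_wrinv \<xi> x e \<subseteq> x_events \<xi>"
  proof -
    have "is_history Init (x_hist \<xi>)" "e \<in> x_events \<xi>"
      using \<xi>(2) e(1) by (auto simp: local_exec_def is_execution_def)
    then show ?thesis unfolding is_history_def by blast
  qed
  then have "i \<in> insert j (tr_events t)" using \<xi>(2) e(2) unfolding local_exec_def by auto
  then have "i = j" using assms tr_events_not_init unfolding anchored_def by blast
  then show thesis using that \<xi>(2) by blast
qed

lemma fresh_call:
  assumes t: "is_trace I t" "no_recv t" and e: "e\<^sub>0 \<in> calls Init Op"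
  shows "\<exists>t' e. is_trace I t' \<and> no_recv t' \<and> e \<notin> tr_events t \<and> e \<in> calls Init Op \<and>
    ev_rep e = r \<and> obj e = {x} \<and> os_rspec Op e = os_rspec Op e\<^sub>0 \<and> os_wspec Op e = os_wspec Op e\<^sub>0 \<and>
    tr_events t' = insert e (tr_events t) \<and>
    (\<forall>i. tr_so i t' = tr_so i t \<union> insert i {a \<in> tr_events t. ev_rep a = r} \<times> {e}) \<and>
    (\<forall>y a. tr_wrinv t y a \<subseteq> tr_wrinv t' y a)"
proof -
  obtain n where n: "n \<notin> ev_id ` tr_events t"
    using ex_new_if_finite[OF infinite_id] finite_tr_events by blast
  obtain e1 where e1: "e1 \<in> calls Init Op" "ev_rep e1 = r" "ev_id e1 = n" "obj e1 = {x}"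
    "os_rspec Op e1 = os_rspec Op e\<^sub>0" "os_wspec Op e1 = os_wspec Op e\<^sub>0"
    by (rule ex_call_at[OF e])
  obtain l e' m where l: "same_call obj Op e1 e'" "is_trace I (t @ l @ [Do e' m])"
    "tr_events l = {}" "no_recv l"
    using append_call[OF impl avail t(1) e1(1)] n e1(3) by blast
  note sc = same_callD[OF l(1)]
  have new: "e' \<notin> tr_events t" using n sc e1(3) by auto
  then have "Do e' m \<notin> set t" by (auto simp: tr_events_def)
  note so = tr_so_append_call[OF l(3) this]
  have "e' \<in> calls Init Op" using tr_events_not_init[OF l(2), of e'] by auto
  then show ?thesis
    using l new sc e1 t so tr_wrinv_append[of t _ _ "l @ [Do e' m]"]
    by (intro exI[of _ "t @ l @ [Do e' m]"] exI[of _ e']) (auto simp: no_recv_def)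
qed

text \<open>The event read precedes \<open>e\<close> in \<open>so\<close> because \<open>wr\<close>
  lies in \<open>rb\<close>, which is \<open>so\<close> here. Conversely the \<open>so\<close>
  formula of the model makes every writing predecessor visible, so none of them can come after
  \<open>w\<close>.\<close>

lemma local_read:
  assumes \<xi>: "local_exec i t \<xi>" and "is_trace I t" and i: "i \<in> Init"
    and e: "e \<in> tr_events t" "os_rspec Op e" "x \<in> obj e"
  obtains w where "is_max_in (x_ar \<xi>) (ctxt \<xi> CMod x e) w" "tr_wrinv t x e = {w}" "writes w x"
    "(w, e) \<in> tr_so i t" "ev_wval e x = Option.bind (ev_wval w x) (outcome Op e)"
    "\<And>w'. (w', e) \<in> tr_so i t \<Longrightarrow> writes w' x \<Longrightarrow> w' = w \<or> (w, w') \<notin> tr_so i t"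
proof -
  have ex: "is_execution Init \<xi>" using \<xi> by (simp add: local_exec_def)
  note ar = execution_ar[OF ex]
  have "e \<in> x_events \<xi> - Init" using e(1) \<xi> tr_events_not_init assms(2) by (auto simp: local_exec_def)
  then obtain w where w: "is_max_in (x_ar \<xi>) (ctxt \<xi> CMod x e) w" "x_wrinv \<xi> x e = {w}"
    "ev_wval e x = Option.bind (ev_wval w x) (outcome Op e)"
    using valid_read[of CMod \<xi> e x] \<xi> e unfolding local_exec_def by blast
  have wr: "(w, e) \<in> x_wr \<xi>" using w(2) \<open>e \<in> x_events \<xi> - Init\<close> by (auto simp: h_wr_def)
  have wx: "writes w x" using w(1) by (auto simp: is_max_in_def ctxt_def vis_def)
  show thesis
  proof (rule that)
    show "is_max_in (x_ar \<xi>) (ctxt \<xi> CMod x e) w" by (rule w)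
    show "writes w x" by (rule wx)
    show "tr_wrinv t x e = {w}" using w(2) \<xi> by (simp add: local_exec_def)
    show "(w, e) \<in> tr_so i t" using wr ar(6) \<xi> by (auto simp: local_exec_def)
    show "ev_wval e x = Option.bind (ev_wval w x) (outcome Op e)" by (rule w)
    fix w' assume w': "(w', e) \<in> tr_so i t" "writes w' x"
    have so: "(w', e) \<in> x_so \<xi>" using w' \<xi> by (simp add: local_exec_def)
    obtain v where "v \<in> CMod" "vis \<xi> v x w' e"
    proof (rule so_formula)
      fix v
      assume "v \<in> CMod" "\<And>\<xi> x e r. is_execution Init \<xi> \<Longrightarrow> (e, r) \<in> x_so \<xi> \<Longrightarrow> writes e x \<Longrightarrow>
        x_wrinv \<xi> x r \<noteq> {} \<Longrightarrow> vis \<xi> v x e r"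
      then show thesis using that ex so w'(2) w(2) by simp
    qed
    then have "w' \<in> ctxt \<xi> CMod x e" by (auto simp: ctxt_def vis_def)
    then have "w' = w \<or> (w', w) \<in> x_ar \<xi>" using w(1) by (auto simp: is_max_in_def)
    moreover have "(w, w') \<notin> tr_so i t" if "(w', w) \<in> x_ar \<xi>"
    proof
      assume "(w, w') \<in> tr_so i t"
      then have "(w, w') \<in> x_ar \<xi>" using ar(5,7) \<xi> by (auto simp: local_exec_def)
      then show False using that transD[OF ar(1)] ar(2) by (auto simp: irrefl_def)
    qed
    ultimately show "w' = w \<or> (w, w') \<notin> tr_so i t" by blast
  qed
qed

lemma ex_anchored: obtains i t where "anchored i t"
proof -
  obtain e\<^sub>0 where e0: "e\<^sub>0 \<in> calls Init Op" "os_rspec Op e\<^sub>0" using ex_read_call by blast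
  have t: "is_trace I []" "no_recv []" by (simp_all add: is_trace_def no_recv_def)
  obtain t' e where t': "is_trace I t'" "no_recv t'" "os_rspec Op e = os_rspec Op e\<^sub>0" "obj e = {undefined}"
    "tr_events t' = {e}"
    using fresh_call[OF t e0(1), of undefined undefined] by auto
  obtain i \<xi> where i: "i \<in> Init" "i \<in> os_events Op" "local_exec i t' \<xi>"
    using ex_local_exec[OF t'(1,2)] by blast
  have e: "e \<in> tr_events t'" "os_rspec Op e" "undefined \<in> obj e" using t' e0 by auto
  from local_read[OF i(3) t'(1) i(1) e] obtain w where w: "tr_wrinv t' undefined e = {w}" "(w, e) \<in> tr_so i t'"
    by metis
  \<comment> \<open>The trace has a single event, so the only possible \<open>so\<close>-predecessor
    of the read is the initial event.\<close>
  have "tr_so i t' \<subseteq> insert i {e} \<times> insert i {e}" "irrefl (tr_so i t')"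
    using i(3) t'(5) unfolding local_exec_def is_execution_def is_history_def by auto
  then have "w = i" using w(2) by (auto simp: irrefl_def)
  then have "anchored i t'" unfolding anchored_def using w e t' i by auto
  then show thesis by (rule that)
qed

text \<open>\<open>cur i t r x w\<close>: the last write to \<open>x\<close> at replica \<open>r\<close> is \<open>w\<close>.\<close>

definition cur ::
  "('id, 'rep, 'op, 'obj, 'val, 'meta) event \<Rightarrow>
   ('id, 'rep, 'op, 'obj, 'val, 'meta, 'l, 'msg) iaction list \<Rightarrow> 'rep \<Rightarrow> 'obj \<Rightarrow>
   ('id, 'rep, 'op, 'obj, 'val, 'meta) event \<Rightarrow> bool" where
  "cur i t r x w \<longleftrightarrow> (w = i \<or> w \<in> tr_events t \<and> ev_rep w = r) \<and> writes w x \<and>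
     (\<forall>w' \<in> tr_events t. ev_rep w' = r \<and> writes w' x \<and> w' \<noteq> w \<longrightarrow> (w', w) \<in> tr_so i t)"

text \<open>\<open>Y\<close> holds the objects that the new events must leave alone: the object read
  at the end of a half of the store-buffering run has to stay unwritten at that replica.\<close>

definition ext ::
  "('id, 'rep, 'op, 'obj, 'val, 'meta) event \<Rightarrow>
   ('id, 'rep, 'op, 'obj, 'val, 'meta, 'l, 'msg) iaction list \<Rightarrow>
   ('id, 'rep, 'op, 'obj, 'val, 'meta, 'l, 'msg) iaction list \<Rightarrow> 'rep \<Rightarrow> 'obj set \<Rightarrow> bool" where
  "ext i t t' r Y \<longleftrightarrow> anchored i t' \<and> tr_events t \<subseteq> tr_events t' \<and> tr_so i t \<subseteq> tr_so i t' \<and>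
     (\<forall>x a. tr_wrinv t x a \<subseteq> tr_wrinv t' x a) \<and>
     (\<forall>e \<in> tr_events t' - tr_events t. ev_rep e = r \<and> obj e \<inter> Y = {})"

lemma ext_refl: "anchored i t \<Longrightarrow> ext i t t r Y"
  by (simp add: ext_def)

lemma ext_trans: "ext i t t' r Y \<Longrightarrow> ext i t' t'' r Y \<Longrightarrow> ext i t t'' r Y"
  unfolding ext_def by blast

definition last_at ::
  "('id, 'rep, 'op, 'obj, 'val, 'meta) event \<Rightarrow>
   ('id, 'rep, 'op, 'obj, 'val, 'meta, 'l, 'msg) iaction list \<Rightarrow> 'rep \<Rightarrow>
   ('id, 'rep, 'op, 'obj, 'val, 'meta) event \<Rightarrow> bool" where
  "last_at i t r p \<longleftrightarrow> p \<in> tr_events t \<and> ev_rep p = r \<and>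
     (\<forall>a \<in> tr_events t. ev_rep a = r \<and> a \<noteq> p \<longrightarrow> (a, p) \<in> tr_so i t)"

lemma anchored_so:
  assumes "anchored i t"
  shows "irrefl (tr_so i t)" "trans (tr_so i t)" "e \<in> tr_events t \<Longrightarrow> (i, e) \<in> tr_so i t"
proof -
  obtain \<xi> where "local_exec i t \<xi>" using anchored_local_exec[OF assms] .
  then show "irrefl (tr_so i t)" "trans (tr_so i t)"
    unfolding local_exec_def is_execution_def is_history_def by auto
qed (auto simp: tr_so_def)

lemma anchored_writes_obj:
  assumes "anchored i t" "e \<in> tr_events t" "writes e x"
  shows "x \<in> obj e"
proof -
  obtain \<xi> where \<xi>: "local_exec i t \<xi>" using anchored_local_exec[OF assms(1)] .
  then have "well_read \<xi>" using valid_well_read[of CMod] by (simp add: local_exec_def)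
  moreover have "e \<in> x_events \<xi> - Init"
    using \<xi> assms tr_events_not_init by (auto simp: local_exec_def anchored_def)
  ultimately show ?thesis using assms(3) unfolding well_read_def by blast
qed

lemma cur_init:
  assumes "anchored i t" "\<And>a. a \<in> tr_events t \<Longrightarrow> ev_rep a = r \<Longrightarrow> x \<notin> obj a"
  shows "cur i t r x i"
  using assms anchored_writes_obj[OF assms(1)] init_writes
  unfolding cur_def anchored_def by blast

lemma cur_last: "last_at i t r p \<Longrightarrow> writes p x \<Longrightarrow> cur i t r x p"
  unfolding cur_def last_at_def by blast

text \<open>The value that a call of \<open>e\<^sub>0\<close> reads at \<open>r\<close> is known before the call, so that \<open>e\<^sub>0\<close>
  can be chosen depending on it.\<close>

lemma step:
  assumes t: "anchored i t" and e0: "e\<^sub>0 \<in> calls Init Op" and cur: "cur i t r x w" and Y: "x \<notin> Y"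
  shows "\<exists>t' e. ext i t t' r Y \<and> last_at i t' r e \<and> tr_events t' = insert e (tr_events t) \<and>
    (\<forall>a \<in> tr_events t. ev_rep a = r \<longrightarrow> (a, e) \<in> tr_so i t') \<and>
    obj e = {x} \<and> os_rspec Op e = os_rspec Op e\<^sub>0 \<and> os_wspec Op e = os_wspec Op e\<^sub>0 \<and>
    (os_rspec Op e \<longrightarrow> tr_wrinv t' x e = {w}) \<and>
    ev_wval e x = Option.bind (ev_wval w x) (outcome Op e\<^sub>0)"
proof -
  have t': "is_trace I t" "no_recv t" "i \<in> Init" using t by (auto simp: anchored_def)
  obtain t' e where e: "is_trace I t'" "no_recv t'" "e \<notin> tr_events t" "e \<in> calls Init Op"
    "ev_rep e = r" "obj e = {x}" "os_rspec Op e = os_rspec Op e\<^sub>0" "os_wspec Op e = os_wspec Op e\<^sub>0"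
    "tr_events t' = insert e (tr_events t)"
    "tr_so i t' = tr_so i t \<union> insert i {a \<in> tr_events t. ev_rep a = r} \<times> {e}"
    "\<And>y a. tr_wrinv t y a \<subseteq> tr_wrinv t' y a"
    using fresh_call[OF t'(1,2) e0, of r x] by blast
  have anch: "anchored i t'" using t e(1,2,9,11) unfolding anchored_def by blast
  obtain \<xi> where \<xi>: "local_exec i t' \<xi>" using anchored_local_exec[OF anch] .
  have et: "e \<in> tr_events t'" using e(9) by simp
  have "(a, e) \<notin> tr_so i t" for a
    using anchored_so[OF t] e(3) \<open>i \<in> Init\<close> e(4) calls_not_init unfolding tr_so_def tr_events_def
    by (auto dest!: nth_mem)
  then have pred: "(a, e) \<in> tr_so i t' \<longleftrightarrow> a = i \<or> a \<in> tr_events t \<and> ev_rep a = r" for a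
    using e(10) by auto
  have read: "tr_wrinv t' x e = {w} \<and> ev_wval e x = Option.bind (ev_wval w x) (outcome Op e)"
    if "os_rspec Op e"
  proof -
    have "x \<in> obj e" using e(6) by simp
    from local_read[OF \<xi> e(1) t'(3) et that this] obtain u where u: "tr_wrinv t' x e = {u}"
      "writes u x" "(u, e) \<in> tr_so i t'" "ev_wval e x = Option.bind (ev_wval u x) (outcome Op e)"
      "\<And>w'. (w', e) \<in> tr_so i t' \<Longrightarrow> writes w' x \<Longrightarrow> w' = u \<or> (u, w') \<notin> tr_so i t'"
      by metis
    \<comment> \<open>The next two facts identify \<open>u\<close> with \<open>w\<close>: no visible
      write of this replica may lie after the event read, whereas \<open>cur\<close> puts every
      other such write before \<open>w\<close>.\<close>
    have "w = u \<or> (u, w) \<notin> tr_so i t'"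
      using cur by (intro u(5)) (auto simp: cur_def pred)
    moreover have "w = u \<or> (u, w) \<in> tr_so i t'"
    proof (cases "u = i")
      case True
      then show ?thesis using cur anchored_so(3)[OF t, of w] e(10) by (auto simp: cur_def)
    next
      case False
      then have "u \<in> tr_events t \<and> ev_rep u = r" using u(3) pred by blast
      then show ?thesis using cur u(2) e(10) by (auto simp: cur_def)
    qed
    ultimately show ?thesis using u by auto
  qed
  \<comment> \<open>A call that does not read has the same outcome for every value, so the value of
    \<open>w\<close> may be inserted and both kinds of call are described by one equation.\<close>
  have val: "ev_wval e x = Option.bind (ev_wval w x) (outcome Op e)"
  proof (cases "os_rspec Op e")
    case False
    have "e \<in> x_events \<xi> - Init" using et \<xi> calls_not_init[OF e(4)] by (simp add: local_exec_def)
    then have "\<forall>v. ev_wval e x = outcome Op e v"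
      using valid_non_read(2)[of CMod \<xi> e x] \<xi> False e(6) unfolding local_exec_def by auto
    moreover have "ev_wval w x \<noteq> None" using cur by (simp add: cur_def writes_def)
    ultimately show ?thesis by auto
  qed (use read in blast)
  have "outcome Op e = outcome Op e\<^sub>0" using outcome_cong[OF e(8)] by blast
  then have "ev_wval e x = Option.bind (ev_wval w x) (outcome Op e\<^sub>0)" using val by simp
  moreover have "last_at i t' r e" unfolding last_at_def using e(5,9) pred by blast
  moreover have "ext i t t' r Y" unfolding ext_def using anch e Y by auto
  ultimately show ?thesis using read e pred by (intro exI[of _ t'] exI[of _ e]) auto
qed

end


section \<open>Realizing words by two replicas\<close>

context available_storage
begin

lemma step_write:
  assumes t: "anchored i t" and Y: "x \<notin> Y"
    and fresh: "\<And>a. a \<in> tr_events t \<Longrightarrow> ev_rep a = r \<Longrightarrow> x \<notin> obj a"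
  shows "\<exists>t' e. ext i t t' r Y \<and> last_at i t' r e \<and> tr_events t' = insert e (tr_events t) \<and>
    (\<forall>a \<in> tr_events t. ev_rep a = r \<longrightarrow> (a, e) \<in> tr_so i t') \<and> obj e = {x} \<and> writes e x \<and>
    (has_rw \<longrightarrow> os_rspec Op e)"
proof -
  have "writes i x" using t init_writes by (simp add: anchored_def)
  then obtain v where v: "ev_wval i x = Some v" by (auto simp: writes_def)
  obtain e\<^sub>0 where e0: "e\<^sub>0 \<in> calls Init Op" "outcome Op e\<^sub>0 v \<noteq> None" "has_rw \<longrightarrow> os_rspec Op e\<^sub>0"
    using ex_write_call[of v] ex_rw_call[of v] by (cases has_rw) (auto simp: is_rw_def)
  from step[OF t e0(1) cur_init[OF t fresh] Y]
  obtain t' e where "ext i t t' r Y" "last_at i t' r e" "tr_events t' = insert e (tr_events t)"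
    "\<forall>a \<in> tr_events t. ev_rep a = r \<longrightarrow> (a, e) \<in> tr_so i t'" "obj e = {x}"
    "os_rspec Op e = os_rspec Op e\<^sub>0"
    "ev_wval e x = Option.bind (ev_wval i x) (outcome Op e\<^sub>0)" by blast
  then show ?thesis using e0(2,3) v by (intro exI[of _ t'] exI[of _ e]) (auto simp: writes_def)
qed

text \<open>If read-write events exist, the reader is chosen among those that write after reading
  the value of \<open>w\<close>, so that a further \<open>wr\<close> edge can start from it.\<close>

lemma step_read:
  assumes t: "anchored i t" and Y: "x \<notin> Y" and cur: "cur i t r x w"
  shows "\<exists>t' e. ext i t t' r Y \<and> last_at i t' r e \<and> tr_events t' = insert e (tr_events t) \<and>
    (\<forall>a \<in> tr_events t. ev_rep a = r \<longrightarrow> (a, e) \<in> tr_so i t') \<and> obj e = {x} \<and>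
    os_rspec Op e \<and> tr_wrinv t' x e = {w} \<and> (has_rw \<longrightarrow> writes e x)"
proof -
  obtain v where v: "ev_wval w x = Some v" using cur by (auto simp: cur_def writes_def)
  obtain e\<^sub>0 where e0: "e\<^sub>0 \<in> calls Init Op" "has_rw \<longrightarrow> outcome Op e\<^sub>0 v \<noteq> None" "os_rspec Op e\<^sub>0"
    using ex_read_call ex_rw_call[of v] by (cases has_rw) (auto simp: is_rw_def)
  from step[OF t e0(1) cur Y]
  obtain t' e where "ext i t t' r Y" "last_at i t' r e" "tr_events t' = insert e (tr_events t)"
    "\<forall>a \<in> tr_events t. ev_rep a = r \<longrightarrow> (a, e) \<in> tr_so i t'" "obj e = {x}"
    "os_rspec Op e = os_rspec Op e\<^sub>0" "os_rspec Op e \<longrightarrow> tr_wrinv t' x e = {w}"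
    "ev_wval e x = Option.bind (ev_wval w x) (outcome Op e\<^sub>0)" by blast
  then show ?thesis using e0(2,3) v by (intro exI[of _ t'] exI[of _ e]) (auto simp: writes_def)
qed

lemma ex_fresh_obj:
  assumes "anchored i t" "finite Y"
  obtains x where "x \<notin> Y" "\<And>a. a \<in> tr_events t \<Longrightarrow> x \<notin> obj a"
proof -
  have "finite (obj a)" if "a \<in> tr_events t" for a
    using that assms(1) tr_events_not_init calls_obj unfolding anchored_def by (metis finite.simps)
  then have "finite (Y \<union> (\<Union>a\<in>tr_events t. obj a))" using assms(2) finite_tr_events by auto
  from ex_new_if_finite[OF infinite_obj this] show thesis using that by blast
qed

text \<open>The letter \<open>ar\<close> is realized by \<open>so\<close>: the arbitration order of the induced executions is not
  known, except that it contains \<open>so\<close>.\<close>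

definition lrel where
  "lrel i t R = (if R = RWr then {(a, b). b \<in> tr_events t \<and> (\<exists>x. a \<in> tr_wrinv t x b)} else tr_so i t)"

primrec lsem where
  "lsem i t [] = Id"
| "lsem i t (R # w) = lrel i t R O lsem i t w"

lemma lsem_append: "lsem i t (u @ w) = lsem i t u O lsem i t w"
  by (induction u) (simp_all add: O_assoc)

lemma ext_mono:
  assumes "ext i t t' r Y"
  shows "tr_events t \<subseteq> tr_events t'" "tr_so i t \<subseteq> tr_so i t'" "tr_wrinv t x a \<subseteq> tr_wrinv t' x a"
  using assms unfolding ext_def by blast+

lemma lrel_mono: "ext i t t' r Y \<Longrightarrow> lrel i t R \<subseteq> lrel i t' R"
  unfolding lrel_def using ext_mono by (fastforce split: if_splits)

lemma lsem_mono: "ext i t t' r Y \<Longrightarrow> lsem i t w \<subseteq> lsem i t' w"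
  by (induction w) (simp_all add: relcomp_mono lrel_mono)

lemma lsem_subset_wsem:
  assumes \<xi>: "local_exec i t \<xi>" and w: "simple w"
  shows "(a, b) \<in> lsem i t w \<Longrightarrow> b \<in> x_events \<xi> \<Longrightarrow> (a, b) \<in> wsem \<xi> w"
  using w
proof (induction w arbitrary: a)
  case (Cons R w)
  have ex: "is_execution Init \<xi>" using \<xi> by (simp add: local_exec_def)
  have "lrel i t R \<subseteq> rel_sem \<xi> R"
    using \<xi> Cons.prems(3) execution_ar(5-7)[OF ex]
    by (auto simp: lrel_def local_exec_def simple_def h_wr_def)
  then show ?case using Cons by (auto simp: simple_def)
qed auto

lemma realizable_ConsD:
  assumes "realizable (R # w)"
  shows "realizable w"
  using assms unfolding realizable_def by (auto simp: successively_Cons)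

lemma realizable_append:
  "realizable (u @ w) \<Longrightarrow> realizable u \<and> realizable w"
  unfolding realizable_def by (auto simp: successively_append_iff)

text \<open>Each letter costs one call at \<open>r\<close>. A \<open>wr\<close> edge is a read of an
  object that \<open>p\<close> wrote last; any other letter is realized by \<open>so\<close>,
  through a write to a fresh object from which a later \<open>wr\<close> edge can start. Two
  \<open>wr\<close> edges in a row need a reader that also writes, which \<open>realizable\<close>
  guarantees to exist. A leading \<open>wr\<close> needs an object written by \<open>p\<close>,
  hence the last assumption.\<close>

lemma realize_word:
  assumes "realizable w" "anchored i t" "last_at i t r p" "finite Y"
    and "w \<noteq> [] \<and> hd w = RWr \<Longrightarrow> \<exists>x. x \<notin> Y \<and> writes p x"
  shows "\<exists>t' q. ext i t t' r Y \<and> last_at i t' r q \<and> (p, q) \<in> lsem i t' w"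
  using assms
proof (induction w arbitrary: t p)
  case Nil
  then show ?case using ext_refl by fastforce
next
  case (Cons R w)
  have "\<exists>t' e. ext i t t' r Y \<and> last_at i t' r e \<and> (p, e) \<in> lrel i t' R \<and>
      (w \<noteq> [] \<and> hd w = RWr \<longrightarrow> (\<exists>x. x \<notin> Y \<and> writes e x))"
  proof (cases "R = RWr")
    case True
    then obtain x where x: "x \<notin> Y" "writes p x" using Cons.prems(5) by auto
    obtain t' e where e: "ext i t t' r Y" "last_at i t' r e" "tr_events t' = insert e (tr_events t)"
      "tr_wrinv t' x e = {p}" "has_rw \<longrightarrow> writes e x"
      using step_read[OF Cons.prems(2) x(1) cur_last[OF Cons.prems(3) x(2)]] by blast
    have "(p, e) \<in> lrel i t' R" using True e(3,4) by (auto simp: lrel_def)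
    moreover have "has_rw" if "w \<noteq> [] \<and> hd w = RWr"
      using Cons.prems(1) that True by (auto simp: realizable_def successively_Cons)
    ultimately show ?thesis using e x(1) by blast
  next
    case False
    obtain x where x: "x \<notin> Y" "\<And>a. a \<in> tr_events t \<Longrightarrow> x \<notin> obj a"
      using ex_fresh_obj[OF Cons.prems(2,4)] by blast
    obtain t' e where e: "ext i t t' r Y" "last_at i t' r e"
      "\<forall>a \<in> tr_events t. ev_rep a = r \<longrightarrow> (a, e) \<in> tr_so i t'" "writes e x"
      using step_write[OF Cons.prems(2) x(1), of r] x(2) by blast
    have "(p, e) \<in> lrel i t' R" using False e(3) Cons.prems(3) by (auto simp: lrel_def last_at_def)
    then show ?thesis using e x(1) by blast
  qed
  then obtain t' e where e: "ext i t t' r Y" "last_at i t' r e" "(p, e) \<in> lrel i t' R"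
    "w \<noteq> [] \<and> hd w = RWr \<Longrightarrow> \<exists>x. x \<notin> Y \<and> writes e x" by blast
  have "anchored i t'" using e(1) by (simp add: ext_def)
  from Cons.IH[OF realizable_ConsD[OF Cons.prems(1)] this e(2) Cons.prems(4) e(4)]
  obtain t'' q where q: "ext i t' t'' r Y" "last_at i t'' r q" "(e, q) \<in> lsem i t'' w" by blast
  then have "(p, q) \<in> lsem i t'' (R # w)" using e(3) lrel_mono[OF q(1)] by auto
  then show ?case using q ext_trans[OF e(1) q(1)] by blast
qed

text \<open>One replica of the store-buffering run: it writes \<open>x\<close>, follows \<alpha> to
  \<open>a\<close>, passes to \<open>d\<close> and follows \<beta> to a read of \<open>y\<close>
  that still returns the initial event. The edge into this read is realized by \<open>so\<close>,
  since the read takes its value from \<open>i\<close>; this is why \<beta> must not end in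
  \<open>wr\<close>.\<close>

lemma realize_half:
  assumes t: "anchored i t" and xy: "x \<noteq> y"
    and fresh: "\<And>a. a \<in> tr_events t \<Longrightarrow> ev_rep a = r \<Longrightarrow> x \<notin> obj a \<and> y \<notin> obj a"
    and \<alpha>: "realizable \<alpha>" and \<beta>: "realizable \<beta>" "\<beta> \<noteq> [] \<Longrightarrow> last \<beta> \<noteq> RWr"
  shows "\<exists>t' W a d b. ext i t t' r {} \<and> {W, a, d, b} \<subseteq> tr_events t' \<and>
    ev_rep a = r \<and> ev_rep d = r \<and> writes W x \<and>
    (W, a) \<in> lsem i t' \<alpha> \<and> (a, d) \<in> tr_so i t' \<and> (d, b) \<in> lsem i t' \<beta> \<and>
    os_rspec Op b \<and> y \<in> obj b \<and> i \<in> tr_wrinv t' y b"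
proof -
  have x: "x \<notin> {y}" using xy by simp
  obtain t1 W where W: "ext i t t1 r {y}" "last_at i t1 r W" "obj W = {x}" "writes W x"
    using step_write[OF t x, of r] fresh by blast
  have "\<exists>z. z \<notin> {y} \<and> writes W z" using W(4) xy by blast
  moreover have "anchored i t1" using W(1) by (simp add: ext_def)
  ultimately obtain t2 a where a: "ext i t1 t2 r {y}" "last_at i t2 r a" "(W, a) \<in> lsem i t2 \<alpha>"
    using realize_word[OF \<alpha>, of i t1 r W "{y}"] W(2) by blast
  have t12: "ext i t t2 r {y}" using ext_trans[OF W(1) a(1)] .
  have y_fresh: "y \<notin> obj e" if "ext i t t' r {y}" "e \<in> tr_events t'" "ev_rep e = r" for t' e
    using that fresh unfolding ext_def by (cases "e \<in> tr_events t") auto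
  have read: "\<exists>t'' b. ext i t' t'' r {} \<and> b \<in> tr_events t'' \<and> ev_rep b = r \<and> os_rspec Op b \<and>
      y \<in> obj b \<and> i \<in> tr_wrinv t'' y b \<and> (\<forall>a \<in> tr_events t'. ev_rep a = r \<longrightarrow> (a, b) \<in> tr_so i t'')"
    if t': "ext i t t' r {y}" for t'
  proof -
    have "anchored i t'" using t' by (simp add: ext_def)
    then obtain t'' b where b: "ext i t' t'' r {}" "last_at i t'' r b"
      "\<forall>a \<in> tr_events t'. ev_rep a = r \<longrightarrow> (a, b) \<in> tr_so i t''" "obj b = {y}"
      "os_rspec Op b" "tr_wrinv t'' y b = {i}"
      using step_read[of i t' y "{}" r i] cur_init[of i t' r y] y_fresh[OF t'] by blast
    then show ?thesis by (intro exI[of _ t''] exI[of _ b]) (simp add: last_at_def)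
  qed
  have weaken: "ext i t t'' r {}" if "ext i t t' r {y}" "ext i t' t'' r {}" for t' t''
  proof -
    have "ext i t t' r {}" using that(1) by (simp add: ext_def)
    then show ?thesis using that(2) by (rule ext_trans)
  qed
  show ?thesis
  proof (cases \<beta> rule: rev_cases)
    case Nil
    obtain t3 b where b: "ext i t2 t3 r {}" "b \<in> tr_events t3" "ev_rep b = r" "os_rspec Op b"
      "y \<in> obj b" "i \<in> tr_wrinv t3 y b" "\<forall>a \<in> tr_events t2. ev_rep a = r \<longrightarrow> (a, b) \<in> tr_so i t3"
      using read[OF t12] by blast
    have ev: "W \<in> tr_events t3" "a \<in> tr_events t3" "ev_rep a = r"
      using W(2) a(2) ext_mono(1)[OF a(1)] ext_mono(1)[OF b(1)] by (auto simp: last_at_def)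
    have ab: "(a, b) \<in> tr_so i t3" using b(7) a(2) by (simp add: last_at_def)
    have Wa: "(W, a) \<in> lsem i t3 \<alpha>" using a(3) lsem_mono[OF b(1)] by blast
    have db: "(b, b) \<in> lsem i t3 \<beta>" using Nil by simp
    show ?thesis
      using weaken[OF t12 b(1)] b W(4) Wa ab db ev
      by (intro exI[of _ t3] exI[of _ W] exI[of _ a] exI[of _ b]) simp
  next
    case (snoc \<beta>' R)
    have at2: "anchored i t2" using t12 by (simp add: ext_def)
    obtain z where z: "z \<notin> {y}" "\<And>a. a \<in> tr_events t2 \<Longrightarrow> z \<notin> obj a"
      using ex_fresh_obj[OF at2, of "{y}"] by blast
    \<comment> \<open>The write to a fresh object other than \<open>y\<close> makes \<open>d\<close>
      a possible start of \<open>\<beta>'\<close> even if that begins with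
      \<open>wr\<close>.\<close>
    obtain t3 d where d: "ext i t2 t3 r {y}" "last_at i t3 r d"
      "\<forall>a \<in> tr_events t2. ev_rep a = r \<longrightarrow> (a, d) \<in> tr_so i t3" "writes d z"
      using step_write[OF at2 z(1), of r] z(2) by blast
    have at3: "anchored i t3" using d(1) by (simp add: ext_def)
    have "realizable \<beta>'" using realizable_append[of \<beta>' "[R]"] \<beta>(1) snoc by simp
    moreover have "\<exists>z. z \<notin> {y} \<and> writes d z" using d(4) z(1) by blast
    ultimately obtain t4 q where q: "ext i t3 t4 r {y}" "last_at i t4 r q" "(d, q) \<in> lsem i t4 \<beta>'"
      using realize_word[of \<beta>' i t3 r d "{y}"] at3 d(2) by blast
    have t14: "ext i t t4 r {y}" using ext_trans[OF ext_trans[OF t12 d(1)] q(1)] .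
    obtain t5 b where b: "ext i t4 t5 r {}" "b \<in> tr_events t5" "ev_rep b = r" "os_rspec Op b"
      "y \<in> obj b" "i \<in> tr_wrinv t5 y b" "\<forall>a \<in> tr_events t4. ev_rep a = r \<longrightarrow> (a, b) \<in> tr_so i t5"
      using read[OF t14] by blast
    have e25: "tr_events t1 \<subseteq> tr_events t5" "tr_events t2 \<subseteq> tr_events t5" "tr_events t3 \<subseteq> tr_events t5"
      using ext_mono(1)[OF a(1)] ext_mono(1)[OF d(1)] ext_mono(1)[OF q(1)] ext_mono(1)[OF b(1)]
      by simp_all
    have "(q, b) \<in> tr_so i t5" using b(7) q(2) by (simp add: last_at_def)
    moreover have "R \<noteq> RWr" using \<beta>(2) snoc by simp
    ultimately have qb: "(q, b) \<in> lsem i t5 [R]" by (simp add: lrel_def)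
    have "(d, q) \<in> lsem i t5 \<beta>'" using q(3) lsem_mono[OF b(1)] by blast
    then have db: "(d, b) \<in> lsem i t5 \<beta>" unfolding snoc lsem_append using qb by blast
    have Wa: "(W, a) \<in> lsem i t5 \<alpha>"
      using a(3) lsem_mono[OF d(1)] lsem_mono[OF q(1)] lsem_mono[OF b(1)] by blast
    have "(a, d) \<in> tr_so i t3" using d(3) a(2) by (simp add: last_at_def)
    then have ad: "(a, d) \<in> tr_so i t5" using ext_mono(2)[OF q(1)] ext_mono(2)[OF b(1)] by blast
    have "W \<in> tr_events t5" "a \<in> tr_events t5" "d \<in> tr_events t5" "ev_rep a = r" "ev_rep d = r"
      using W(2) a(2) d(2) e25 by (auto simp: last_at_def)
    then show ?thesis
      using weaken[OF t14 b(1)] b W(4) Wa ad db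
      by (intro exI[of _ t5] exI[of _ W] exI[of _ a] exI[of _ d] exI[of _ b]) simp
  qed
qed

text \<open>Store buffering: with \<open>u = \<alpha>; ar; \<beta>\<close>, neither replica's final read of the other replica's
  object sees the other's write, which forces a cycle in \<open>ar\<close>.\<close>

lemma no_realizable_ar_word:
  assumes \<alpha>\<beta>: "\<alpha> @ RAr # \<beta> \<in> (\<Union>v\<in>CMod. flang v)" "realizable (\<alpha> @ RAr # \<beta>)"
    and \<beta>: "\<beta> \<noteq> [] \<Longrightarrow> last \<beta> \<noteq> RWr"
  shows False
proof -
  have re: "realizable \<alpha>" "realizable \<beta>"
    using realizable_append[OF \<alpha>\<beta>(2)] realizable_ConsD by blast+
  have si: "simple \<alpha>" "simple \<beta>" "simple (\<alpha> @ RAr # \<beta>)"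
    using \<alpha>\<beta>(1) flang_simple simple_append[of \<alpha>] simple_append[of "[RAr]" \<beta>] by auto
  obtain r1 r2 :: 'rep where r: "r1 \<noteq> r2" using two_reps by blast
  obtain i t where t: "anchored i t" by (rule ex_anchored)
  obtain x where x: "x \<notin> {}" "\<And>a. a \<in> tr_events t \<Longrightarrow> x \<notin> obj a"
    using ex_fresh_obj[OF t, of "{}"] by blast
  obtain y where y: "y \<notin> {x}" "\<And>a. a \<in> tr_events t \<Longrightarrow> y \<notin> obj a"
    using ex_fresh_obj[OF t, of "{x}"] by blast
  have xy: "x \<noteq> y" using y(1) by simp
  have fresh0: "x \<notin> obj a \<and> y \<notin> obj a" if "a \<in> tr_events t" "ev_rep a = r1" for a
    using that x(2) y(2) by blast
  obtain t1 W1 a1 d1 b1 where h1: "ext i t t1 r1 {}" "{W1, a1, d1, b1} \<subseteq> tr_events t1"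
    "ev_rep a1 = r1" "ev_rep d1 = r1" "writes W1 x" "(W1, a1) \<in> lsem i t1 \<alpha>" "(a1, d1) \<in> tr_so i t1"
    "(d1, b1) \<in> lsem i t1 \<beta>" "os_rspec Op b1" "y \<in> obj b1" "i \<in> tr_wrinv t1 y b1"
    using realize_half[OF t xy fresh0 re \<beta>] by blast
  have t1: "anchored i t1" using h1(1) by (simp add: ext_def)
  have fresh1: "y \<notin> obj a \<and> x \<notin> obj a" if "a \<in> tr_events t1" "ev_rep a = r2" for a
    using h1(1) that x(2) y(2) r unfolding ext_def by (cases "a \<in> tr_events t") auto
  have yx: "y \<noteq> x" using y(1) by simp
  obtain t2 W2 a2 d2 b2 where h2: "ext i t1 t2 r2 {}" "{W2, a2, d2, b2} \<subseteq> tr_events t2"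
    "ev_rep a2 = r2" "ev_rep d2 = r2" "writes W2 y" "(W2, a2) \<in> lsem i t2 \<alpha>" "(a2, d2) \<in> tr_so i t2"
    "(d2, b2) \<in> lsem i t2 \<beta>" "os_rspec Op b2" "x \<in> obj b2" "i \<in> tr_wrinv t2 x b2"
    using realize_half[OF t1 yx fresh1 re \<beta>] by blast
  have t2: "anchored i t2" using h2(1) by (simp add: ext_def)
  have up: "tr_events t1 \<subseteq> tr_events t2" "tr_so i t1 \<subseteq> tr_so i t2" "i \<in> tr_wrinv t2 y b1"
    using ext_mono(1,2)[OF h2(1)] ext_mono(3)[OF h2(1), of y b1] h1(11) by auto
  have l1: "(W1, a1) \<in> lsem i t2 \<alpha>" "(d1, b1) \<in> lsem i t2 \<beta>"
    using h1(6,8) lsem_mono[OF h2(1)] by blast+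
  obtain \<xi> where \<xi>: "local_exec i t2 \<xi>" using anchored_local_exec[OF t2] .
  have ex: "is_execution Init \<xi>" using \<xi> by (simp add: local_exec_def)
  note cl = is_execution_rel_closed[OF ex] and ar = execution_ar[OF ex]
  have evs: "x_events \<xi> = insert i (tr_events t2)" using \<xi> by (simp add: local_exec_def)
  have so_ar: "tr_so i t2 \<subseteq> x_ar \<xi>" using ar(5,7) \<xi> by (auto simp: local_exec_def)
  \<comment> \<open>If \<open>a\<close> came before \<open>d\<close> in \<open>ar\<close>, the word
    would lead from \<open>W\<close> through \<open>a\<close> and \<open>d\<close> to
    \<open>b\<close> and make \<open>W\<close> visible to \<open>b\<close>. But \<open>b\<close>
    reads \<open>i\<close>, which is below \<open>W\<close>, so the pair is ordered the other way.
    It is used with \<open>a\<close> and \<open>d\<close> on different replicas.\<close>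
  have key: "(d, a) \<in> x_ar \<xi>"
    if k: "writes W z" "(W, a) \<in> lsem i t2 \<alpha>" "(d, b) \<in> lsem i t2 \<beta>" "os_rspec Op b" "z \<in> obj b"
      "i \<in> tr_wrinv t2 z b" "a \<noteq> d" "{W, a, d, b} \<subseteq> tr_events t2" for W z a d b
  proof (rule ccontr)
    assume "(d, a) \<notin> x_ar \<xi>"
    moreover have "a \<in> x_events \<xi>" "d \<in> x_events \<xi>" using k(8) evs by auto
    ultimately have "(a, d) \<in> x_ar \<xi>" using ar(3) k(7) unfolding total_on_def by blast
    moreover have "(W, a) \<in> wsem \<xi> \<alpha>" "(d, b) \<in> wsem \<xi> \<beta>"
      using lsem_subset_wsem[OF \<xi> si(1) k(2)] lsem_subset_wsem[OF \<xi> si(2) k(3)] k(8) evs by auto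
    ultimately have "(W, b) \<in> wsem \<xi> (\<alpha> @ RAr # \<beta>)" by (auto simp: wsem_append[OF cl])
    moreover have "x_wrinv \<xi> z b \<noteq> {}" using k(6) \<xi> by (auto simp: local_exec_def)
    ultimately have "vis \<xi> (\<alpha> @ RAr # \<beta>) z W b" using k(1) vis_iff_wsem[OF cl] by blast
    then have "W \<in> ctxt \<xi> (\<Union>v\<in>CMod. flang v) z b"
      unfolding ctxt_def using \<alpha>\<beta>(1) k(8) evs by blast
    then have "W \<in> ctxt \<xi> CMod z b" unfolding ctxt_flang[OF cl, of CMod] .
    moreover obtain w where "is_max_in (x_ar \<xi>) (ctxt \<xi> CMod z b) w" "tr_wrinv t2 z b = {w}"
    proof -
      have "is_trace I t2" "i \<in> Init" "b \<in> tr_events t2" using t2 k(8) by (auto simp: anchored_def)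
      from local_read[OF \<xi> this k(4,5)] show thesis using that by blast
    qed
    ultimately have "W = i \<or> (W, i) \<in> x_ar \<xi>" using k(6) by (auto simp: is_max_in_def)
    moreover have "(i, W) \<in> x_ar \<xi>" using anchored_so(3)[OF t2, of W] k(8) so_ar by auto
    ultimately show False using transD[OF ar(1)] ar(2) by (auto simp: irrefl_def)
  qed
  have "a2 \<noteq> d1" "a1 \<noteq> d2" using h1(3,4) h2(3,4) r by auto
  have "{W2, a2, d1, b1} \<subseteq> tr_events t2" "{W1, a1, d2, b2} \<subseteq> tr_events t2"
    using h1(2) h2(2) up(1) by auto
  \<comment> \<open>Together with \<open>so\<close> on each replica this closes the cycle
    \<open>a1\<close>, \<open>d1\<close>, \<open>a2\<close>, \<open>d2\<close>,
    \<open>a1\<close>.\<close>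
  have "(d1, a2) \<in> x_ar \<xi>"
    by (rule key[OF h2(5,6) l1(2) h1(9,10) up(3)]) fact+
  moreover have "(d2, a1) \<in> x_ar \<xi>"
    by (rule key[OF h1(5) l1(1) h2(8,9,10,11)]) fact+
  moreover have "(a1, d1) \<in> x_ar \<xi>" "(a2, d2) \<in> x_ar \<xi>" using h1(7) h2(7) up(2) so_ar by blast+
  ultimately have "(a1, a1) \<in> x_ar \<xi>" using transD[OF ar(1)] by metis
  then show False using ar(2) by (simp add: irrefl_def)
qed

text \<open>The empty word makes a reading and writing event visible to itself. It would then have
  to be at most as late in \<open>ar\<close> as the event it reads, which precedes it.\<close>

lemma no_empty_word:
  assumes "[] \<in> (\<Union>v\<in>CMod. flang v)"
  shows "\<not> has_rw"
proof
  assume rw: has_rw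
  obtain i t where t: "anchored i t" by (rule ex_anchored)
  obtain x where x: "x \<notin> {}" "\<And>a. a \<in> tr_events t \<Longrightarrow> x \<notin> obj a"
    using ex_fresh_obj[OF t, of "{}"] by blast
  obtain t' e where e: "ext i t t' undefined {}" "last_at i t' undefined e" "obj e = {x}" "writes e x"
    "os_rspec Op e"
    using step_write[OF t x(1), of undefined] x(2) rw by blast
  have t': "anchored i t'" using e(1) by (simp add: ext_def)
  have et: "e \<in> tr_events t'" "x \<in> obj e" using e by (auto simp: last_at_def)
  obtain \<xi> where \<xi>: "local_exec i t' \<xi>" using anchored_local_exec[OF t'] .
  have ex: "is_execution Init \<xi>" using \<xi> by (simp add: local_exec_def)
  note cl = is_execution_rel_closed[OF ex] and ar = execution_ar[OF ex]
  have "is_trace I t'" "i \<in> Init" using t' by (auto simp: anchored_def)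
  from local_read[OF \<xi> this et(1) e(5) et(2)] obtain w where w:
    "is_max_in (x_ar \<xi>) (ctxt \<xi> CMod x e) w" "tr_wrinv t' x e = {w}" "(w, e) \<in> tr_so i t'" by metis
  have ex: "e \<in> x_events \<xi>" "x_wrinv \<xi> x e \<noteq> {}" using et w(2) \<xi> by (auto simp: local_exec_def)
  then have "e \<in> ctxt \<xi> CMod x e"
    using assms e(4) unfolding ctxt_flang[OF cl, of CMod] by (force simp: ctxt_def vis_iff_wsem[OF cl])
  then have "e = w \<or> (e, w) \<in> x_ar \<xi>" using w(1) by (auto simp: is_max_in_def)
  moreover have "(w, e) \<in> x_ar \<xi>" using w(3) ar(5,7) \<xi> by (auto simp: local_exec_def)
  ultimately show False using transD[OF ar(1)] ar(2) by (auto simp: irrefl_def)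
qed

text \<open>The word is split at an occurrence of \<open>ar\<close>; unless it ends in
  \<open>wr\<close> after that, store buffering excludes that it is realizable. The three shapes
  that remain are those that \<open>irrelevant_word\<close> handles.\<close>

lemma word_classification:
  assumes u: "u \<in> (\<Union>v\<in>CMod. flang v)" "u = [] \<or> RAr \<in> set u"
  shows "(\<exists>u'. u' \<noteq> [] \<and> u = u' @ [RWr]) \<or> \<not> realizable u \<or> (u = [] \<and> \<not> has_rw)"
proof (cases "u = []")
  case False
  then obtain \<alpha> \<beta> where \<alpha>\<beta>: "u = \<alpha> @ RAr # \<beta>" using u(2) split_list by fastforce
  show ?thesis
  proof (cases "\<beta> \<noteq> [] \<and> last \<beta> = RWr")
    case True
    then have "u = (\<alpha> @ RAr # butlast \<beta>) @ [RWr]" using \<alpha>\<beta> append_butlast_last_id[of \<beta>] by simp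
    then show ?thesis by blast
  next
    case False
    then show ?thesis using no_realizable_ar_word[of \<alpha> \<beta>] u(1) \<alpha>\<beta> by blast
  qed
qed (use no_empty_word u in blast)

end


section \<open>Irrelevant words\<close>

context basic_storage
begin

text \<open>Calls access a single object and a valid read has a single source, so a reader
  determines both the object and the write. The argument for words ending in \<open>wr\<close>
  depends on it.\<close>

lemma well_read_wrinv:
  assumes "well_read \<xi>" "r \<in> x_events \<xi>" "w \<in> x_wrinv \<xi> x r"
  shows "r \<notin> Init" "os_rspec Op r" "obj r = {x}" "x_wrinv \<xi> x r = {w}" "writes w x"
proof -
  show nI: "r \<notin> Init" using assms unfolding well_read_def by blast
  have c: "(if os_rspec Op r \<and> x \<in> obj r
         then \<exists>w \<in> x_events \<xi>. x_wrinv \<xi> x r = {w} \<and> writes w x \<and>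
                ev_wval r x = Option.bind (ev_wval w x) (outcome Op r)
         else x_wrinv \<xi> x r = {})"
    using assms(1,2) nI unfolding well_read_def by blast
  then have *: "os_rspec Op r \<and> x \<in> obj r" using assms(3) by (auto split: if_splits)
  then show "os_rspec Op r" by blast
  have "r \<in> calls Init Op" using assms(1,2) nI by (auto simp: well_read_def calls_def)
  then show "obj r = {x}" using calls_obj * by fastforce
  show "x_wrinv \<xi> x r = {w}" "writes w x" using c assms(3) unfolding if_P[OF *] by auto
qed

lemma well_read_writes:
  assumes "well_read \<xi>" "e \<in> x_events \<xi>" "e \<notin> Init" "writes e x"
  shows "e \<in> calls Init Op" "os_wspec Op e \<noteq> None"
  using assms unfolding well_read_def calls_def by blast+

lemma well_read_rw:
  assumes "well_read \<xi>" "e \<in> x_events \<xi>" "w \<in> x_wrinv \<xi> x e" "writes e y"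
  shows has_rw
proof -
  note r = well_read_wrinv[OF assms(1-3)]
  note w = well_read_writes[OF assms(1,2) r(1) assms(4)]
  show ?thesis unfolding has_rw_def is_rw_def using r(2) w by blast
qed

text \<open>An event below \<open>w\<close> cannot change the maximum of a context that contains
  \<open>w\<close>. For a word ending in \<open>wr\<close>, the source of the last edge is
  \<open>w\<close> itself and the nonempty rest climbs in \<open>ar\<close>. The other two shapes
  cannot occur: two adjacent \<open>wr\<close> edges, as well as visibility of a reader to itself,
  would need an event that reads and writes.\<close>

lemma irrelevant_word:
  assumes ex: "is_execution Init \<xi>" and wr: "well_read \<xi>"
    and u: "simple u" "(\<exists>u'. u' \<noteq> [] \<and> u = u' @ [RWr]) \<or> \<not> realizable u \<or> (u = [] \<and> \<not> has_rw)"
    and vis: "vis \<xi> u x e r" "w \<in> x_wrinv \<xi> x r"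
  shows "(e, w) \<in> x_ar \<xi>"
proof -
  note cl = is_execution_rel_closed[OF ex]
  have er: "(e, r) \<in> wsem \<xi> u" "writes e x" using vis vis_iff_wsem[OF cl] by auto
  have r: "r \<in> x_events \<xi>" using er(1) wsem_closed[OF cl] by blast
  note rd = well_read_wrinv[OF wr r vis(2)]
  consider u' where "u' \<noteq> []" "u = u' @ [RWr]" | "\<not> realizable u" | "u = []" "\<not> has_rw"
    using u(2) by blast
  then show ?thesis
  proof cases
    case 1
    then obtain z where z: "(e, z) \<in> wsem \<xi> u'" "(z, r) \<in> x_wr \<xi>"
      using er(1) by (auto simp: wsem_append[OF cl])
    obtain y where y: "z \<in> x_wrinv \<xi> y r" using z(2) by (auto simp: h_wr_def)
    have "y = x" using well_read_wrinv(3)[OF wr r y] rd(3) by auto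
    then have "z = w" using y rd(4) by auto
    moreover have "simple u'" using u(1) 1(2) simple_append by blast
    ultimately show ?thesis using wsem_simple_subset_ar'[OF ex _ 1(1)] z(1) by blast
  next
    case 2
    then have norw: "\<not> has_rw" and "\<not> successively (\<lambda>R S. \<not> (R = RWr \<and> S = RWr)) u"
      by (auto simp: realizable_def)
    have "successively (\<lambda>R S. \<not> (R = RWr \<and> S = RWr)) v" if "(a, b) \<in> wsem \<xi> v" for a b v
      using that
    proof (induction v arbitrary: a)
      case (Cons R v)
      obtain c where c: "(a, c) \<in> rel_sem \<xi> R" "(c, b) \<in> wsem \<xi> v" using Cons.prems by auto
      have "\<not> (R = RWr \<and> hd v = RWr)" if v: "v \<noteq> []"
      proof
        assume RR: "R = RWr \<and> hd v = RWr"
        then obtain d where "(a, c) \<in> x_wr \<xi>" "(c, d) \<in> x_wr \<xi>"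
          using c v by (cases v) auto
        then obtain y z where yz: "c \<in> x_events \<xi>" "a \<in> x_wrinv \<xi> y c" "d \<in> x_events \<xi>" "c \<in> x_wrinv \<xi> z d"
          by (auto simp: h_wr_def)
        then show False using well_read_rw[OF wr yz(1,2)] well_read_wrinv(5)[OF wr yz(3,4)] norw by blast
      qed
      then show ?case using Cons.IH[OF c(2)] by (auto simp: successively_Cons)
    qed simp
    then show ?thesis using \<open>\<not> successively _ u\<close> er(1) by blast
  next
    case 3
    then have "e = r" using er(1) by auto
    then show ?thesis using well_read_rw[OF wr r vis(2)] er(2) 3(2) by blast
  qed
qed

text \<open>The words outside \<open>F\<close> only add events below the event \<open>w\<close> that
  is read, and \<open>w\<close> is in the smaller context already because \<open>F\<close> covers
  \<open>wr\<close>. So the event read is the maximum of both contexts or of neither.\<close>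

lemma equivalent_if_irrelevant:
  assumes sub: "F \<subseteq> W" and si: "\<And>u. u \<in> W \<Longrightarrow> simple u"
    and irr: "\<And>u. u \<in> W - F \<Longrightarrow>
      (\<exists>u'. u' \<noteq> [] \<and> u = u' @ [RWr]) \<or> \<not> realizable u \<or> (u = [] \<and> \<not> has_rw)"
    and wrF: "[RWr] \<in> F \<or> [RRb] \<in> F"
  shows "equivalent_models Init obj Op W F"
  unfolding equivalent_models_def
proof (intro allI impI)
  fix \<xi> assume ex: "is_execution Init \<xi>"
  note cl = is_execution_rel_closed[OF ex]
  have max: "is_max_in (x_ar \<xi>) (ctxt \<xi> W x e) w = is_max_in (x_ar \<xi>) (ctxt \<xi> F x e) w"
    if wr: "well_read \<xi>" and e: "e \<in> x_events \<xi>" "x_wrinv \<xi> x e = {w}" for x e w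
  proof -
    have wx: "writes w x" using well_read_wrinv(5)[OF wr e(1), of w x] e(2) by simp
    have we: "(w, e) \<in> x_wr \<xi>" using e by (auto simp: h_wr_def)
    then have "(w, e) \<in> x_rb \<xi>" using execution_ar(6)[OF ex] by blast
    have "w \<in> x_events \<xi>" using we cl by (auto simp: rel_closed_def)
    have "\<exists>v\<in>F. vis \<xi> v x w e"
    proof -
      have "vis \<xi> [RWr] x w e" "vis \<xi> [RRb] x w e"
        unfolding vis_iff_wsem[OF cl] wsem_single[OF cl]
        using we \<open>(w, e) \<in> x_rb \<xi>\<close> wx e(2) by simp_all
      then show ?thesis using wrF by blast
    qed
    then have wF: "w \<in> ctxt \<xi> F x e" using \<open>w \<in> x_events \<xi>\<close> by (simp add: ctxt_def)
    have FW: "ctxt \<xi> F x e \<subseteq> ctxt \<xi> W x e" using sub by (auto simp: ctxt_def)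
    have "a \<in> ctxt \<xi> F x e \<or> (a, w) \<in> x_ar \<xi>" if a: "a \<in> ctxt \<xi> W x e" for a
    proof -
      obtain u where u: "u \<in> W" "vis \<xi> u x a e" using a by (auto simp: ctxt_def)
      show ?thesis
      proof (cases "u \<in> F")
        case True
        then show ?thesis using u a by (auto simp: ctxt_def)
      next
        case False
        have "w \<in> x_wrinv \<xi> x e" using e(2) by simp
        then show ?thesis using irrelevant_word[OF ex wr si[OF u(1)] _ u(2)] irr u(1) False by blast
      qed
    qed
    then show ?thesis using wF FW unfolding is_max_in_def by blast
  qed
  have imp: "valid Init obj C' Op \<xi>" if v: "valid Init obj C Op \<xi>"
    and m: "\<And>x e w. e \<in> x_events \<xi> \<Longrightarrow> x_wrinv \<xi> x e = {w} \<Longrightarrow>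
      is_max_in (x_ar \<xi>) (ctxt \<xi> C x e) w = is_max_in (x_ar \<xi>) (ctxt \<xi> C' x e) w" for C C'
    unfolding valid_def
  proof (intro conjI ballI allI)
    show "x_events \<xi> \<subseteq> os_events Op" using v by (simp add: valid_def)
    show "x_wrinv \<xi> x e = {}" if "e \<in> x_events \<xi> \<inter> Init" for e x using v that unfolding valid_def by blast
    fix e x assume e: "e \<in> x_events \<xi> - Init"
    have ve: "if os_rspec Op e \<and> x \<in> obj e
        then \<exists>w. is_max_in (x_ar \<xi>) (ctxt \<xi> C x e) w \<and> x_wrinv \<xi> x e = {w} \<and>
                 ev_wval e x = Option.bind (ev_wval w x) (outcome Op e)
        else x_wrinv \<xi> x e = {} \<and>
             (if x \<in> obj e then \<forall>v. ev_wval e x = outcome Op e v else ev_wval e x = None)"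
      using v e unfolding valid_def by blast
    show "if os_rspec Op e \<and> x \<in> obj e
        then \<exists>w. is_max_in (x_ar \<xi>) (ctxt \<xi> C' x e) w \<and> x_wrinv \<xi> x e = {w} \<and>
                 ev_wval e x = Option.bind (ev_wval w x) (outcome Op e)
        else x_wrinv \<xi> x e = {} \<and>
             (if x \<in> obj e then \<forall>v. ev_wval e x = outcome Op e v else ev_wval e x = None)"
    proof (cases "os_rspec Op e \<and> x \<in> obj e")
      case True
      obtain w where "is_max_in (x_ar \<xi>) (ctxt \<xi> C x e) w" "x_wrinv \<xi> x e = {w}"
        "ev_wval e x = Option.bind (ev_wval w x) (outcome Op e)"
        using ve unfolding if_P[OF True] by blast
      then show ?thesis unfolding if_P[OF True] using m[of e x w] e by blast
    next
      case False
      then show ?thesis using ve unfolding if_not_P[OF False] by blast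
    qed
  qed
  show "valid Init obj W Op \<xi> = valid Init obj F Op \<xi>"
  proof
    assume v: "valid Init obj W Op \<xi>"
    show "valid Init obj F Op \<xi>" using imp[OF v] max[OF valid_well_read[OF v]] by blast
  next
    assume v: "valid Init obj F Op \<xi>"
    show "valid Init obj W Op \<xi>" using imp[OF v] max[OF valid_well_read[OF v]] by blast
  qed
qed


section \<open>Two executions that detect single-letter words\<close>

text \<open>Initial event \<open>i\<close>, a write \<open>a\<close> and a read \<open>b\<close> of
  the same object. The pair \<open>(a, b)\<close> always belongs to \<open>rb\<close> and
  \<open>ar\<close>, whereas \<open>s\<close> switches its membership in \<open>so\<close> and the
  source \<open>c\<close> of the read its membership in \<open>wr\<close>. The two relations can
  thus be tested separately.\<close>

definition tri ::
  "('id, 'rep, 'op, 'obj, 'val, 'meta) event \<Rightarrow> ('id, 'rep, 'op, 'obj, 'val, 'meta) event \<Rightarrow>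
   ('id, 'rep, 'op, 'obj, 'val, 'meta) event \<Rightarrow> 'obj \<Rightarrow> bool \<Rightarrow>
   ('id, 'rep, 'op, 'obj, 'val, 'meta) event \<Rightarrow> ('id, 'rep, 'op, 'obj, 'val, 'meta) execution" where
  "tri i a b x s c =
     \<lparr>x_hist = \<lparr>h_events = {i, a, b}, h_so = {(i, a), (i, b)} \<union> (if s then {(a, b)} else {}),
        h_wrinv = (\<lambda>y e. if y \<noteq> x then {} else if e = a \<and> os_rspec Op a then {i}
                          else if e = b then {c} else {})\<rparr>,
      x_rb = {(i, a), (i, b), (a, b)}, x_ar = {(i, a), (i, b), (a, b)}\<rparr>"

lemma tri_sel:
  assumes "a \<noteq> b"
  shows "x_events (tri i a b x s c) = {i, a, b}"
    "x_so (tri i a b x s c) = {(i, a), (i, b)} \<union> (if s then {(a, b)} else {})"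
    "x_wr (tri i a b x s c) = (if os_rspec Op a then {(i, a)} else {}) \<union> {(c, b)} \<union>
      (if i = a \<and> os_rspec Op a then {(i, i)} else if i = b then {(c, i)} else {})"
    "x_rb (tri i a b x s c) = {(i, a), (i, b), (a, b)}"
    "x_ar (tri i a b x s c) = {(i, a), (i, b), (a, b)}"
    "x_wrinv (tri i a b x s c) = (\<lambda>y e. if y \<noteq> x then {} else if e = a \<and> os_rspec Op a then {i}
                          else if e = b then {c} else {})"
  using assms by (auto simp: tri_def h_wr_def split: if_splits)

lemma tri_execution:
  assumes i: "i \<in> Init" and ab: "a \<notin> Init" "b \<notin> Init" "a \<noteq> b"
    and s: "s \<longleftrightarrow> ev_rep a = ev_rep b" and c: "c = i \<or> c = a"
  shows "is_execution Init (tri i a b x s c)"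
proof -
  let ?\<xi> = "tri i a b x s c"
  note sel = tri_sel[OF ab(3), of i x s c]
  have ne: "i \<noteq> a" "i \<noteq> b" using i ab by auto
  have wr: "x_wr ?\<xi> \<subseteq> {(i, a), (i, b), (a, b)}" unfolding sel using ne c by auto
  have tr: "trans {(i, a), (i, b), (a, b)}" using ne ab(3) by (intro transI) auto
  have "acyclic {(i, a), (i, b), (a, b)}"
    unfolding acyclic_def trancl_id[OF tr] using ne ab(3) by auto
  then have ac: "acyclic (x_so ?\<xi> \<union> x_wr ?\<xi>)"
  proof (rule acyclic_subset)
    show "x_so ?\<xi> \<union> x_wr ?\<xi> \<subseteq> {(i, a), (i, b), (a, b)}" using wr unfolding sel(2) by simp
  qed
  have hist: "is_history Init (x_hist ?\<xi>)"
    unfolding is_history_def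
  proof (intro conjI)
    show "\<exists>j. x_events ?\<xi> \<inter> Init = {j} \<and> (\<forall>e\<in>x_events ?\<xi> - {j}. (j, e) \<in> x_so ?\<xi>)"
      using i ab by (intro exI[of _ i]) (auto simp: sel)
    show "trans (x_so ?\<xi>)" using ne ab(3) by (intro transI) (auto simp: sel split: if_splits)
    show "irrefl (x_so ?\<xi>)" using ne ab(3) by (auto simp: sel irrefl_def)
    show "\<forall>e\<in>x_events ?\<xi> - Init. \<forall>e'\<in>x_events ?\<xi> - Init. e \<noteq> e' \<longrightarrow>
        ((e, e') \<in> x_so ?\<xi> \<or> (e', e) \<in> x_so ?\<xi>) = (ev_rep e = ev_rep e')"
    proof (intro ballI impI)
      fix e e' assume e: "e \<in> x_events ?\<xi> - Init" "e' \<in> x_events ?\<xi> - Init" "e \<noteq> e'"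
      have so: "(a, b) \<in> x_so ?\<xi> \<longleftrightarrow> ev_rep a = ev_rep b" "(b, a) \<notin> x_so ?\<xi>"
        unfolding sel(2) using ne ab(3) s by auto
      have "e \<in> {a, b}" "e' \<in> {a, b}" using e i unfolding sel(1) by blast+
      then consider "e = a" "e' = b" | "e = b" "e' = a" using e(3) by blast
      then show "((e, e') \<in> x_so ?\<xi> \<or> (e', e) \<in> x_so ?\<xi>) = (ev_rep e = ev_rep e')"
      proof cases
        case 1
        then show ?thesis using so by simp
      next
        case 2
        then show ?thesis using so by (simp add: eq_commute[of "ev_rep b"])
      qed
    qed
    show "\<forall>y. \<forall>e\<in>x_events ?\<xi>. x_wrinv ?\<xi> y e \<subseteq> x_events ?\<xi>"
      using c unfolding sel(1,6) by (simp split: if_split) blast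
    show "acyclic (x_so ?\<xi> \<union> x_wr ?\<xi>)" by (rule ac)
    show "finite (x_events ?\<xi>)" by (simp add: sel)
    show "x_so ?\<xi> \<subseteq> x_events ?\<xi> \<times> x_events ?\<xi>" by (simp add: sel)
  qed
  have star: "(x_so ?\<xi>)\<^sup>* \<subseteq> {(i, a), (i, b), (a, b)} \<union> Id"
  proof -
    have "(x_so ?\<xi>)\<^sup>* \<subseteq> {(i, a), (i, b), (a, b)}\<^sup>*" by (rule rtrancl_mono) (auto simp: sel)
    also have "\<dots> = {(i, a), (i, b), (a, b)} \<union> Id"
      unfolding rtrancl_trancl_reflcl trancl_id[OF tr] by simp
    finally show ?thesis .
  qed
  have "x_rb ?\<xi> O (x_so ?\<xi>)\<^sup>* \<subseteq> x_rb ?\<xi> O ({(i, a), (i, b), (a, b)} \<union> Id)"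
    by (rule relcomp_mono[OF order_refl star])
  also have "\<dots> \<subseteq> x_rb ?\<xi>" using ne ab(3) by (auto simp: sel(4))
  finally have "x_rb ?\<xi> O (x_so ?\<xi>)\<^sup>* \<subseteq> x_rb ?\<xi>" .
  moreover have "x_rb ?\<xi> O Id \<subseteq> x_rb ?\<xi> O (x_so ?\<xi>)\<^sup>*" by (rule relcomp_mono) auto
  ultimately have rb: "x_rb ?\<xi> = x_rb ?\<xi> O (x_so ?\<xi>)\<^sup>*" unfolding R_O_Id by (intro equalityI)
  show ?thesis
    unfolding is_execution_def
  proof (intro conjI)
    show "strict_linear_order_on (x_events ?\<xi>) (x_ar ?\<xi>)"
      unfolding strict_linear_order_on_def using ne ab(3)
      by (intro conjI transI) (auto simp: sel irrefl_def total_on_def)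
    show "asym (x_rb ?\<xi>)" using ne ab(3) by (auto simp: sel intro!: asymI)
    show "irrefl (x_rb ?\<xi>)" using ne ab(3) by (auto simp: sel irrefl_def)
    show "x_so ?\<xi> \<union> x_wr ?\<xi> \<subseteq> x_rb ?\<xi>" using wr unfolding sel(2,4) by simp
    show "x_rb ?\<xi> = x_rb ?\<xi> O (x_so ?\<xi>)\<^sup>*" by (rule rb)
    show "x_ar ?\<xi> \<subseteq> x_events ?\<xi> \<times> x_events ?\<xi>" "x_rb ?\<xi> \<subseteq> x_ar ?\<xi>" by (simp_all add: sel)
  qed (rule hist)
qed

text \<open>No event lies between \<open>a\<close> and \<open>b\<close> in \<open>ar\<close> and
  none above \<open>b\<close>, so a word leading from \<open>a\<close> to \<open>b\<close> has room
  for one letter only.\<close>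

lemma tri_word:
  assumes ex: "is_execution Init (tri i a b x s c)" and ne: "a \<noteq> b" "i \<noteq> a" "i \<noteq> b"
    and u: "simple u" "(a, b) \<in> wsem (tri i a b x s c) u"
  shows "\<exists>R. u = [R] \<and> (a, b) \<in> rel_sem (tri i a b x s c) R"
proof -
  let ?\<xi> = "tri i a b x s c"
  note sel = tri_sel[OF ne(1), of i x s c]
  obtain R v where Rv: "u = R # v" using u(2) ne(1) by (cases u) auto
  obtain z where z: "(a, z) \<in> rel_sem ?\<xi> R" "(z, b) \<in> wsem ?\<xi> v" using u(2) Rv by auto
  have "R \<in> {RSo, RWr, RRb, RAr}" "simple v" using u(1) Rv by (auto simp: simple_def)
  then have "(a, z) \<in> x_ar ?\<xi>" using rel_sem_simple_subset_ar[OF ex] z(1) by blast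
  then have "z = b" using ne by (auto simp: sel)
  have "v = []"
  proof (rule ccontr)
    assume "v \<noteq> []"
    then have "(b, b) \<in> x_ar ?\<xi>"
      using wsem_simple_subset_ar'[OF ex \<open>simple v\<close>] z(2) \<open>z = b\<close> by blast
    then show False using ne by (auto simp: sel)
  qed
  then show ?thesis using Rv z(1) \<open>z = b\<close> by simp
qed

lemma all_eq_at: "(\<And>y. y \<noteq> x \<Longrightarrow> P y) \<Longrightarrow> (\<forall>y. P y) \<longleftrightarrow> P x"
  by metis

text \<open>The value equations of validity are built in, so that validity of \<open>tri\<close>
  becomes a question about contexts alone. The equation for \<open>a\<close> also covers a write
  that does not read, whose outcome is constant.\<close>

definition tri_events where
  "tri_events i a b x c \<longleftrightarrow> i \<in> Init \<and> i \<in> os_events Op \<and> a \<in> calls Init Op \<and> b \<in> calls Init Op \<and>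
     a \<noteq> b \<and> obj a = {x} \<and> obj b = {x} \<and> os_rspec Op b \<and> writes a x \<and> (c = i \<or> c = a) \<and>
     ev_wval a = (\<lambda>y. if y = x then Option.bind (ev_wval i x) (outcome Op a) else None) \<and>
     ev_wval b = (\<lambda>y. if y = x then Option.bind (ev_wval c x) (outcome Op b) else None)"

text \<open>Contexts lie below the reader in \<open>ar\<close>, so \<open>a\<close> sees at most
  \<open>i\<close> and \<open>b\<close> at most \<open>i\<close> and \<open>a\<close>; the maxima
  can be read off.\<close>

lemma tri_valid_iff:
  assumes T: "tri_events i a b x c" and s: "s \<longleftrightarrow> ev_rep a = ev_rep b"
    and C: "\<And>u. u \<in> C \<Longrightarrow> simple u \<and> u \<noteq> []"
  shows "valid Init obj C Op (tri i a b x s c) \<longleftrightarrow>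
    (os_rspec Op a \<longrightarrow> i \<in> ctxt (tri i a b x s c) C x a) \<and>
    c \<in> ctxt (tri i a b x s c) C x b \<and> (c = i \<longrightarrow> a \<notin> ctxt (tri i a b x s c) C x b)"
proof -
  let ?\<xi> = "tri i a b x s c"
  have i: "i \<in> Init" "i \<in> os_events Op" and ab: "a \<in> calls Init Op" "b \<in> calls Init Op" "a \<noteq> b"
    and ob: "obj a = {x}" "obj b = {x}" "os_rspec Op b" and ax: "writes a x" and c: "c = i \<or> c = a"
    and val: "ev_wval a = (\<lambda>y. if y = x then Option.bind (ev_wval i x) (outcome Op a) else None)"
      "ev_wval b = (\<lambda>y. if y = x then Option.bind (ev_wval c x) (outcome Op b) else None)"
    using T unfolding tri_events_def by - (elim conjE, assumption)+
  have nI: "a \<notin> Init" "b \<notin> Init" using ab calls_not_init by blast+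
  then have ne: "i \<noteq> a" "i \<noteq> b" using i by auto
  note sel = tri_sel[OF ab(3), of i x s c]
  note ex = tri_execution[OF i(1) nI ab(3) s c, of x]
  note cl = is_execution_rel_closed[OF ex]
  have sub: "(e, r) \<in> x_ar ?\<xi>" if e: "e \<in> ctxt ?\<xi> C x r" for e r
  proof -
    obtain u where "u \<in> C" "vis ?\<xi> u x e r" using e by (auto simp: ctxt_def)
    then show ?thesis
      using wsem_simple_subset_ar'[OF ex, of u] C[of u] vis_iff_wsem[OF cl] by blast
  qed
  have ca: "ctxt ?\<xi> C x a \<subseteq> {i}" and cb: "ctxt ?\<xi> C x b \<subseteq> {i, a}"
    using sub ne ab(3) unfolding sel by blast+
  have ma: "is_max_in (x_ar ?\<xi>) (ctxt ?\<xi> C x a) i \<longleftrightarrow> i \<in> ctxt ?\<xi> C x a"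
    using ca by (auto simp: is_max_in_def)
  have mb: "is_max_in (x_ar ?\<xi>) (ctxt ?\<xi> C x b) c \<longleftrightarrow>
      c \<in> ctxt ?\<xi> C x b \<and> (c = i \<longrightarrow> a \<notin> ctxt ?\<xi> C x b)"
  proof -
    have ar: "(a, i) \<notin> x_ar ?\<xi>" "(i, a) \<in> x_ar ?\<xi>" unfolding sel(5) using ne ab(3) by auto
    from c show ?thesis
    proof
      assume "c = i"
      then show ?thesis using cb ar(1) ne(1) unfolding is_max_in_def by auto
    next
      assume "c = a"
      then show ?thesis using cb ar(2) ne(1) unfolding is_max_in_def by auto
    qed
  qed
  have wi: "\<exists>v. ev_wval i x = Some v" using init_writes[OF i(1), of x] by (auto simp: writes_def)
  have nr: "\<forall>v. ev_wval a x = outcome Op a v" if nra: "\<not> os_rspec Op a"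
  proof
    fix v
    obtain v' where "ev_wval i x = Some v'" using wi by blast
    then show "ev_wval a x = outcome Op a v" using val(1) non_read_outcome[OF ab(1) nra, of v v'] by simp
  qed
  have evs: "x_events ?\<xi> - Init = {a, b}" "x_events ?\<xi> \<inter> Init = {i}" using i nI by (auto simp: sel)
  have os: "x_events ?\<xi> \<subseteq> os_events Op" using i ab calls_not_init by (auto simp: sel)
  have wrinv: "x_wrinv ?\<xi> y i = {}" "x_wrinv ?\<xi> y a = (if y = x \<and> os_rspec Op a then {i} else {})"
    "x_wrinv ?\<xi> y b = (if y = x then {c} else {})" for y
    using ne ab(3) by (auto simp: sel)
  let ?V = "\<lambda>e y. if os_rspec Op e \<and> y \<in> obj e
      then \<exists>w. is_max_in (x_ar ?\<xi>) (ctxt ?\<xi> C y e) w \<and> x_wrinv ?\<xi> y e = {w} \<and>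
               ev_wval e y = Option.bind (ev_wval w y) (outcome Op e)
      else x_wrinv ?\<xi> y e = {} \<and>
           (if y \<in> obj e then \<forall>v. ev_wval e y = outcome Op e v else ev_wval e y = None)"
  have Va: "(\<forall>y. ?V a y) \<longleftrightarrow> (os_rspec Op a \<longrightarrow> i \<in> ctxt ?\<xi> C x a)"
  proof -
    have "?V a y" if "y \<noteq> x" for y using that ob(1) val(1) wrinv(2)[of y] by simp
    then have "(\<forall>y. ?V a y) \<longleftrightarrow> ?V a x" by (rule all_eq_at)
    moreover have "?V a x \<longleftrightarrow> (os_rspec Op a \<longrightarrow> i \<in> ctxt ?\<xi> C x a)"
    proof (cases "os_rspec Op a")
      case True
      have "ev_wval a x = Option.bind (ev_wval i x) (outcome Op a)" by (simp add: val(1))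
      moreover have "x_wrinv ?\<xi> x a = {i}" using wrinv(2)[of x] True by simp
      ultimately show ?thesis using True ob(1) ma by auto
    next
      case False
      moreover have "x_wrinv ?\<xi> x a = {}" using wrinv(2)[of x] False by simp
      ultimately show ?thesis using nr[OF False] ob(1) by simp
    qed
    ultimately show ?thesis by (rule trans)
  qed
  have Vb: "(\<forall>y. ?V b y) \<longleftrightarrow> is_max_in (x_ar ?\<xi>) (ctxt ?\<xi> C x b) c"
  proof -
    have "?V b y" if "y \<noteq> x" for y using that ob(2) val(2) wrinv(3)[of y] by simp
    then have "(\<forall>y. ?V b y) \<longleftrightarrow> ?V b x" by (rule all_eq_at)
    moreover have "?V b x \<longleftrightarrow> is_max_in (x_ar ?\<xi>) (ctxt ?\<xi> C x b) c"
    proof -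
      have "ev_wval b x = Option.bind (ev_wval c x) (outcome Op b)" by (simp add: val(2))
      moreover have "x_wrinv ?\<xi> x b = {c}" using wrinv(3)[of x] by simp
      ultimately show ?thesis using ob(2,3) by auto
    qed
    ultimately show ?thesis by (rule trans)
  qed
  have "valid Init obj C Op ?\<xi> \<longleftrightarrow> (\<forall>y. ?V a y) \<and> (\<forall>y. ?V b y)"
    unfolding valid_def evs using os wrinv(1) by simp
  then show ?thesis unfolding Va Vb mb .
qed

end


section \<open>Normal form of an implementable model\<close>

context basic_storage
begin

text \<open>The flag \<open>d\<close> lets \<open>b\<close> read the initial event instead of
  \<open>a\<close>, and \<open>s\<close> puts both calls on one replica. Distinct identifiers keep
  the two calls apart, and the outcomes are chosen to match the values read.\<close>

lemma ex_tri:
  assumes i: "i \<in> Init" "i \<in> os_events Op"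
  obtains a b x where "tri_events i a b x (if d then i else a)" "s \<longleftrightarrow> ev_rep a = ev_rep b"
proof -
  obtain q q' :: 'rep where q: "q \<noteq> q'" using two_reps by blast
  define r r' where "r = q" and "r' = (if s then q else q')"
  have r: "s \<longleftrightarrow> r = r'" using q by (simp add: r_def r'_def)
  define n :: 'id where "n = undefined"
  obtain n' where n': "n' \<notin> {n}" using ex_new_if_finite[OF infinite_id, of "{n}"] by blast
  define x :: 'obj where "x = undefined"
  obtain v where v: "ev_wval i x = Some v" using init_writes[OF i(1), of x] by (auto simp: writes_def)
  obtain e where e: "e \<in> calls Init Op" "outcome Op e v \<noteq> None" using ex_write_call by blast
  obtain a1 where a1: "a1 \<in> calls Init Op" "ev_rep a1 = r" "ev_id a1 = n" "obj a1 = {x}"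
    "os_rspec Op a1 = os_rspec Op e" "os_wspec Op a1 = os_wspec Op e"
    by (rule ex_call_at[OF e(1)])
  obtain a where a: "a \<in> calls Init Op" "same_call obj Op a1 a"
    "ev_wval a = (\<lambda>y. if y \<in> obj a1 then outcome Op a1 v else None)"
    by (rule ex_outcome[OF a1(1), where v = v])
  note sa = same_callD[OF a(2)]
  have oa: "outcome Op a u = outcome Op e u" "outcome Op a1 u = outcome Op e u" for u
    using outcome_cong[OF sa(5)] outcome_cong[OF a1(6)] by simp_all
  have wa: "writes a x" using a(3) a1(4) oa e(2) by (simp add: writes_def)
  define c where "c = (if d then i else a)"
  have "writes c x" using wa init_writes[OF i(1)] by (simp add: c_def)
  then obtain v' where v': "ev_wval c x = Some v'" by (auto simp: writes_def)
  obtain f where f: "f \<in> calls Init Op" "os_rspec Op f" using ex_read_call by blast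
  obtain b1 where b1: "b1 \<in> calls Init Op" "ev_rep b1 = r'" "ev_id b1 = n'" "obj b1 = {x}"
    "os_rspec Op b1 = os_rspec Op f" "os_wspec Op b1 = os_wspec Op f"
    by (rule ex_call_at[OF f(1)])
  obtain b where b: "b \<in> calls Init Op" "same_call obj Op b1 b"
    "ev_wval b = (\<lambda>y. if y \<in> obj b1 then outcome Op b1 v' else None)"
    by (rule ex_outcome[OF b1(1), where v = v'])
  note sb = same_callD[OF b(2)]
  have ob: "outcome Op b u = outcome Op b1 u" for u using outcome_cong[OF sb(5)] .
  have ab: "a \<noteq> b" using sa(1) sb(1) a1(3) b1(3) n' by auto
  have va: "ev_wval a = (\<lambda>y. if y = x then Option.bind (ev_wval i x) (outcome Op a) else None)"
    unfolding a(3) a1(4) v by (simp add: fun_eq_iff oa)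
  have vb: "ev_wval b = (\<lambda>y. if y = x then Option.bind (ev_wval c x) (outcome Op b) else None)"
    unfolding b(3) b1(4) v' by (simp add: fun_eq_iff ob)
  have obs: "obj a = {x}" "obj b = {x}" "os_rspec Op b" using sa sb a1 b1 f(2) by simp_all
  have c: "c = i \<or> c = a" by (simp add: c_def)
  have "tri_events i a b x c"
    unfolding tri_events_def by (intro conjI i a(1) b(1) ab obs wa c va vb)
  moreover have "s \<longleftrightarrow> ev_rep a = ev_rep b" using r sa(2) sb(2) a1(2) b1(2) by simp
  ultimately show thesis using that unfolding c_def by blast
qed

lemma ctxt_single_wordI:
  assumes "is_execution Init \<xi>" "[R] \<in> C" "(e, r) \<in> rel_sem \<xi> R" "writes e x" "x_wrinv \<xi> x r \<noteq> {}"
  shows "e \<in> ctxt \<xi> C x r"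
proof -
  note cl = is_execution_rel_closed[OF assms(1)]
  have "vis \<xi> [R] x e r" unfolding vis_iff_wsem[OF cl] wsem_single[OF cl] using assms(3-5) by blast
  then show ?thesis using assms(2) unfolding ctxt_def vis_def by blast
qed

lemma tri_eventsD:
  assumes "tri_events i a b x c"
  shows "i \<in> Init" "a \<notin> Init" "b \<notin> Init" "a \<noteq> b" "i \<noteq> a" "i \<noteq> b" "writes a x" "writes i x"
    "os_rspec Op b" "c = i \<or> c = a"
proof -
  show "i \<in> Init" "a \<noteq> b" "writes a x" "os_rspec Op b" "c = i \<or> c = a"
    using assms unfolding tri_events_def by - (elim conjE, assumption)+
  have "a \<in> calls Init Op" "b \<in> calls Init Op"
    using assms unfolding tri_events_def by - (elim conjE, assumption)+
  then show "a \<notin> Init" "b \<notin> Init" using calls_not_init by blast+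
  then show "i \<noteq> a" "i \<noteq> b" using \<open>i \<in> Init\<close> by blast+
  show "writes i x" using init_writes \<open>i \<in> Init\<close> .
qed

lemma tri_rel_b:
  assumes T: "tri_events i a b x c" and s: "s \<longleftrightarrow> ev_rep a = ev_rep b"
  shows "(a, b) \<in> x_so (tri i a b x s c) \<longleftrightarrow> s" "(a, b) \<in> x_wr (tri i a b x s c) \<longleftrightarrow> c = a"
    "x_wrinv (tri i a b x s c) x b = {c}" "(c, b) \<in> x_wr (tri i a b x s c)"
    "os_rspec Op a \<Longrightarrow> x_wrinv (tri i a b x s c) x a = {i}"
    "os_rspec Op a \<Longrightarrow> (i, a) \<in> x_wr (tri i a b x s c)"
    "(i, a) \<in> x_so (tri i a b x s c)" "(i, b) \<in> x_so (tri i a b x s c)"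
    "{(i, a), (i, b), (a, b)} \<subseteq> x_rb (tri i a b x s c)"
  unfolding tri_sel[OF tri_eventsD(4)[OF T], of i x s c] using tri_eventsD[OF T] by auto

lemma tri_ctxt_word:
  assumes T: "tri_events i a b x c" and s: "s \<longleftrightarrow> ev_rep a = ev_rep b"
    and C: "\<And>u. u \<in> C \<Longrightarrow> simple u" and a: "a \<in> ctxt (tri i a b x s c) C x b"
  obtains R where "[R] \<in> C" "(a, b) \<in> rel_sem (tri i a b x s c) R" "R \<in> {RSo, RWr, RRb, RAr}"
proof -
  note D = tri_eventsD[OF T]
  note ex = tri_execution[OF D(1-4) s D(10), of x]
  obtain u where u: "u \<in> C" "vis (tri i a b x s c) u x a b" using a by (auto simp: ctxt_def)
  then have w: "(a, b) \<in> wsem (tri i a b x s c) u"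
    using vis_iff_wsem[OF is_execution_rel_closed[OF ex]] by blast
  obtain R where R: "u = [R]" "(a, b) \<in> rel_sem (tri i a b x s c) R"
    using tri_word[OF ex D(4-6) C[OF u(1)] w] by blast
  then show thesis using that u(1) C[OF u(1)] by (simp add: simple_def)
qed

text \<open>The \<open>so\<close> formula of the model must make \<open>a\<close> visible to
  \<open>b\<close> when they are related by \<open>so\<close> but not by \<open>wr\<close>, and by
  \<open>tri_word\<close> only a single letter can do so. The \<open>wr\<close> formula is tested
  with the roles of the two relations exchanged.\<close>

lemma model_single_words:
  assumes i: "i \<in> Init" "i \<in> os_events Op"
  defines "W \<equiv> (\<Union>v\<in>CMod. flang v)"
  shows "[RSo] \<in> W \<or> [RRb] \<in> W \<or> [RAr] \<in> W" "[RWr] \<in> W \<or> [RRb] \<in> W \<or> [RAr] \<in> W"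
proof -
  have si: "simple u" if "u \<in> W" for u using that flang_simple by (auto simp: W_def)
  obtain a b x where T: "tri_events i a b x (if True then i else a)" and s: "True \<longleftrightarrow> ev_rep a = ev_rep b"
    by (rule ex_tri[OF i])
  let ?\<xi> = "tri i a b x True (if True then i else a)"
  note D = tri_eventsD[OF T] and rel = tri_rel_b[OF T s]
  note ex = tri_execution[OF D(1-4) s D(10), of x]
  have so: "(a, b) \<in> x_so ?\<xi>" and rd: "x_wrinv ?\<xi> x b \<noteq> {}" using rel(1,3) by simp_all
  obtain v where "v \<in> CMod" "vis ?\<xi> v x a b"
  proof (rule so_formula)
    fix v
    assume v: "v \<in> CMod" "\<And>\<xi> x e r. is_execution Init \<xi> \<Longrightarrow> (e, r) \<in> x_so \<xi> \<Longrightarrow> writes e x \<Longrightarrow>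
      x_wrinv \<xi> x r \<noteq> {} \<Longrightarrow> vis \<xi> v x e r"
    show thesis using that[of v] v(1) v(2)[OF ex so D(7) rd] by blast
  qed
  then have "a \<in> ctxt ?\<xi> CMod x b" by (auto simp: ctxt_def vis_def)
  then have aW: "a \<in> ctxt ?\<xi> W x b" unfolding ctxt_flang[OF is_execution_rel_closed[OF ex], of CMod] W_def .
  obtain R where "[R] \<in> W" "(a, b) \<in> rel_sem ?\<xi> R" "R \<in> {RSo, RWr, RRb, RAr}"
    by (rule tri_ctxt_word[OF T s si aW])
  then show "[RSo] \<in> W \<or> [RRb] \<in> W \<or> [RAr] \<in> W" using rel(2) D(5) by auto
next
  have si: "simple u" if "u \<in> W" for u using that flang_simple by (auto simp: W_def)
  obtain a b x where T: "tri_events i a b x (if False then i else a)" and s: "False \<longleftrightarrow> ev_rep a = ev_rep b"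
    by (rule ex_tri[OF i])
  let ?\<xi> = "tri i a b x False (if False then i else a)"
  note D = tri_eventsD[OF T] and rel = tri_rel_b[OF T s]
  note ex = tri_execution[OF D(1-4) s D(10), of x]
  have b: "b \<in> x_events ?\<xi>" unfolding tri_sel[OF D(4)] by simp
  have a_rd: "a \<in> x_wrinv ?\<xi> x b" using rel(3) by simp
  obtain v where "v \<in> CMod" "vis ?\<xi> v x a b"
  proof (rule wr_formula)
    fix v
    assume v: "v \<in> CMod" "\<And>\<xi> x e r. is_execution Init \<xi> \<Longrightarrow> r \<in> x_events \<xi> \<Longrightarrow>
      e \<in> x_wrinv \<xi> x r \<Longrightarrow> writes e x \<Longrightarrow> vis \<xi> v x e r"
    show thesis using that[of v] v(1) v(2)[OF ex b a_rd D(7)] by blast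
  qed
  then have "a \<in> ctxt ?\<xi> CMod x b" by (auto simp: ctxt_def vis_def)
  then have aW: "a \<in> ctxt ?\<xi> W x b" unfolding ctxt_flang[OF is_execution_rel_closed[OF ex], of CMod] W_def .
  obtain R where "[R] \<in> W" "(a, b) \<in> rel_sem ?\<xi> R" "R \<in> {RSo, RWr, RRb, RAr}"
    by (rule tri_ctxt_word[OF T s si aW])
  then show "[RWr] \<in> W \<or> [RRb] \<in> W \<or> [RAr] \<in> W" using rel(1) by auto
qed

text \<open>Equivalence transfers nothing but validity, so the letters are recovered from it. If
  \<open>b\<close> reads \<open>a\<close> from another replica, the execution is valid for
  \<open>F\<close>, hence for \<open>N\<close>, and \<open>N\<close> must make \<open>a\<close>
  visible without \<open>so\<close>. If \<open>b\<close> ignores an earlier \<open>a\<close> of its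
  own replica, the execution is invalid for \<open>N\<close> too; since \<open>N\<close> already
  covers \<open>wr\<close>, the initial event is visible as it should be, and the only possible
  defect is that \<open>a\<close> is visible without \<open>wr\<close>.\<close>

lemma equivalent_single_words:
  assumes i: "i \<in> Init" "i \<in> os_events Op" and eq: "equivalent_models Init obj Op F N"
    and F: "\<And>u. u \<in> F \<Longrightarrow> simple u \<and> u \<noteq> []" and N: "\<And>u. u \<in> N \<Longrightarrow> simple u \<and> u \<noteq> [] \<and> RAr \<notin> set u"
    and so: "[RSo] \<in> F \<or> [RRb] \<in> F" and wr: "[RWr] \<in> F \<or> [RRb] \<in> F"
  shows "[RSo] \<in> N \<or> [RRb] \<in> N" "[RWr] \<in> N \<or> [RRb] \<in> N"
proof -
  have N': "\<And>u. u \<in> N \<Longrightarrow> simple u \<and> u \<noteq> []" "\<And>u. u \<in> N \<Longrightarrow> simple u" using N by blast+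
  show wrN: "[RWr] \<in> N \<or> [RRb] \<in> N"
  proof -
    obtain a b x where T': "tri_events i a b x (if False then i else a)" and s: "False \<longleftrightarrow> ev_rep a = ev_rep b"
      by (rule ex_tri[OF i])
    have T: "tri_events i a b x a" using T' by simp
    let ?\<xi> = "tri i a b x False a"
    note D = tri_eventsD[OF T] and rel = tri_rel_b[OF T s]
    note ex = tri_execution[OF D(1-4) s D(10), of x]
    have "i \<in> ctxt ?\<xi> F x a" if ra: "os_rspec Op a"
      using so
    proof
      assume "[RSo] \<in> F"
      from ctxt_single_wordI[OF ex this] show ?thesis using rel(5)[OF ra] rel(7) D(8) by simp
    next
      assume "[RRb] \<in> F"
      from ctxt_single_wordI[OF ex this] show ?thesis using rel(5)[OF ra] rel(9) D(8) by simp
    qed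
    moreover have "a \<in> ctxt ?\<xi> F x b"
      using wr
    proof
      assume "[RWr] \<in> F"
      from ctxt_single_wordI[OF ex this] show ?thesis using rel(3,4) D(7) by simp
    next
      assume "[RRb] \<in> F"
      from ctxt_single_wordI[OF ex this] show ?thesis using rel(3,9) D(7) by simp
    qed
    ultimately have "valid Init obj F Op ?\<xi>" using tri_valid_iff[OF T s F] D(5) by blast
    then have "valid Init obj N Op ?\<xi>" using eq ex unfolding equivalent_models_def by blast
    then have aN: "a \<in> ctxt ?\<xi> N x b" using tri_valid_iff[OF T s N'(1)] by blast
    obtain R where R: "[R] \<in> N" "(a, b) \<in> rel_sem ?\<xi> R" "R \<in> {RSo, RWr, RRb, RAr}"
      by (rule tri_ctxt_word[OF T s N'(2) aN])
    then have "R \<noteq> RSo" "R \<noteq> RAr" using rel(1) N[OF R(1)] by auto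
    then show ?thesis using R by auto
  qed
  obtain a b x where T': "tri_events i a b x (if True then i else a)" and s: "True \<longleftrightarrow> ev_rep a = ev_rep b"
    by (rule ex_tri[OF i])
  have T: "tri_events i a b x i" using T' by simp
  let ?\<xi> = "tri i a b x True i"
  note D = tri_eventsD[OF T] and rel = tri_rel_b[OF T s]
  note ex = tri_execution[OF D(1-4) s D(10), of x]
  have "a \<in> ctxt ?\<xi> F x b"
    using so
  proof
    assume "[RSo] \<in> F"
    from ctxt_single_wordI[OF ex this] show ?thesis using rel(1,3) D(7) by simp
  next
    assume "[RRb] \<in> F"
    from ctxt_single_wordI[OF ex this] show ?thesis using rel(3,9) D(7) by simp
  qed
  then have "\<not> valid Init obj F Op ?\<xi>" using tri_valid_iff[OF T s F] by blast
  then have inv: "\<not> valid Init obj N Op ?\<xi>" using eq ex unfolding equivalent_models_def by blast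
  have "i \<in> ctxt ?\<xi> N x a" if ra: "os_rspec Op a"
    using wrN
  proof
    assume "[RWr] \<in> N"
    from ctxt_single_wordI[OF ex this] show ?thesis using rel(5,6)[OF ra] D(8) by simp
  next
    assume "[RRb] \<in> N"
    from ctxt_single_wordI[OF ex this] show ?thesis using rel(5)[OF ra] rel(9) D(8) by simp
  qed
  moreover have "i \<in> ctxt ?\<xi> N x b"
    using wrN
  proof
    assume "[RWr] \<in> N"
    from ctxt_single_wordI[OF ex this] show ?thesis using rel(3,4) D(8) by simp
  next
    assume "[RRb] \<in> N"
    from ctxt_single_wordI[OF ex this] show ?thesis using rel(3,9) D(8) by simp
  qed
  ultimately have aN: "a \<in> ctxt ?\<xi> N x b" using tri_valid_iff[OF T s N'(1)] inv by blast
  obtain R where R: "[R] \<in> N" "(a, b) \<in> rel_sem ?\<xi> R" "R \<in> {RSo, RWr, RRb, RAr}"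
    by (rule tri_ctxt_word[OF T s N'(2) aN])
  then have "R \<noteq> RWr" "R \<noteq> RAr" using rel(2) D(5) N[OF R(1)] by auto
  then show "[RSo] \<in> N \<or> [RRb] \<in> N" using R by auto
qed

text \<open>The letter \<open>rb\<close> may stand in for either of the others, as it contains both
  \<open>so\<close> and \<open>wr\<close>.\<close>

lemma basic_modelI:
  assumes ne: "\<And>u. u \<in> N \<Longrightarrow> u \<noteq> []"
    and so: "[RSo] \<in> N \<or> [RRb] \<in> N" and wr: "[RWr] \<in> N \<or> [RRb] \<in> N"
  shows "is_basic_model Init N"
  unfolding is_basic_model_def
proof (intro conjI)
  have v: "vis \<xi> [R] x e r" if "is_execution Init \<xi>" "(e, r) \<in> rel_sem \<xi> R" "writes e x" "x_wrinv \<xi> x r \<noteq> {}"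
    for \<xi> :: "('id, 'rep, 'op, 'obj, 'val, 'meta) execution" and R e r x
  proof -
    note cl = is_execution_rel_closed[OF that(1)]
    show ?thesis unfolding vis_iff_wsem[OF cl] wsem_single[OF cl] using that by blast
  qed
  show "N \<noteq> {}" using so by blast
  show "\<forall>v\<in>N. v \<noteq> []" using ne by blast
  show "\<exists>v\<in>N. \<forall>\<xi>. is_execution Init \<xi> \<longrightarrow>
      (\<forall>x e r. (e, r) \<in> x_so \<xi> \<and> writes e x \<and> x_wrinv \<xi> x r \<noteq> {} \<longrightarrow> vis \<xi> v x e r)"
  proof -
    have R: "?thesis" if "[R] \<in> N" "\<And>\<xi>. is_execution Init \<xi> \<Longrightarrow> x_so \<xi> \<subseteq> rel_sem \<xi> R" for R
    proof (intro bexI[OF _ that(1)] allI impI)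
      fix \<xi> x e r
      assume "is_execution Init \<xi>" "(e, r) \<in> x_so \<xi> \<and> writes e x \<and> x_wrinv \<xi> x r \<noteq> {}"
      then show "vis \<xi> [R] x e r" using v that(2) by blast
    qed
    show ?thesis using so R[of RSo] R[of RRb] execution_ar(5) by auto
  qed
  show "\<exists>v\<in>N. \<forall>\<xi>. is_execution Init \<xi> \<longrightarrow>
      (\<forall>x e. \<forall>r\<in>x_events \<xi>. e \<in> x_wrinv \<xi> x r \<and> writes e x \<longrightarrow> vis \<xi> v x e r)"
  proof -
    have R: "?thesis" if "[R] \<in> N" "\<And>\<xi>. is_execution Init \<xi> \<Longrightarrow> x_wr \<xi> \<subseteq> rel_sem \<xi> R" for R
    proof (intro bexI[OF _ that(1)] allI impI ballI)
      fix \<xi> x e r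
      assume ex: "is_execution Init \<xi>" and r: "r \<in> x_events \<xi>" and e: "e \<in> x_wrinv \<xi> x r \<and> writes e x"
      have "(e, r) \<in> x_wr \<xi>" using r e by (auto simp: h_wr_def)
      then show "vis \<xi> [R] x e r" using v[OF ex] that(2)[OF ex] e by blast
    qed
    show ?thesis using wr R[of RWr] R[of RRb] execution_ar(6) by auto
  qed
qed

lemma ctxt_words_equivalent:
  "equivalent_models Init obj Op C (\<Union>v\<in>C. flang v)"
  unfolding equivalent_models_def
proof (intro allI impI)
  fix \<xi> assume "is_execution Init \<xi>"
  from ctxt_flang[OF is_execution_rel_closed[OF this], of C]
  show "valid Init obj C Op \<xi> = valid Init obj (\<Union>v\<in>C. flang v) Op \<xi>" by (rule valid_cong_ctxt)
qed

end

context available_storage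
begin

lemma arbitration_free: "arbitration_free Init obj Op CMod"
proof -
  define W where "W = (\<Union>v\<in>CMod. flang v)"
  define F where "F = {u \<in> W. u \<noteq> [] \<and> RAr \<notin> set u}"
  obtain i t where "anchored i t" by (rule ex_anchored)
  then have i: "i \<in> Init" "i \<in> os_events Op" by (simp_all add: anchored_def)
  have si: "simple u" if "u \<in> W" for u using that flang_simple by (auto simp: W_def)
  \<comment> \<open>The single letter \<open>ar\<close> is store buffering with \<alpha> and \<beta>
    empty. Without it, the letters that cover \<open>so\<close> and \<open>wr\<close> in
    \<open>W\<close> are free of \<open>ar\<close> and remain in \<open>F\<close>.\<close>
  have "[RAr] \<notin> W" using no_realizable_ar_word[of "[]" "[]"] by (auto simp: W_def realizable_def)
  then have soF: "[RSo] \<in> F \<or> [RRb] \<in> F" and wrF: "[RWr] \<in> F \<or> [RRb] \<in> F"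
    using model_single_words[OF i] by (auto simp: F_def W_def)
  have FW: "F \<subseteq> W" by (auto simp: F_def)
  have irr: "(\<exists>u'. u' \<noteq> [] \<and> u = u' @ [RWr]) \<or> \<not> realizable u \<or> (u = [] \<and> \<not> has_rw)" if "u \<in> W - F" for u
  proof (rule word_classification)
    show "u \<in> (\<Union>v\<in>CMod. flang v)" using that by (simp add: W_def)
    show "u = [] \<or> RAr \<in> set u" using that by (simp add: F_def)
  qed
  have WF: "equivalent_models Init obj Op W F"
    by (rule equivalent_if_irrelevant[OF FW si irr wrF])
  have F: "simple u \<and> u \<noteq> []" if "u \<in> F" for u using that si by (simp add: F_def)
  then have sF: "simple u" if "u \<in> F" for u using that by blast
  obtain N where N: "N \<subseteq> F" "equivalent_models Init obj Op F N"
    "\<And>v. v \<in> N \<Longrightarrow> \<not> vacuous Init obj Op N v"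
  proof (rule equivalent_models_minimal[where F = F and Init = Init and obj = obj and Op = Op])
    fix N assume "N \<subseteq> F" "equivalent_models Init obj Op F N"
      "\<And>v. v \<in> N \<Longrightarrow> \<not> vacuous Init obj Op N v"
    then show thesis by (rule that)
  qed (rule sF)
  have N': "simple u \<and> u \<noteq> [] \<and> RAr \<notin> set u" if "u \<in> N" for u
    using subsetD[OF N(1) that] si by (simp add: F_def)
  have eq: "equivalent_models Init obj Op CMod N"
    unfolding equivalent_models_def
  proof (intro allI impI)
    fix \<xi> assume ex: "is_execution Init \<xi>"
    have "valid Init obj CMod Op \<xi> = valid Init obj W Op \<xi>"
      using ctxt_words_equivalent[of CMod] ex unfolding equivalent_models_def W_def by simp
    also have "\<dots> = valid Init obj F Op \<xi>" using WF ex unfolding equivalent_models_def by simp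
    also have "\<dots> = valid Init obj N Op \<xi>" using N(2) ex unfolding equivalent_models_def by simp
    finally show "valid Init obj CMod Op \<xi> = valid Init obj N Op \<xi>" .
  qed
  have "is_basic_model Init N"
  proof (rule basic_modelI)
    show "u \<noteq> []" if "u \<in> N" for u using N'[OF that] by simp
  qed (rule equivalent_single_words[OF i N(2) F N' soF wrF], assumption+)+
  then have "is_normal_form_of Init obj Op N CMod"
    unfolding is_normal_form_of_def in_normal_form_def using N(3) N' eq by simp
  moreover have "arbitration_free_formula v" if "v \<in> N" for v
    using N'[OF that] arbitration_free_simple by simp
  ultimately show ?thesis unfolding arbitration_free_def by blast
qed

end


section \<open>An implementation without communication\<close>

text \<open>Serves as arbitration order: the order in which the calls occur in the trace, with the
  initial event in front.\<close>

definition list_ord :: "'a list \<Rightarrow> 'a rel" where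
  "list_ord D = {(D ! j, D ! k) |j k. j < k \<and> k < length D}"

lemma list_ord_snoc: "list_ord (D @ [e]) = list_ord D \<union> set D \<times> {e}"
proof (intro equalityI subsetI)
  fix p assume "p \<in> list_ord (D @ [e])"
  then obtain j k where jk: "p = ((D @ [e]) ! j, (D @ [e]) ! k)" "j < k" "k < Suc (length D)"
    by (auto simp: list_ord_def)
  show "p \<in> list_ord D \<union> set D \<times> {e}"
  proof (cases "k < length D")
    case True
    then have "p = (D ! j, D ! k)" using jk by (simp add: nth_append)
    then show ?thesis using True jk(2) by (auto simp: list_ord_def)
  next
    case False
    then have "p = (D ! j, e)" "j < length D" using jk by (simp_all add: nth_append)
    then show ?thesis by simp
  qed
next
  fix p assume "p \<in> list_ord D \<union> set D \<times> {e}"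
  then show "p \<in> list_ord (D @ [e])"
  proof
    assume "p \<in> list_ord D"
    then obtain j k where jk: "p = (D ! j, D ! k)" "j < k" "k < length D" by (auto simp: list_ord_def)
    then have "p = ((D @ [e]) ! j, (D @ [e]) ! k)" by (simp add: nth_append)
    then show ?thesis using jk unfolding list_ord_def by fastforce
  next
    assume "p \<in> set D \<times> {e}"
    then obtain j where "p = (D ! j, e)" "j < length D" by (auto simp: in_set_conv_nth)
    then have "p = ((D @ [e]) ! j, (D @ [e]) ! length D)" by (simp add: nth_append)
    then show ?thesis using \<open>j < length D\<close> unfolding list_ord_def by fastforce
  qed
qed

lemma list_ord_subset: "list_ord D \<subseteq> set D \<times> set D"
  by (auto simp: list_ord_def)

lemma list_ord_linear:
  assumes "distinct D"
  shows "strict_linear_order_on (set D) (list_ord D)"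
  using assms
proof (induction D rule: rev_induct)
  case Nil
  show ?case by (simp add: list_ord_def strict_linear_order_on_def)
next
  case (snoc e D)
  then have IH: "trans (list_ord D)" "irrefl (list_ord D)" "total_on (set D) (list_ord D)" and e: "e \<notin> set D"
    by (auto simp: strict_linear_order_on_def)
  note sub = list_ord_subset[of D]
  have "trans (list_ord (D @ [e]))"
  proof (rule transI)
    fix b c d assume "(b, c) \<in> list_ord (D @ [e])" "(c, d) \<in> list_ord (D @ [e])"
    then have bc: "(b, c) \<in> list_ord D" and cd: "(c, d) \<in> list_ord D \<or> d = e"
      using e sub unfolding list_ord_snoc by blast+
    show "(b, d) \<in> list_ord (D @ [e])"
      using cd transD[OF IH(1) bc] bc sub unfolding list_ord_snoc by blast
  qed
  moreover have "irrefl (list_ord (D @ [e]))"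
    unfolding list_ord_snoc irrefl_def using e IH(2)[unfolded irrefl_def] by blast
  moreover have "total_on (set (D @ [e])) (list_ord (D @ [e]))"
    unfolding list_ord_snoc total_on_def using IH(3)[unfolded total_on_def] by auto
  ultimately show ?case by (simp add: strict_linear_order_on_def)
qed

lemma last_filter_max:
  assumes "w \<in> set (i # filter P D)"
  shows "w = last (i # filter P D) \<or> (w, last (i # filter P D)) \<in> list_ord (i # D)"
  using assms
proof (induction D rule: rev_induct)
  case (snoc d D)
  have *: "list_ord (i # D @ [d]) = list_ord (i # D) \<union> set (i # D) \<times> {d}"
    using list_ord_snoc[of "i # D" d] by simp
  show ?case
  proof (cases "P d")
    case True
    then have "last (i # filter P (D @ [d])) = d" by simp
    moreover have "w = d \<or> (w, d) \<in> list_ord (i # D @ [d])"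
    proof -
      have "set (i # filter P (D @ [d])) \<subseteq> insert d (set (i # D))" by auto
      then show ?thesis using snoc.prems unfolding * by blast
    qed
    ultimately show ?thesis by simp
  next
    case False
    then have fe: "filter P (D @ [d]) = filter P D" by simp
    show ?thesis using snoc.IH snoc.prems unfolding fe * by blast
  qed
qed simp

lemma wsem_local:
  assumes ex: "is_execution Init \<xi>" and rb: "x_rb \<xi> = x_so \<xi>"
    and v: "simple v" "v \<noteq> []" "RAr \<notin> set v"
  shows "wsem \<xi> v \<subseteq> x_so \<xi>"
proof -
  note ar = execution_ar[OF ex]
  have tr: "trans (x_so \<xi>)" using ex unfolding is_execution_def is_history_def by blast
  have R: "rel_sem \<xi> R \<subseteq> x_so \<xi>" if "R \<in> set v" for R
  proof -
    have "R \<in> {RSo, RWr, RRb}" using that v(1,3) by (auto simp: simple_def)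
    then show ?thesis using ar(6) rb by auto
  qed
  have "wsem \<xi> u \<subseteq> (x_so \<xi>)\<^sup>=" if "set u \<subseteq> set v" for u
    using that
  proof (induction u)
    case (Cons S u)
    then have "rel_sem \<xi> S \<subseteq> x_so \<xi>" "wsem \<xi> u \<subseteq> (x_so \<xi>)\<^sup>=" using R by auto
    then show ?case using transD[OF tr] by fastforce
  qed auto
  moreover obtain S u where Su: "v = S # u" using v(2) by (cases v) auto
  ultimately have "rel_sem \<xi> S \<subseteq> x_so \<xi>" "wsem \<xi> u \<subseteq> (x_so \<xi>)\<^sup>=" using R by auto
  then show ?thesis using Su transD[OF tr] by fastforce
qed

section \<open>The local implementation and the executions it induces\<close>

context basic_storage
begin

text \<open>The initial event in front makes \<open>last\<close> meaningful and is the answer when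
  the replica has not yet written \<open>x\<close>.\<close>

definition last_write where
  "last_write i t r x = last (i # filter (\<lambda>e. ev_rep e = r \<and> writes e x) (do_evs t))"

text \<open>The state is the trace so far. As every list counts as a state, the first conjunct
  excludes lists with events that are not calls; otherwise a dependency might fall outside the
  action set and \<open>local_impl\<close> would not be an LTS.\<close>

definition local_step ::
  "('id, 'rep, 'op, 'obj, 'val, 'meta) event \<Rightarrow>
   ('id, 'rep, 'op, 'obj, 'val, 'meta, 'l, 'msg) iaction list \<Rightarrow>
   ('id, 'rep, 'op, 'obj, 'val, 'meta) event \<Rightarrow>
   ('obj \<Rightarrow> ('id, 'rep, 'op, 'obj, 'val, 'meta) event set option) \<Rightarrow> bool" where
  "local_step i t e m \<longleftrightarrow> tr_events t \<subseteq> calls Init Op \<and> e \<in> calls Init Op \<and>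
     ev_id e \<notin> ev_id ` tr_events t \<and>
     m = (\<lambda>x. if os_rspec Op e \<and> x \<in> obj e then Some {last_write i t (ev_rep e) x} else None) \<and>
     ev_wval e = (\<lambda>x. if x \<in> obj e
       then Option.bind (ev_wval (last_write i t (ev_rep e) x) x) (outcome Op e) else None)"

definition local_impl ::
  "('id, 'rep, 'op, 'obj, 'val, 'meta) event \<Rightarrow>
   ('id, 'rep, 'op, 'obj, 'val, 'meta, 'l, 'msg) implementation" where
  "local_impl i =
     \<lparr>states = UNIV, actions = {Do e m |e m. e \<in> calls Init Op \<and> (\<forall>W \<in> ran m. W \<subseteq> os_events Op)},
      start = [],
      trans = (\<lambda>t a. case a of Do e m \<Rightarrow> if local_step i t e m then Some (t @ [a]) else None
                              | _ \<Rightarrow> None)\<rparr>"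

lemma local_impl_sel [simp]:
  "states (local_impl i) = UNIV" "start (local_impl i) = []"
  "actions (local_impl i) = {Do e m |e m. e \<in> calls Init Op \<and> (\<forall>W \<in> ran m. W \<subseteq> os_events Op)}"
  by (simp_all add: local_impl_def)

lemma local_impl_trans [simp]:
  "lts.trans (local_impl i) t (Do e m) = (if local_step i t e m then Some (t @ [Do e m]) else None)"
  "lts.trans (local_impl i) t (Send r l n S) = None"
  "lts.trans (local_impl i) t (Receive r l n S) = None"
  "lts.trans (local_impl i) t (Internal r l) = None"
  by (simp_all add: local_impl_def)

lemma local_impl_trans_Some:
  "lts.trans (local_impl i) t a = Some t' \<longleftrightarrow>
     (\<exists>e m. a = Do e m \<and> local_step i t e m \<and> t' = t @ [a])"
  by (cases a) auto

lemma last_write_cases: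
  "last_write i t r x = i \<or> last_write i t r x \<in> tr_events t \<and> ev_rep (last_write i t r x) = r"
proof -
  have "last_write i t r x \<in> set (i # filter (\<lambda>e. ev_rep e = r \<and> writes e x) (do_evs t))"
    unfolding last_write_def by (rule last_in_set) simp
  then show ?thesis by (auto simp: set_do_evs)
qed

lemma writes_last_write: "i \<in> Init \<Longrightarrow> writes (last_write i t r x) x"
proof -
  assume i: "i \<in> Init"
  have "last_write i t r x \<in> set (i # filter (\<lambda>e. ev_rep e = r \<and> writes e x) (do_evs t))"
    unfolding last_write_def by (rule last_in_set) simp
  then show ?thesis using init_writes[OF i] by auto
qed

lemma local_step_action:
  assumes "i \<in> os_events Op" "local_step i t e m"
  shows "Do e m \<in> actions (local_impl i)"
proof -
  have "last_write i t (ev_rep e) x \<in> os_events Op" for x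
  proof -
    have "tr_events t \<subseteq> calls Init Op" using assms(2) by (simp add: local_step_def)
    then show ?thesis using last_write_cases[of i t "ev_rep e" x] assms(1) calls_not_init by auto
  qed
  then show ?thesis using assms(2) by (auto simp: local_step_def ran_def split: if_splits)
qed

lemma local_impl_lts:
  assumes "i \<in> os_events Op"
  shows "is_lts (local_impl i)"
  unfolding is_lts_def
proof (intro conjI allI impI)
  fix t a t' assume "lts.trans (local_impl i) t a = Some t'"
  then obtain e m where "a = Do e m" "local_step i t e m" unfolding local_impl_trans_Some by blast
  then show "a \<in> actions (local_impl i)" using local_step_action[OF assms] by simp
qed simp_all

lemma local_impl_run: "run_from (local_impl i) s t = Some s' \<Longrightarrow> s' = s @ t"
proof (induction t arbitrary: s)
  case (Cons a t)
  then obtain s1 where s1: "lts.trans (local_impl i) s a = Some s1" "run_from (local_impl i) s1 t = Some s'"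
    by (auto split: option.splits)
  have "s1 = s @ [a]" using s1(1) unfolding local_impl_trans_Some by blast
  then show ?case using Cons.IH[OF s1(2)] by simp
qed simp

lemma local_impl_trace_snoc:
  "is_trace (local_impl i) (t @ [a]) \<longleftrightarrow>
     is_trace (local_impl i) t \<and> (\<exists>e m. a = Do e m \<and> local_step i t e m)"
proof (cases "run_from (local_impl i) [] t")
  case None
  then show ?thesis by (simp add: is_trace_def run_from_append)
next
  case (Some s)
  then have "s = t" using local_impl_run[of i "[]" t s] by simp
  then show ?thesis using Some by (cases a) (simp_all add: is_trace_def run_from_append)
qed

text \<open>Validity with the context replaced by the writing \<open>so\<close>-predecessors, which
  keeps the model out of the induction over the trace. The value \<open>undefined\<close> is
  arbitrary: a call that accesses \<open>x\<close> without reading has a constant outcome.\<close>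

definition locally_read where
  "locally_read i t \<longleftrightarrow> (\<forall>e \<in> tr_events t. \<forall>x.
     if os_rspec Op e \<and> x \<in> obj e
     then \<exists>w. tr_wrinv t x e = {w} \<and>
       is_max_in (list_ord (i # do_evs t)) {a. (a, e) \<in> tr_so i t \<and> writes a x} w \<and>
       ev_wval e x = Option.bind (ev_wval w x) (outcome Op e)
     else tr_wrinv t x e = {} \<and> ev_wval e x = (if x \<in> obj e then outcome Op e undefined else None))"

lemma tr_so_subset:
  "tr_so i t \<subseteq> insert i (tr_events t) \<times> tr_events t"
proof (rule subrelI)
  fix a b assume "(a, b) \<in> tr_so i t"
  then consider "a = i" "b \<in> tr_events t" |
    j k m m' where "j < k" "k < length t" "t ! j = Do a m" "t ! k = Do b m'"
    unfolding tr_so_def by blast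
  then show "(a, b) \<in> insert i (tr_events t) \<times> tr_events t"
  proof cases
    case 2
    then have "Do a m \<in> set t" "Do b m' \<in> set t"
      using nth_mem[of j t] nth_mem[of k t] by simp_all
    then show ?thesis by (auto simp: tr_events_def)
  qed simp
qed

text \<open>A step appends one event \<open>e\<close>, whose \<open>so\<close>-predecessors are
  \<open>i\<close> and the earlier events of its replica and which comes last in
  \<open>list_ord\<close>. What is recorded about earlier events does not change, so essentially
  only the pairs involving \<open>e\<close> need checking.\<close>

lemma local_impl_invariant:
  assumes i: "i \<in> Init" "i \<in> os_events Op" and t: "is_trace (local_impl i) t"
  shows "no_recv t \<and> (\<forall>r l n S. Send r l n S \<notin> set t) \<and> distinct (map ia_ident t) \<and>
    distinct (i # do_evs t) \<and> tr_events t \<subseteq> calls Init Op \<and>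
    trans (tr_so i t) \<and> tr_so i t \<subseteq> list_ord (i # do_evs t) \<and>
    (\<forall>a \<in> tr_events t. \<forall>b \<in> tr_events t. a \<noteq> b \<longrightarrow>
      ((a, b) \<in> tr_so i t \<or> (b, a) \<in> tr_so i t \<longleftrightarrow> ev_rep a = ev_rep b)) \<and>
    {i} \<times> tr_events t \<subseteq> tr_so i t \<and> locally_read i t"
  using t
proof (induction t rule: rev_induct)
  case Nil
  show ?case by (simp add: no_recv_def locally_read_def tr_so_def)
next
  case (snoc a t)
  then obtain e m where a: "a = Do e m" and st: "local_step i t e m" and tt: "is_trace (local_impl i) t"
    by (auto simp: local_impl_trace_snoc)
  from snoc.IH[OF tt] have IH: "no_recv t" "\<forall>r l n S. Send r l n S \<notin> set t" "distinct (map ia_ident t)"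
    "distinct (i # do_evs t)" "tr_events t \<subseteq> calls Init Op"
    "trans (tr_so i t)" "tr_so i t \<subseteq> list_ord (i # do_evs t)"
    "\<forall>a \<in> tr_events t. \<forall>b \<in> tr_events t. a \<noteq> b \<longrightarrow>
      ((a, b) \<in> tr_so i t \<or> (b, a) \<in> tr_so i t \<longleftrightarrow> ev_rep a = ev_rep b)"
    "{i} \<times> tr_events t \<subseteq> tr_so i t" "locally_read i t"
    by - (elim conjE, assumption)+
  let ?t' = "t @ [a]"
  have e: "e \<in> calls Init Op" "ev_id e \<notin> ev_id ` tr_events t" and
    m: "m = (\<lambda>x. if os_rspec Op e \<and> x \<in> obj e then Some {last_write i t (ev_rep e) x} else None)" and
    val: "ev_wval e = (\<lambda>x. if x \<in> obj e
       then Option.bind (ev_wval (last_write i t (ev_rep e) x) x) (outcome Op e) else None)"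
    using st unfolding local_step_def by - (elim conjE, assumption)+
  have new: "e \<notin> tr_events t" "e \<noteq> i" using e calls_not_init i by blast+
  have evs: "tr_events ?t' = insert e (tr_events t)" "do_evs ?t' = do_evs t @ [e]" by (simp_all add: a)
  have "Do e m \<notin> set t" using new by (auto simp: tr_events_def)
  from tr_so_append_call[of "[]" e m t i m] this
  have so: "tr_so i ?t' = tr_so i t \<union> insert i {b \<in> tr_events t. ev_rep b = ev_rep e} \<times> {e}"
    by (simp add: a)
  have ord: "list_ord (i # do_evs ?t') = list_ord (i # do_evs t) \<union> insert i (tr_events t) \<times> {e}"
    unfolding evs(2) using list_ord_snoc[of "i # do_evs t" e] by (simp add: set_do_evs)
  have range: "b \<in> insert i (tr_events t)" "c \<in> tr_events t" if "(b, c) \<in> tr_so i t" for b c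
    using that tr_so_subset[of i t] by blast+
  have iev: "i \<notin> tr_events t" using IH(5) i calls_not_init by blast
  have rep: "b = i \<or> ev_rep b = ev_rep c" if "(b, c) \<in> tr_so i t" for b c
    using that by (auto simp: tr_so_def)
  have "no_recv ?t'" using IH(1) by (simp add: no_recv_def a)
  moreover have "\<forall>r l n S. Send r l n S \<notin> set ?t'" using IH(2) a by simp
  moreover have "distinct (map ia_ident ?t')"
  proof -
    have "Inl (ev_id e) \<notin> ia_ident ` set t"
    proof
      assume "Inl (ev_id e) \<in> ia_ident ` set t"
      then obtain c where c: "c \<in> set t" "ia_ident c = Inl (ev_id e)" by auto
      obtain e' m' where "c = Do e' m'" "ev_id e' = ev_id e"
        using c(2) by (cases c) auto
      then have "e' \<in> tr_events t" "ev_id e' = ev_id e" using c(1) by (auto simp: tr_events_def)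
      then show False using e(2) imageI[of e' "tr_events t" ev_id] by simp
    qed
    then show ?thesis using IH(3) by (simp add: a)
  qed
  moreover have "distinct (i # do_evs ?t')" unfolding evs(2) using IH(4) new by (auto simp: set_do_evs)
  moreover have "tr_events ?t' \<subseteq> calls Init Op" unfolding evs(1) using IH(5) e(1) by simp
  moreover have "trans (tr_so i ?t')"
  proof (rule transI)
    fix b c d assume bc: "(b, c) \<in> tr_so i ?t'" and cd: "(c, d) \<in> tr_so i ?t'"
    have "c \<noteq> e" using cd new range(1)[of c d] unfolding so by auto
    then have bc': "(b, c) \<in> tr_so i t" using bc unfolding so by blast
    show "(b, d) \<in> tr_so i ?t'"
    proof (cases "(c, d) \<in> tr_so i t")
      case True
      then show ?thesis using transD[OF IH(6) bc'] unfolding so by blast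
    next
      case False
      then have d: "d = e" "c \<in> insert i {b \<in> tr_events t. ev_rep b = ev_rep e}" using cd unfolding so by blast+
      then have "c \<in> tr_events t" "ev_rep c = ev_rep e" using range(2)[OF bc'] iev by auto
      then have "b \<in> insert i {b \<in> tr_events t. ev_rep b = ev_rep e}"
        using rep[OF bc'] range(1)[OF bc'] by auto
      then show ?thesis using d(1) unfolding so by blast
    qed
  qed
  moreover have "tr_so i ?t' \<subseteq> list_ord (i # do_evs ?t')" unfolding so ord using IH(7) by blast
  moreover have "\<forall>b \<in> tr_events ?t'. \<forall>c \<in> tr_events ?t'. b \<noteq> c \<longrightarrow>
      ((b, c) \<in> tr_so i ?t' \<or> (c, b) \<in> tr_so i ?t' \<longleftrightarrow> ev_rep b = ev_rep c)"
  proof (intro ballI impI)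
    fix b c assume bc: "b \<in> tr_events ?t'" "c \<in> tr_events ?t'" "b \<noteq> c"
    have no: "(d, e) \<notin> tr_so i t" "(e, d) \<notin> tr_so i t" for d
      using range[of d e] range[of e d] new by blast+
    consider "b \<in> tr_events t" "c \<in> tr_events t" | "b = e" "c \<in> tr_events t" | "c = e" "b \<in> tr_events t"
      using bc unfolding evs(1) by blast
    then show "((b, c) \<in> tr_so i ?t' \<or> (c, b) \<in> tr_so i ?t') = (ev_rep b = ev_rep c)"
    proof cases
      case 1
      then have "b \<noteq> e" "c \<noteq> e" using new by blast+
      then show ?thesis using IH(8)[rule_format, OF 1 bc(3)] unfolding so by blast
    next
      case 2
      have ci: "c \<noteq> i" "c \<noteq> e" using iev 2 new by blast+
      then have "(b, c) \<notin> tr_so i ?t'" "(c, b) \<in> tr_so i ?t' \<longleftrightarrow> ev_rep c = ev_rep e"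
        unfolding so using 2 no by auto
      then show ?thesis using 2 by auto
    next
      case 3
      have bi: "b \<noteq> i" "b \<noteq> e" using iev 3 new by blast+
      then have "(c, b) \<notin> tr_so i ?t'" "(b, c) \<in> tr_so i ?t' \<longleftrightarrow> ev_rep b = ev_rep e"
        unfolding so using 3 no by auto
      then show ?thesis using 3 by auto
    qed
  qed
  moreover have "{i} \<times> tr_events ?t' \<subseteq> tr_so i ?t'" unfolding so evs using IH(9) by blast
  moreover have "locally_read i ?t'"
    unfolding locally_read_def
  proof (intro ballI allI)
    fix f x assume "f \<in> tr_events ?t'"
    then consider "f \<in> tr_events t" | "f = e" unfolding evs(1) by blast
    then show "if os_rspec Op f \<and> x \<in> obj f
     then \<exists>w. tr_wrinv ?t' x f = {w} \<and>
       is_max_in (list_ord (i # do_evs ?t')) {a. (a, f) \<in> tr_so i ?t' \<and> writes a x} w \<and>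
       ev_wval f x = Option.bind (ev_wval w x) (outcome Op f)
     else tr_wrinv ?t' x f = {} \<and> ev_wval f x = (if x \<in> obj f then outcome Op f undefined else None)"
    proof cases
      case 1
      then have fe: "f \<noteq> e" using new by blast
      have wr: "tr_wrinv ?t' x f = tr_wrinv t x f" using fe by (auto simp: tr_wrinv_def a)
      have so': "(b, f) \<in> tr_so i ?t' \<longleftrightarrow> (b, f) \<in> tr_so i t" for b unfolding so using fe by blast
      have max: "is_max_in (list_ord (i # do_evs ?t')) A w" if "is_max_in (list_ord (i # do_evs t)) A w" for A w
        using that unfolding ord is_max_in_def by blast
      have "if os_rspec Op f \<and> x \<in> obj f
         then \<exists>w. tr_wrinv t x f = {w} \<and>
           is_max_in (list_ord (i # do_evs t)) {a. (a, f) \<in> tr_so i t \<and> writes a x} w \<and>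
           ev_wval f x = Option.bind (ev_wval w x) (outcome Op f)
         else tr_wrinv t x f = {} \<and> ev_wval f x = (if x \<in> obj f then outcome Op f undefined else None)"
        using IH(10) 1 unfolding locally_read_def by blast
      then show ?thesis unfolding wr so' using max by (auto split: if_splits)
    next
      case 2
      have wr: "tr_wrinv ?t' x f = (case m x of None \<Rightarrow> {} | Some W \<Rightarrow> W)"
      proof -
        have "Do f m' \<in> set ?t' \<longleftrightarrow> m' = m" for m' using 2 new by (auto simp: a tr_events_def)
        then show ?thesis unfolding tr_wrinv_def by (auto split: option.split)
      qed
      let ?w = "last_write i t (ev_rep e) x"
      have wx: "writes ?w x" using writes_last_write[OF i(1)] .
      then obtain v where v: "ev_wval ?w x = Some v" by (auto simp: writes_def)
      have no: "(d, e) \<notin> tr_so i t" for d using range(2)[of d e] new by blast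
      \<comment> \<open>The writing predecessors of \<open>e\<close> are the members of the list
        whose last element is \<open>last_write\<close>; by \<open>last_filter_max\<close> that
        element is their maximum.\<close>
      have set: "{a. (a, e) \<in> tr_so i ?t' \<and> writes a x} =
          set (i # filter (\<lambda>b. ev_rep b = ev_rep e \<and> writes b x) (do_evs t))"
        unfolding so using no init_writes[OF i(1)] by (auto simp: set_do_evs)
      have max: "is_max_in (list_ord (i # do_evs ?t')) {a. (a, e) \<in> tr_so i ?t' \<and> writes a x} ?w"
        unfolding set is_max_in_def
      proof (intro conjI ballI impI)
        show "?w \<in> set (i # filter (\<lambda>b. ev_rep b = ev_rep e \<and> writes b x) (do_evs t))"
          unfolding last_write_def by (rule last_in_set) simp
        fix w' assume "w' \<in> set (i # filter (\<lambda>b. ev_rep b = ev_rep e \<and> writes b x) (do_evs t))" "w' \<noteq> ?w"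
        from last_filter_max[OF this(1)] this(2) show "(w', ?w) \<in> list_ord (i # do_evs ?t')"
          unfolding last_write_def ord by blast
      qed
      show ?thesis
      proof (cases "os_rspec Op e \<and> x \<in> obj e")
        case True
        have "tr_wrinv ?t' x e = {?w}" using wr 2 m True by simp
        moreover have "ev_wval e x = Option.bind (ev_wval ?w x) (outcome Op e)" using val True by simp
        ultimately show ?thesis using True max 2 by auto
      next
        case False
        have "tr_wrinv ?t' x e = {}" using wr 2 m False by (simp split: if_splits)
        moreover have "ev_wval e x = (if x \<in> obj e then outcome Op e undefined else None)"
        proof (cases "x \<in> obj e")
          case True
          then have "\<not> os_rspec Op e" using False by blast
          from non_read_outcome[OF e(1) this, of v undefined] show ?thesis using True val v by simp
        qed (use val in simp)
        ultimately show ?thesis unfolding 2 if_not_P[OF False] by blast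
      qed
    qed
  qed
  ultimately show ?case by (intro conjI)
qed

definition local_run ::
  "('id, 'rep, 'op, 'obj, 'val, 'meta) event \<Rightarrow>
   ('id, 'rep, 'op, 'obj, 'val, 'meta, 'l, 'msg) iaction list \<Rightarrow>
   ('id, 'rep, 'op, 'obj, 'val, 'meta) execution" where
  "local_run i t =
     \<lparr>x_hist = \<lparr>h_events = insert i (tr_events t), h_so = tr_so i t, h_wrinv = tr_wrinv t\<rparr>,
      x_rb = tr_so i t, x_ar = list_ord (i # do_evs t)\<rparr>"

lemma local_run_sel [simp]:
  "x_events (local_run i t) = insert i (tr_events t)" "x_so (local_run i t) = tr_so i t"
  "x_wrinv (local_run i t) = tr_wrinv t" "x_rb (local_run i t) = tr_so i t"
  "x_ar (local_run i t) = list_ord (i # do_evs t)"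
  by (simp_all add: local_run_def)

text \<open>Every read takes its value from a \<open>so\<close>-predecessor, so \<open>wr\<close>
  lies in \<open>so\<close>, which is transitive and contained in the linear order of the trace.
  Acyclicity and the closure of \<open>rb\<close> under \<open>so\<close> follow.\<close>

lemma local_run_execution:
  assumes i: "i \<in> Init" "i \<in> os_events Op" and t: "is_trace (local_impl i) t"
  shows "is_execution Init (local_run i t)" (is "is_execution Init ?\<xi>")
proof -
  from local_impl_invariant[OF i t] have inv: "distinct (i # do_evs t)" "tr_events t \<subseteq> calls Init Op"
    "trans (tr_so i t)" "tr_so i t \<subseteq> list_ord (i # do_evs t)"
    "\<forall>a \<in> tr_events t. \<forall>b \<in> tr_events t. a \<noteq> b \<longrightarrow>
      ((a, b) \<in> tr_so i t \<or> (b, a) \<in> tr_so i t \<longleftrightarrow> ev_rep a = ev_rep b)"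
    "{i} \<times> tr_events t \<subseteq> tr_so i t" "locally_read i t"
    by - (elim conjE, assumption)+
  have set: "set (i # do_evs t) = insert i (tr_events t)" by (simp add: set_do_evs)
  have lin: "strict_linear_order_on (insert i (tr_events t)) (list_ord (i # do_evs t))"
    using list_ord_linear[OF inv(1)] unfolding set .
  then have tr: "trans (list_ord (i # do_evs t))" and irr: "irrefl (list_ord (i # do_evs t))"
    unfolding strict_linear_order_on_def by blast+
  have sub: "list_ord (i # do_evs t) \<subseteq> insert i (tr_events t) \<times> insert i (tr_events t)"
    using list_ord_subset[of "i # do_evs t"] unfolding set .
  have evI: "tr_events t \<inter> Init = {}" using inv(2) calls_not_init by blast
  have irr_so: "irrefl (tr_so i t)" using irr inv(4) by (auto simp: irrefl_def)
  have wrinv: "tr_wrinv t x i = {}" for x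
  proof -
    have "i \<notin> tr_events t" using evI i(1) by blast
    then show ?thesis by (auto simp: tr_wrinv_def tr_events_def)
  qed
  have wr: "(w, e) \<in> tr_so i t" if "e \<in> tr_events t" "w \<in> tr_wrinv t x e" for w e x
  proof -
    have "if os_rspec Op e \<and> x \<in> obj e
     then \<exists>w. tr_wrinv t x e = {w} \<and>
       is_max_in (list_ord (i # do_evs t)) {a. (a, e) \<in> tr_so i t \<and> writes a x} w \<and>
       ev_wval e x = Option.bind (ev_wval w x) (outcome Op e)
     else tr_wrinv t x e = {} \<and> ev_wval e x = (if x \<in> obj e then outcome Op e undefined else None)"
      using inv(7) that(1) unfolding locally_read_def by blast
    then show ?thesis using that(2) by (auto simp: is_max_in_def split: if_splits)
  qed
  have wr_so: "x_wr ?\<xi> \<subseteq> tr_so i t" using wr wrinv by (auto simp: h_wr_def)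
  have so_wr: "tr_so i t \<union> x_wr ?\<xi> = tr_so i t" using wr_so by blast
  have hist: "is_history Init (x_hist ?\<xi>)"
    unfolding is_history_def
  proof (intro conjI)
    show "finite (x_events ?\<xi>)" by (simp add: finite_tr_events)
    show "x_so ?\<xi> \<subseteq> x_events ?\<xi> \<times> x_events ?\<xi>" using inv(4) sub by auto
    show "irrefl (x_so ?\<xi>)" "trans (x_so ?\<xi>)" using irr_so inv(3) by simp_all
    show "\<exists>j. x_events ?\<xi> \<inter> Init = {j} \<and> (\<forall>e\<in>x_events ?\<xi> - {j}. (j, e) \<in> x_so ?\<xi>)"
      using evI i(1) inv(6) by (intro exI[of _ i]) auto
    have "x_events ?\<xi> - Init = tr_events t" using evI i(1) by auto
    then show "\<forall>e\<in>x_events ?\<xi> - Init. \<forall>e'\<in>x_events ?\<xi> - Init. e \<noteq> e' \<longrightarrow>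
        ((e, e') \<in> x_so ?\<xi> \<or> (e', e) \<in> x_so ?\<xi>) = (ev_rep e = ev_rep e')"
      using inv(5) by (simp only: local_run_sel)
    show "\<forall>x. \<forall>e\<in>x_events ?\<xi>. x_wrinv ?\<xi> x e \<subseteq> x_events ?\<xi>"
    proof (intro allI ballI subsetI)
      fix x e w assume "e \<in> x_events ?\<xi>" "w \<in> x_wrinv ?\<xi> x e"
      then have "(w, e) \<in> tr_so i t" using wr wrinv by auto
      then show "w \<in> x_events ?\<xi>" using tr_so_subset[of i t] by auto
    qed
    have "acyclic (tr_so i t)" unfolding acyclic_def trancl_id[OF inv(3)] using irr_so by (simp add: irrefl_def)
    then show "acyclic (x_so ?\<xi> \<union> x_wr ?\<xi>)" using so_wr by simp
  qed
  have "tr_so i t O (tr_so i t)\<^sup>* = tr_so i t"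
    unfolding trancl_unfold_left[symmetric] by (rule trancl_id[OF inv(3)])
  moreover have "asym (tr_so i t)"
  proof (rule asymI)
    fix a b assume "(a, b) \<in> tr_so i t"
    then show "(b, a) \<notin> tr_so i t" using transD[OF inv(3)] irr_so by (auto simp: irrefl_def)
  qed
  ultimately show ?thesis
    unfolding is_execution_def local_run_sel
    using hist lin sub inv(4) wr_so irr_so by simp
qed

text \<open>Contexts consist exactly of the writing \<open>so\<close>-predecessors:
  \<open>wsem_local\<close> admits nothing else, and the \<open>so\<close> formula of a basic model
  supplies all of them. Thus \<open>locally_read\<close> is validity.\<close>

lemma local_run_valid:
  assumes i: "i \<in> Init" "i \<in> os_events Op" and t: "is_trace (local_impl i) t"
    and C: "is_basic_model Init C" "\<And>v. v \<in> C \<Longrightarrow> simple v \<and> v \<noteq> [] \<and> RAr \<notin> set v"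
  shows "valid Init obj C Op (local_run i t)" (is "valid Init obj C Op ?\<xi>")
proof -
  from local_impl_invariant[OF i t] have inv: "tr_events t \<subseteq> calls Init Op" "locally_read i t"
    by - (elim conjE, assumption)+
  note ex = local_run_execution[OF i t]
  note cl = is_execution_rel_closed[OF ex]
  obtain v where v: "v \<in> C" "\<forall>\<xi>. is_execution Init \<xi> \<longrightarrow>
      (\<forall>x e r. (e, r) \<in> x_so \<xi> \<and> writes e x \<and> x_wrinv \<xi> x r \<noteq> {} \<longrightarrow> vis \<xi> v x e r)"
    using C(1) unfolding is_basic_model_def by (elim conjE bexE) (rule that)
  have ctxt: "ctxt ?\<xi> C x e = {a. (a, e) \<in> tr_so i t \<and> writes a x}" if "tr_wrinv t x e \<noteq> {}" for x e
  proof (intro equalityI subsetI)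
    fix a assume "a \<in> ctxt ?\<xi> C x e"
    then obtain u where u: "u \<in> C" "vis ?\<xi> u x a e" by (auto simp: ctxt_def)
    have "wsem ?\<xi> u \<subseteq> x_so ?\<xi>" using C(2)[OF u(1)] by (intro wsem_local[OF ex]) simp_all
    then show "a \<in> {a. (a, e) \<in> tr_so i t \<and> writes a x}" using u(2) unfolding vis_iff_wsem[OF cl] by auto
  next
    fix a assume a: "a \<in> {a. (a, e) \<in> tr_so i t \<and> writes a x}"
    then have "vis ?\<xi> v x a e" using v(2)[rule_format, OF ex, of a e x] that by simp
    then show "a \<in> ctxt ?\<xi> C x e" using v(1) unfolding ctxt_def vis_def by blast
  qed
  have evI: "tr_events t \<inter> Init = {}" using inv(1) calls_not_init by blast
  show ?thesis
    unfolding valid_def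
  proof (intro conjI ballI allI)
    show "x_events ?\<xi> \<subseteq> os_events Op" using i inv(1) calls_not_init by auto
  next
    fix e x assume "e \<in> x_events ?\<xi> \<inter> Init"
    then have "e \<notin> tr_events t" using evI by blast
    then show "x_wrinv ?\<xi> x e = {}" by (auto simp: tr_wrinv_def tr_events_def)
  next
    fix e x assume "e \<in> x_events ?\<xi> - Init"
    then have e: "e \<in> tr_events t" "e \<in> calls Init Op" using i(1) inv(1) by auto
    have r: "if os_rspec Op e \<and> x \<in> obj e
     then \<exists>w. tr_wrinv t x e = {w} \<and>
       is_max_in (list_ord (i # do_evs t)) {a. (a, e) \<in> tr_so i t \<and> writes a x} w \<and>
       ev_wval e x = Option.bind (ev_wval w x) (outcome Op e)
     else tr_wrinv t x e = {} \<and> ev_wval e x = (if x \<in> obj e then outcome Op e undefined else None)"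
      using inv(2) e(1) unfolding locally_read_def by blast
    show "if os_rspec Op e \<and> x \<in> obj e
      then \<exists>w. is_max_in (x_ar ?\<xi>) (ctxt ?\<xi> C x e) w \<and> x_wrinv ?\<xi> x e = {w} \<and>
               ev_wval e x = Option.bind (ev_wval w x) (outcome Op e)
      else x_wrinv ?\<xi> x e = {} \<and>
           (if x \<in> obj e then \<forall>v. ev_wval e x = outcome Op e v else ev_wval e x = None)"
    proof (cases "os_rspec Op e \<and> x \<in> obj e")
      case True
      then obtain w where w: "tr_wrinv t x e = {w}"
        "is_max_in (list_ord (i # do_evs t)) {a. (a, e) \<in> tr_so i t \<and> writes a x} w"
        "ev_wval e x = Option.bind (ev_wval w x) (outcome Op e)"
        using r unfolding if_P[OF True] by blast
      have "is_max_in (x_ar ?\<xi>) (ctxt ?\<xi> C x e) w" using w(2) ctxt[of x e] w(1) by simp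
      moreover have "x_wrinv ?\<xi> x e = {w}" using w(1) by simp
      ultimately show ?thesis unfolding if_P[OF True] using w(3) by blast
    next
      case False
      note r' = r[unfolded if_not_P[OF False]]
      have "x_wrinv ?\<xi> x e = {}" using r' by simp
      moreover have "if x \<in> obj e then \<forall>v. ev_wval e x = outcome Op e v else ev_wval e x = None"
      proof (cases "x \<in> obj e")
        case True
        then have "\<not> os_rspec Op e" using False by blast
        then have "outcome Op e undefined = outcome Op e v" for v using non_read_outcome[OF e(2)] by blast
        then show ?thesis using True r' by simp
      qed (use r' in simp)
      ultimately show ?thesis unfolding if_not_P[OF False] by blast
    qed
  qed
qed

lemma local_impl_implementation:
  assumes i: "i \<in> Init" "i \<in> os_events Op"
  shows "is_implementation Init Op (local_impl i)"
  unfolding is_implementation_def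
proof (intro conjI allI impI)
  show "is_lts (local_impl i)" using local_impl_lts[OF i(2)] .
next
  fix t assume t: "is_trace (local_impl i) t"
  from local_impl_invariant[OF i this] have inv: "no_recv t" "\<forall>r l n S. Send r l n S \<notin> set t"
    "distinct (map ia_ident t)"
    by - (elim conjE, assumption)+
  have "ia_rbset (t ! k) = {}" if "k < length t" for k
    using inv(1,2) nth_mem[OF that] by (cases "t ! k") (auto simp: no_recv_def)
  then show "wf_itrace t" unfolding wf_itrace_def using inv by auto
qed auto

lemma local_impl_spec:
  assumes i: "i \<in> Init" "i \<in> os_events Op"
    and C: "is_basic_model Init C" "\<And>v. v \<in> C \<Longrightarrow> simple v \<and> v \<noteq> [] \<and> RAr \<notin> set v"
    and eq: "equivalent_models Init obj Op CMod C"
  shows "is_spec_implementation Init obj CMod Op (local_impl i)"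
  unfolding is_spec_implementation_def
proof (intro conjI allI impI)
  show "is_implementation Init Op (local_impl i)" by (rule local_impl_implementation[OF i])
next
  fix t assume t: "is_trace (local_impl i) t"
  from local_impl_invariant[OF i this] have "no_recv t" by blast
  note ex = local_run_execution[OF i t]
  have "valid Init obj CMod Op (local_run i t)"
    using local_run_valid[OF i t C] eq ex unfolding equivalent_models_def by blast
  moreover have "induces Init t (local_run i t)"
    unfolding induces_def using ex i(1) tr_rb_no_recv[OF \<open>no_recv t\<close>]
    by (intro conjI bexI[of _ i]) (simp_all add: local_run_def)
  ultimately show "\<exists>\<xi>. induces Init t \<xi> \<and> valid Init obj CMod Op \<xi>" by blast
qed

section \<open>Availability of the local implementation\<close>

lemma comp_local_impl_trans:
  assumes "lts.trans (comp (local_impl i) P) (s, p) a = Some (s', p')"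
  shows "(\<exists>e m. a = Impl (Do e m) \<and> local_step i s e m \<and> s' = s @ [Do e m] \<and>
      lts.trans P p (PEvent e) = Some p') \<or>
    (\<exists>r l. a = Prog (PLocal r l) \<and> s' = s \<and> lts.trans P p (PLocal r l) = Some p')"
proof (cases a)
  case (Impl b)
  then show ?thesis using assms by (cases b) (auto simp: comp_def split: option.splits if_splits)
next
  case (Prog b)
  then show ?thesis using assms by (cases b) (auto simp: comp_def)
qed

text \<open>Events are executed jointly with the program, so each identifier stored in the state
  also occurs in the program's trace. Freshness of identifiers can then be taken from the
  program.\<close>

lemma comp_local_impl_run:
  assumes "run_from (comp (local_impl i) P) (s, p) tc = Some (s', p')"
  shows "run_from P p (prog_part tc) = Some p' \<and>
    (\<forall>e \<in> tr_events s'. e \<in> tr_events s \<or> PEvent e \<in> set (prog_part tc)) \<and>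
    (is_trace (local_impl i) s \<longrightarrow> is_trace (local_impl i) s')"
  using assms
proof (induction tc arbitrary: s p)
  case (Cons a tc)
  then obtain s1 p1 where 1: "lts.trans (comp (local_impl i) P) (s, p) a = Some (s1, p1)"
    "run_from (comp (local_impl i) P) (s1, p1) tc = Some (s', p')"
    by (auto split: option.splits)
  note IH = Cons.IH[OF 1(2)]
  from comp_local_impl_trans[OF 1(1)] show ?case
  proof (elim disjE exE conjE)
    fix e m assume "a = Impl (Do e m)" "local_step i s e m" "s1 = s @ [Do e m]"
      "lts.trans P p (PEvent e) = Some p1"
    then show ?thesis using IH local_impl_trace_snoc[of i s "Do e m"] by auto
  next
    fix r l assume "a = Prog (PLocal r l)" "s1 = s" "lts.trans P p (PLocal r l) = Some p1"
    then show ?thesis using IH by auto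
  qed
qed simp

text \<open>The implementation has no actions of its own, so every step of the composition is a step
  of the program and an infinite run would project to one of \<open>P\<close>.\<close>

lemma local_impl_finite:
  assumes "finite_lts P"
  shows "finite_lts (comp (local_impl i) P)" (is "finite_lts ?L")
  unfolding finite_lts_def
proof
  assume "\<exists>\<sigma> \<alpha>. \<sigma> 0 = start ?L \<and> (\<forall>n. lts.trans ?L (\<sigma> n) (\<alpha> n) = Some (\<sigma> (Suc n)))"
  then obtain \<sigma> \<alpha> where 0: "\<sigma> 0 = start ?L" and \<sigma>: "\<And>n. lts.trans ?L (\<sigma> n) (\<alpha> n) = Some (\<sigma> (Suc n))"
    by auto
  have "\<exists>b. lts.trans P (snd (\<sigma> n)) b = Some (snd (\<sigma> (Suc n)))" for n
    using comp_local_impl_trans[of i P "fst (\<sigma> n)" "snd (\<sigma> n)" "\<alpha> n" "fst (\<sigma> (Suc n))" "snd (\<sigma> (Suc n))"] \<sigma>[of n]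
    by auto
  then have "lts.trans P (snd (\<sigma> n)) (SOME b. lts.trans P (snd (\<sigma> n)) b = Some (snd (\<sigma> (Suc n)))) =
      Some (snd (\<sigma> (Suc n)))" for n by (rule someI_ex)
  moreover have "snd (\<sigma> 0) = start P" using 0 by (simp add: comp_def)
  ultimately have "\<exists>\<sigma> \<alpha>. \<sigma> 0 = start P \<and> (\<forall>n. lts.trans P (\<sigma> n) (\<alpha> n) = Some (\<sigma> (Suc n)))"
    by (intro exI[of _ "\<lambda>n. snd (\<sigma> n)"]
        exI[of _ "\<lambda>n. SOME b. lts.trans P (snd (\<sigma> n)) b = Some (snd (\<sigma> (Suc n)))"]) simp
  then show False using assms unfolding finite_lts_def by simp
qed

lemma lts_run_states: "is_lts L \<Longrightarrow> s \<in> states L \<Longrightarrow> run_from L s t = Some s' \<Longrightarrow> s' \<in> states L"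
proof (induction t arbitrary: s)
  case (Cons a t)
  then show ?case unfolding is_lts_def by (auto split: option.splits)
qed simp

text \<open>A pending call can be answered at once. The value it reads is fixed by the state, and
  the program offers the matching outcome along with the others.\<close>

lemma local_impl_not_waiting:
  fixes P :: "('p, ('id, 'rep, 'op, 'obj, 'val, 'meta, 'l) paction) lts"
  assumes i: "i \<in> Init" "i \<in> os_events Op" and P: "is_program Init obj Op P"
    and tc: "is_trace (comp (local_impl i) P) tc"
  shows "\<not> waiting (local_impl i) P tc r"
proof
  let ?L = "comp (local_impl i) P"
  assume w: "waiting (local_impl i) P tc r"
  then obtain a where a: "a \<in> actions P" "pa_rep a = r" "enabled_after P (prog_part tc) a"
    unfolding waiting_def by blast
  have dis: "\<not> enabled_after ?L tc b" if "b \<in> actions ?L" "ca_rep b = r" "\<not> is_receive b" for b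
    using w that unfolding waiting_def by blast
  obtain s p where sp: "run_from ?L (start ?L) tc = Some (s, p)" using tc by (auto simp: is_trace_def)
  have start: "start ?L = ([], start P)" by (simp add: comp_def)
  note run = comp_local_impl_run[OF sp[unfolded start]]
  have p: "lts.trans P p a \<noteq> None" using a(3) run unfolding enabled_after_def by auto
  show False
  proof (cases a)
    case (PLocal r' l)
    have "Prog a \<in> actions ?L" using a(1) PLocal by (simp add: comp_def)
    moreover have "enabled_after ?L tc (Prog a)"
      using sp p PLocal by (auto simp: enabled_after_def comp_def)
    ultimately show False using dis[of "Prog a"] a(2) by (simp add: is_receive_def)
  next
    case (PEvent e)
    have e: "e \<in> calls Init Op" using a(1) P PEvent unfolding is_program_def by blast
    obtain x where x: "obj e = {x}" using calls_obj[OF e] by blast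
    let ?w = "last_write i s (ev_rep e) x"
    obtain v where v: "ev_wval ?w x = Some v" using writes_last_write[OF i(1)] by (force simp: writes_def)
    \<comment> \<open>The event \<open>e\<close> enabled by the program may carry wrong values;
      \<open>e'\<close> is the outcome of the same call for the value \<open>v\<close> that the
      replica will read.\<close>
    obtain e' where e': "e' \<in> calls Init Op" "same_call obj Op e e'"
      "ev_wval e' = (\<lambda>x. if x \<in> obj e then outcome Op e v else None)"
      by (rule ex_outcome[OF e, where v = v])
    note sc = same_callD[OF e'(2)]
    have "is_trace (local_impl i) []" by (simp add: is_trace_def)
    then have s: "is_trace (local_impl i) s" using run by blast
    have sub: "tr_events s \<subseteq> calls Init Op" using local_impl_invariant[OF i s] by - (elim conjE, assumption)
    have plts: "is_lts P" and "p \<in> states P"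
    proof -
      show "is_lts P" using P unfolding is_program_def by blast
      then show "p \<in> states P" using lts_run_states[of P "start P"] run unfolding is_lts_def by blast
    qed
    then have pe': "lts.trans P p (PEvent e') \<noteq> None"
      using P p e e'(1,2) PEvent unfolding is_program_def by blast
    have fresh: "ev_id e' \<notin> ev_id ` tr_events s"
    proof
      assume "ev_id e' \<in> ev_id ` tr_events s"
      then obtain f where "f \<in> tr_events s" "ev_id f = ev_id e'" by auto
      then have f: "PEvent f \<in> set (prog_part tc)" "ev_id f = ev_id e'" using run by auto
      \<comment> \<open>If the identifier had been used, this trace of the program would contain it
        twice.\<close>
      have "is_trace P (prog_part tc @ [PEvent e'])"
        using run pe' by (auto simp: is_trace_def run_from_append split: option.splits)
      then have "distinct (map pa_ident (prog_part tc @ [PEvent e']))"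
        using P unfolding is_program_def by blast
      then show False using f by force
    qed
    define m where "m = (\<lambda>x. if os_rspec Op e' \<and> x \<in> obj e' then Some {last_write i s (ev_rep e') x} else None)"
    have oc: "outcome Op e' u = outcome Op e u" for u using outcome_cong[OF sc(5)] .
    have "ev_wval e' = (\<lambda>x. if x \<in> obj e'
        then Option.bind (ev_wval (last_write i s (ev_rep e') x) x) (outcome Op e') else None)"
      unfolding e'(3) sc(2,3) x by (auto simp: fun_eq_iff v oc)
    then have st: "local_step i s e' m" unfolding local_step_def m_def using sub e'(1) fresh by blast
    have "Impl (Do e' m) \<in> actions ?L"
      using local_step_action[OF i(2) st] unfolding comp_def by simp
    moreover have "enabled_after ?L tc (Impl (Do e' m))"
      using sp st pe' by (auto simp: enabled_after_def comp_def split: option.splits)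
    ultimately show False using dis[of "Impl (Do e' m)"] a(2) PEvent sc(2) by (simp add: is_receive_def)
  qed
qed

lemma arbitration_free_available_impl:
  assumes "arbitration_free Init obj Op CMod"
  shows "\<exists>I :: ('id, 'rep, 'op, 'obj, 'val, 'meta, 'l, 'msg) implementation.
    is_spec_implementation Init obj CMod Op I \<and> available Init obj Op I"
proof -
  obtain C where C: "is_basic_model Init C" "\<forall>v\<in>C. simple v \<and> \<not> vacuous Init obj Op C v"
    "equivalent_models Init obj Op CMod C" "\<forall>v\<in>C. arbitration_free_formula v"
    using assms unfolding arbitration_free_def is_normal_form_of_def in_normal_form_def by auto
  have ne: "C \<noteq> {}" "\<forall>v\<in>C. v \<noteq> []"
    using C(1) unfolding is_basic_model_def by - (elim conjE, assumption)+
  then obtain v where "v \<in> C" by auto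
  then have "\<not> vacuous Init obj Op C v" using C(2) by simp
  \<comment> \<open>Non-vacuity supplies the initial event that the implementation starts from: an
    execution on which \<open>C\<close> and \<open>C - {v}\<close> differ is valid for one of them,
    so its initial event belongs to the operation specification.\<close>
  then obtain \<xi> where \<xi>: "is_execution Init \<xi>" "valid Init obj C Op \<xi> \<noteq> valid Init obj (C - {v}) Op \<xi>"
    unfolding vacuous_def equivalent_models_def by auto
  then have os: "x_events \<xi> \<subseteq> os_events Op" by (auto simp: valid_def)
  have "is_history Init (x_hist \<xi>)" using \<xi>(1) unfolding is_execution_def by - (elim conjE, assumption)
  then obtain i where "x_events \<xi> \<inter> Init = {i}" unfolding is_history_def by (elim conjE exE)
  then have i: "i \<in> Init" "i \<in> os_events Op" using os by blast+
  have C': "simple v \<and> v \<noteq> [] \<and> RAr \<notin> set v" if "v \<in> C" for v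
    using C(2,4) ne(2) that arbitration_free_simple[of v] by simp
  let ?I = "local_impl i :: ('id, 'rep, 'op, 'obj, 'val, 'meta, 'l, 'msg) implementation"
  have "is_spec_implementation Init obj CMod Op ?I" by (rule local_impl_spec[OF i C(1) C' C(3)])
  moreover have "available Init obj Op ?I"
    unfolding available_def
  proof (intro allI impI conjI)
    fix P :: "(('id, 'rep, 'op, 'obj, 'val, 'meta, 'l) paction list,
      ('id, 'rep, 'op, 'obj, 'val, 'meta, 'l) paction) lts" and t r
    assume P: "is_program Init obj Op P"
    show "finite_lts (comp ?I P)" if "finite_lts P" by (rule local_impl_finite[OF that])
    show "\<not> waiting ?I P t r" if "is_trace (comp ?I P) t" by (rule local_impl_not_waiting[OF i P that])
  qed
  ultimately show ?thesis by blast
qed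

end

theorem theorem6p3:
  fixes Init :: "('id, 'rep, 'op, 'obj, 'val, 'meta) event set"
    and obj :: "('id, 'rep, 'op, 'obj, 'val, 'meta) event \<Rightarrow> 'obj set"
    and CMod :: "vformula set"
    and Op :: "('id, 'rep, 'op, 'obj, 'val, 'meta) opspec"
  assumes "infinite (UNIV :: 'obj set)"
    and "infinite (UNIV :: 'id set)"
    and "\<exists>r r' :: 'rep. r \<noteq> r'"
    and "event_universe Init obj"
    and "is_basic_model Init CMod"
    and "is_basic_opspec Init obj Op"
  shows "arbitration_free Init obj Op CMod \<longleftrightarrow>
    (\<exists>I :: ('id, 'rep, 'op, 'obj, 'val, 'meta, 'l, 'msg) implementation.
       is_spec_implementation Init obj CMod Op I \<and> available Init obj Op I)"
proof -
  interpret basic_storage Init obj CMod Op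
    using assms by (intro basic_storage.intro)
  show ?thesis
  proof
    assume "\<exists>I :: ('id, 'rep, 'op, 'obj, 'val, 'meta, 'l, 'msg) implementation.
      is_spec_implementation Init obj CMod Op I \<and> available Init obj Op I"
    then obtain I :: "('id, 'rep, 'op, 'obj, 'val, 'meta, 'l, 'msg) implementation" where
      "is_spec_implementation Init obj CMod Op I" "available Init obj Op I" by blast
    then interpret available_storage Init obj CMod Op I
      by unfold_locales
    show "arbitration_free Init obj Op CMod" by (rule arbitration_free)
  qed (rule arbitration_free_available_impl)
qed

end
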